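(* Let $\Gamma=(V,E)$ be a finite hypergraph. Let $G\subseteq \mathrm{GL}_n$ be a connected linear algebraic group defined over $\mathbb{R}$, and let $H\subseteq G(\mathbb{R})$ be a closed and connected subgroup (for the Euclidean topology). Then there is a dense open subset $U\subseteq C_{G(\mathbb{R}),H}$ (for the Euclidean topology) such that the functions $\rho\mapsto \dim H^0(I(\Gamma),\mathcal{M}_\rho)$ and $\rho\mapsto\dim H^1(I(\Gamma),\mathcal{M}_\rho)$ are constant on $U$.
   Context: $G(\mathbb{R})$ denotes the Lie group of real points. For a Lie group $G$ and closed Lie subgroup $H$, $C_{G,H}$ is the set of assignments $\rho$ with $\rho(v)=g_vHg_v^{-1}$ ($g_v\in G$) for $v\in V$ and $\rho(e)=\bigcap_{v\in e}\rho(v)$ for $e\in E$; it is identified with $(G/N_G(H))^V$, $N_G(H)=\{g:gHg^{-1}=H\}$, and given the corresponding manifold (Euclidean) topology. With $\mathfrak{g}$ the Lie algebra of $G(\mathbb{R})$ and $\mathfrak{h}_x$ the Lie algebra of $\rho(x)$, the motion sheaf $\mathcal{M}_\rho$ is the sheaf on the incidence graph $I(\Gamma)$ (vertices $V\cup E$, an edge $v\sim e$ whenever $v\in e$) with $\mathcal{M}(x)=\mathfrak{g}/\mathfrak{h}_x$, $\mathcal{M}(v\sim e)=\mathfrak{g}/\mathfrak{h}_v$, restriction maps the identity from $\mathcal{M}(v)$ and the reduction from $\mathcal{M}(e)$. Cohomology of a sheaf on a graph: $H^0=\ker d$, $H^1=\operatorname{coker} d$ for the signed coboundary $d:\bigoplus_{\text{vertices}}\mathcal{F}\to\bigoplus_{\text{edges}}\mathcal{F}$,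 $d(w)_e=\sum_{x\in e}[x:e]r^x_e(w_x)$ with $[x:e]=-[y:e]$ for $e=xy$. *)

theory Defs
  imports "HOL-Analysis.Analysis" "HOL-Algebra.AbelCoset"
    "Jordan_Normal_Form.Missing_VectorSpace" "HOL-Library.Poly_Mapping"
begin

section \<open>Real vector spaces with explicit carriers\<close>

text \<open>Vector spaces are records of the type \<^typ>\<open>('a, 'b) module\<close>, so that subspaces, quotients and
  direct sums live on one type and their dimension is \<^const>\<open>vectorspace.dim\<close>. The fields
  \<open>mult\<close> and \<open>one\<close> play no role in a module.\<close>

definition real_scalars :: "real ring" where
  "real_scalars = \<lparr>carrier = UNIV, monoid.mult = (*), one = 1, zero = 0, add = (+)\<rparr>"

definition subspace_module :: "'a::real_vector set \<Rightarrow> (real, 'a) module" where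
  "subspace_module S = \<lparr>carrier = S, monoid.mult = undefined, one = undefined,
     zero = 0, add = (+), smult = (*\<^sub>R)\<rparr>"

text \<open>In the quotient \<open>M / W\<close> the scalar multiple \<open>c \<cdot> A\<close> is \<open>W + {c \<cdot> a | a \<in> A}\<close>; without the summand
  \<open>W\<close> it would fail to be a coset for \<open>c = 0\<close>.\<close>

definition quot_module :: "(real, 'b) module \<Rightarrow> 'b set \<Rightarrow> (real, 'b set) module" where
  "quot_module M W = \<lparr>carrier = a_rcosets\<^bsub>M\<^esub> W, monoid.mult = undefined, one = undefined,
     zero = W, add = set_add M, smult = (\<lambda>c A. W <+>\<^bsub>M\<^esub> ((\<lambda>a. c \<odot>\<^bsub>M\<^esub> a) ` A))\<rparr>"

definition prod_module :: "'i set \<Rightarrow> ('i \<Rightarrow> (real, 'b) module) \<Rightarrow> (real, 'i \<Rightarrow> 'b) module" where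
  "prod_module I M = \<lparr>carrier = (\<Pi>\<^sub>E i\<in>I. carrier (M i)), monoid.mult = undefined, one = undefined,
     zero = (\<lambda>i\<in>I. \<zero>\<^bsub>M i\<^esub>), add = (\<lambda>f g. \<lambda>i\<in>I. f i \<oplus>\<^bsub>M i\<^esub> g i),
     smult = (\<lambda>c f. \<lambda>i\<in>I. c \<odot>\<^bsub>M i\<^esub> f i)\<rparr>"

section \<open>Sheaves on graphs and their cohomology\<close>

record ('x, 'a) graph =
  verts :: "'x set"
  edges :: "'a set"
  ends :: "'a \<Rightarrow> 'x set"

record ('x, 'a, 'm) graph_sheaf =
  vstalk :: "'x \<Rightarrow> (real, 'm) module"
  estalk :: "'a \<Rightarrow> (real, 'm) module"
  restr :: "'x \<Rightarrow> 'a \<Rightarrow> 'm \<Rightarrow> 'm"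

definition incidence_signs :: "('x, 'a) graph \<Rightarrow> ('x \<Rightarrow> 'a \<Rightarrow> real) \<Rightarrow> bool" where
  "incidence_signs \<Gamma> s \<longleftrightarrow>
     (\<forall>a\<in>edges \<Gamma>. \<forall>x\<in>ends \<Gamma> a. s x a \<in> {1, -1} \<and> (\<forall>y\<in>ends \<Gamma> a. x \<noteq> y \<longrightarrow> s x a = - s y a))"

definition cochains0 :: "('x, 'a) graph \<Rightarrow> ('x, 'a, 'm) graph_sheaf \<Rightarrow> (real, 'x \<Rightarrow> 'm) module" where
  "cochains0 \<Gamma> F = prod_module (verts \<Gamma>) (vstalk F)"

definition cochains1 :: "('x, 'a) graph \<Rightarrow> ('x, 'a, 'm) graph_sheaf \<Rightarrow> (real, 'a \<Rightarrow> 'm) module" where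
  "cochains1 \<Gamma> F = prod_module (edges \<Gamma>) (estalk F)"

definition coboundary ::
  "('x, 'a) graph \<Rightarrow> ('x \<Rightarrow> 'a \<Rightarrow> real) \<Rightarrow> ('x, 'a, 'm) graph_sheaf \<Rightarrow> ('x \<Rightarrow> 'm) \<Rightarrow> 'a \<Rightarrow> 'm" where
  "coboundary \<Gamma> s F w =
     (\<lambda>a\<in>edges \<Gamma>. finsum (estalk F a) (\<lambda>x. s x a \<odot>\<^bsub>estalk F a\<^esub> restr F x a (w x)) (ends \<Gamma> a))"

definition H0 ::
  "('x, 'a) graph \<Rightarrow> ('x \<Rightarrow> 'a \<Rightarrow> real) \<Rightarrow> ('x, 'a, 'm) graph_sheaf \<Rightarrow> (real, 'x \<Rightarrow> 'm) module" where
  "H0 \<Gamma> s F = (cochains0 \<Gamma> F)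
     \<lparr>carrier := {w \<in> carrier (cochains0 \<Gamma> F). coboundary \<Gamma> s F w = \<zero>\<^bsub>cochains1 \<Gamma> F\<^esub>}\<rparr>"

definition H1 ::
  "('x, 'a) graph \<Rightarrow> ('x \<Rightarrow> 'a \<Rightarrow> real) \<Rightarrow> ('x, 'a, 'm) graph_sheaf \<Rightarrow> (real, ('a \<Rightarrow> 'm) set) module" where
  "H1 \<Gamma> s F = quot_module (cochains1 \<Gamma> F) (coboundary \<Gamma> s F ` carrier (cochains0 \<Gamma> F))"

section \<open>Linear algebraic groups over the reals\<close>

definition GL :: "('a::field^'n^'n) monoid" where
  "GL = \<lparr>carrier = {A. invertible A}, monoid.mult = (**), one = mat 1\<rparr>"

text \<open>Polynomials in the matrix entries: the variables are the pairs \<^typ>\<open>'n \<times> 'n\<close>.\<close>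

definition eval_poly :: "(('n \<times> 'n \<Rightarrow>\<^sub>0 nat) \<Rightarrow>\<^sub>0 complex) \<Rightarrow> complex^'n^'n \<Rightarrow> complex" where
  "eval_poly p A = (\<Sum>m\<in>Poly_Mapping.keys p. Poly_Mapping.lookup p m *
     (\<Prod>i\<in>UNIV. \<Prod>j\<in>UNIV. A $ i $ j ^ Poly_Mapping.lookup m (i, j)))"

definition zariski :: "(complex^'n^'n) topology" where
  "zariski = topology_generated_by (range (\<lambda>p. {A. eval_poly p A \<noteq> 0}))"

text \<open>A linear algebraic group is given by its complex points. As the reals are a perfect field, it is
  defined over them iff it is cut out in the general linear group by polynomials with real coefficients.\<close>

definition real_algebraic_group :: "(complex^'n^'n) set \<Rightarrow> bool" where
  "real_algebraic_group G \<longleftrightarrow> subgroup G GL \<and>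
     (\<exists>P. (\<forall>p\<in>P. range (Poly_Mapping.lookup p) \<subseteq> \<real>) \<and>
       G = {A \<in> carrier GL. \<forall>p\<in>P. eval_poly p A = 0})"

definition real_points :: "(complex^'n^'n) set \<Rightarrow> (real^'n^'n) set" where
  "real_points G = {A. (\<chi> i j. complex_of_real (A $ i $ j)) \<in> G}"

text \<open>The Lie algebra of a closed matrix group, as its tangent space at the identity.\<close>

definition lie_algebra :: "(real^'n^'n) set \<Rightarrow> (real^'n^'n) set" where
  "lie_algebra K = {X. \<exists>\<gamma>. \<gamma> C1_differentiable_on UNIV \<and> range \<gamma> \<subseteq> K \<and> \<gamma> 0 = mat 1 \<and>
     (\<gamma> has_vector_derivative X) (at 0)}"

section \<open>The space of assignments\<close>

definition conj_set :: "real^'n^'n \<Rightarrow> (real^'n^'n) set \<Rightarrow> (real^'n^'n) set" where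
  "conj_set g H = (\<lambda>h. g ** h ** matrix_inv g) ` H"

definition normalizer_in :: "(real^'n^'n) set \<Rightarrow> (real^'n^'n) set \<Rightarrow> (real^'n^'n) set" where
  "normalizer_in G H = {g \<in> G. conj_set g H = H}"

definition hypergraph :: "'v set \<Rightarrow> 'v set set \<Rightarrow> bool" where
  "hypergraph V E \<longleftrightarrow> E \<subseteq> Pow V"

text \<open>The assignment \<open>\<rho>\<close> determined by a family \<open>g\<close> of group elements. The intersection with \<open>G\<close> only
  serves to give the value \<open>G\<close> on the empty hyperedge.\<close>

definition assignment_of ::
  "'v set \<Rightarrow> 'v set set \<Rightarrow> (real^'n^'n) set \<Rightarrow> (real^'n^'n) set \<Rightarrow> ('v \<Rightarrow> real^'n^'n) \<Rightarrow>
   'v + 'v set \<Rightarrow> (real^'n^'n) set" where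
  "assignment_of V E G H g = (\<lambda>x \<in> Inl ` V \<union> Inr ` E.
     case x of Inl v \<Rightarrow> conj_set (g v) H | Inr e \<Rightarrow> G \<inter> (\<Inter>v\<in>e. conj_set (g v) H))"

definition assignments ::
  "'v set \<Rightarrow> 'v set set \<Rightarrow> (real^'n^'n) set \<Rightarrow> (real^'n^'n) set \<Rightarrow>
   ('v + 'v set \<Rightarrow> (real^'n^'n) set) set" where
  "assignments V E G H = {assignment_of V E G H g | g. \<forall>v\<in>V. g v \<in> G}"

definition quotient_topology :: "'a topology \<Rightarrow> ('a \<Rightarrow> 'b) \<Rightarrow> 'b topology" where
  "quotient_topology X f =
     topology (\<lambda>U. U \<subseteq> f ` topspace X \<and> openin X {x \<in> topspace X. f x \<in> U})"

lemma openin_quotient_topology: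
  "openin (quotient_topology X f) U \<longleftrightarrow>
     U \<subseteq> f ` topspace X \<and> openin X {x \<in> topspace X. f x \<in> U}"
proof -
  have "istopology (\<lambda>U. U \<subseteq> f ` topspace X \<and> openin X {x \<in> topspace X. f x \<in> U})"
    unfolding istopology_def
  proof (intro conjI allI impI)
    fix S T assume "S \<subseteq> f ` topspace X \<and> openin X {x \<in> topspace X. f x \<in> S}"
      and "T \<subseteq> f ` topspace X \<and> openin X {x \<in> topspace X. f x \<in> T}"
    moreover have "{x \<in> topspace X. f x \<in> S \<inter> T} =
        {x \<in> topspace X. f x \<in> S} \<inter> {x \<in> topspace X. f x \<in> T}" by auto
    ultimately show "S \<inter> T \<subseteq> f ` topspace X" "openin X {x \<in> topspace X. f x \<in> S \<inter> T}"
      by auto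
  next
    fix K assume K: "\<forall>S\<in>K. S \<subseteq> f ` topspace X \<and> openin X {x \<in> topspace X. f x \<in> S}"
    then show "\<Union>K \<subseteq> f ` topspace X" by auto
    have "{x \<in> topspace X. f x \<in> \<Union>K} = (\<Union>S\<in>K. {x \<in> topspace X. f x \<in> S})" by auto
    with K show "openin X {x \<in> topspace X. f x \<in> \<Union>K}" by auto
  qed
  then show ?thesis
    by (simp add: quotient_topology_def topology_inverse')
qed

lemma topspace_quotient_topology: "topspace (quotient_topology X f) = f ` topspace X"
proof
  show "topspace (quotient_topology X f) \<subseteq> f ` topspace X"
    using openin_topspace[of "quotient_topology X f"] by (simp only: openin_quotient_topology)
  have "{x \<in> topspace X. f x \<in> f ` topspace X} = topspace X" by auto
  then show "f ` topspace X \<subseteq> topspace (quotient_topology X f)"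
    by (intro openin_subset) (simp add: openin_quotient_topology)
qed

definition coset_topology :: "(real^'n^'n) set \<Rightarrow> (real^'n^'n) set \<Rightarrow> (real^'n^'n) set topology" where
  "coset_topology G N = quotient_topology (top_of_set G) (\<lambda>g. g <#\<^bsub>GL\<^esub> N)"

text \<open>The topology transported along the bijection \<open>(g\<^sub>v N)\<^sub>v \<mapsto> \<rho>\<close> from \<open>(G / N)\<^sup>V\<close>, where \<open>N\<close> is the
  normalizer of \<open>H\<close>: the subgroup \<open>g H g\<^sup>-\<^sup>1\<close> does not depend on the representative \<open>g\<close> of its coset.\<close>

definition assignment_topology ::
  "'v set \<Rightarrow> 'v set set \<Rightarrow> (real^'n^'n) set \<Rightarrow> (real^'n^'n) set \<Rightarrow>
   ('v + 'v set \<Rightarrow> (real^'n^'n) set) topology" where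
  "assignment_topology V E G H =
     quotient_topology (product_topology (\<lambda>_. coset_topology G (normalizer_in G H)) V)
       (\<lambda>c. assignment_of V E G H (\<lambda>v. SOME g. g \<in> c v))"

section \<open>The motion sheaf\<close>

definition incidence_graph :: "'v set \<Rightarrow> 'v set set \<Rightarrow> ('v + 'v set, 'v \<times> 'v set) graph" where
  "incidence_graph V E = \<lparr>verts = Inl ` V \<union> Inr ` E, edges = {(v, e). v \<in> V \<and> e \<in> E \<and> v \<in> e},
     ends = (\<lambda>(v, e). {Inl v, Inr e})\<rparr>"

definition lie_quotient ::
  "(real^'n^'n) set \<Rightarrow> (real^'n^'n) set \<Rightarrow> (real, (real^'n^'n) set) module" where
  "lie_quotient G K = quot_module (subspace_module (lie_algebra G)) (lie_algebra K)"

definition motion_sheaf ::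
  "(real^'n^'n) set \<Rightarrow> ('v + 'v set \<Rightarrow> (real^'n^'n) set) \<Rightarrow>
   ('v + 'v set, 'v \<times> 'v set, (real^'n^'n) set) graph_sheaf" where
  "motion_sheaf G \<rho> = \<lparr>vstalk = (\<lambda>x. lie_quotient G (\<rho> x)),
     estalk = (\<lambda>(v, e). lie_quotient G (\<rho> (Inl v))),
     restr = (\<lambda>x (v, e) A. case x of Inl _ \<Rightarrow> A
       | Inr _ \<Rightarrow> lie_algebra (\<rho> (Inl v)) <+>\<^bsub>subspace_module (lie_algebra G)\<^esub> A)\<rparr>"

end

(* Write R for the real points of G. For a family (g_v) of elements of R the stalks of the motion
   sheaf are, up to intersections, quotients of Lie(G) by the conjugates of Lie(H) by the g_v. So the
   dimensions of H^0 and H^1 are integer combinations of dimensions of solution spaces of linear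
   systems whose coefficients, after clearing det g_v, are polynomials in the entries of the g_v. Such
   a dimension is minimal on the complement of the zeros of finitely many polynomials, and this set is
   dense because a polynomial f of degree d that vanishes on a nonempty open subset of R vanishes on
   all of R, even if R is not connected: translate the open set to the identity and let Z be the
   common zero locus in G of all polynomials of degree at most d that vanish near 1 on R. It is a
   closed subgroup, and it contains the one-parameter groups of G, as G is defined over the reals and
   holomorphic functions that vanish on a real interval are zero. Hence Z is open in G and has countably many cosets; by the
   Nullstellensatz in countably many variables over the uncountable field of complex numbers finitely
   many suffice, so Z is Zariski open and closed, and Z = G as G is Zariski connected. *)
theory Submission
  imports Defs "HOL-Library.Function_Algebras" "HOL-Complex_Analysis.Complex_Analysis"
    "HOL-Computational_Algebra.Fundamental_Theorem_Algebra"
begin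

text \<open>The stalks vary with \<rho>, so the coboundary has no matrix in fixed bases, and a basis
  of an intersection of conjugates need not depend polynomially on the g_v. Cochains are therefore
  lifted to families of elements of Lie(G), a space independent of \<rho>, and an intersection is
  recorded as membership in each conjugate separately. Three solution spaces remain: lifts of
  0-cocycles, lifts of the zero 0-cochain, and pairs of a lifted 0-cochain and a lift of its
  coboundary. Each dimension is constant on a dense open set, so the signs in the combination do not
  matter. Fixing the degree d makes Z tractable. Polynomials of degree at most d are stable under
  translation and form a space of finite dimension. Linear relations between translates then show
  that Z contains inverses, and finitely many equations cut out Z in G, so that one combination with
  a generic parameter separates a coset from countably many points. The Nullstellensatz has to allow
  infinitely many variables because each coset contributes one, standing for the inverse of its
  equation.\<close>

no_notation fps_nth (infixl \<open>$\<close> 75)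

section \<open>Polynomial functions and a Nullstellensatz in countably many variables\<close>

text \<open>Functions instead of formal polynomials: with a suitable set of generators one notion
  covers the entries of a matrix, the entries of a family of matrices and infinitely many
  coordinates.\<close>

inductive_set polyfun :: "('a \<Rightarrow> 'b::comm_ring_1) set \<Rightarrow> ('a \<Rightarrow> 'b) set" for X where
  polyfun_const: "(\<lambda>_. c) \<in> polyfun X"
| polyfun_gen: "f \<in> X \<Longrightarrow> f \<in> polyfun X"
| polyfun_add: "f \<in> polyfun X \<Longrightarrow> g \<in> polyfun X \<Longrightarrow> (\<lambda>x. f x + g x) \<in> polyfun X"
| polyfun_mult: "f \<in> polyfun X \<Longrightarrow> g \<in> polyfun X \<Longrightarrow> (\<lambda>x. f x * g x) \<in> polyfun X"

lemma polyfun_uminus: "f \<in> polyfun X \<Longrightarrow> (\<lambda>x. - f x) \<in> polyfun X"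
  using polyfun_mult[OF polyfun_const[of "-1"]] by fastforce

lemma polyfun_diff: "f \<in> polyfun X \<Longrightarrow> g \<in> polyfun X \<Longrightarrow> (\<lambda>x. f x - g x) \<in> polyfun X"
  using polyfun_add[OF _ polyfun_uminus] by fastforce

lemma polyfun_sum: "(\<And>i. i \<in> I \<Longrightarrow> f i \<in> polyfun X) \<Longrightarrow> (\<lambda>x. \<Sum>i\<in>I. f i x) \<in> polyfun X"
  by (induction I rule: infinite_finite_induct) (auto intro: polyfun.intros)

lemma polyfun_prod: "(\<And>i. i \<in> I \<Longrightarrow> f i \<in> polyfun X) \<Longrightarrow> (\<lambda>x. \<Prod>i\<in>I. f i x) \<in> polyfun X"
  by (induction I rule: infinite_finite_induct) (auto intro: polyfun.intros)

lemma polyfun_power: "f \<in> polyfun X \<Longrightarrow> (\<lambda>x. f x ^ n) \<in> polyfun X"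
  by (induction n) (auto intro: polyfun.intros)

lemma polyfun_compose:
  assumes "f \<in> polyfun X" and "\<And>g. g \<in> X \<Longrightarrow> (\<lambda>y. g (h y)) \<in> polyfun Y"
  shows "(\<lambda>y. f (h y)) \<in> polyfun Y"
  using assms(1) by induction (auto intro: polyfun.intros assms(2))

text \<open>Elimination of one coordinate at a time: a vector with a nonzero entry at
  \<open>j\<close> clears this entry from all others. This costs one vector and one coordinate, so
  the strict inequality survives.\<close>

lemma exists_linear_dependence:
  fixes u :: "'i \<Rightarrow> 'j \<Rightarrow> 'b::field"
  assumes "finite J" "finite I" "card J < card I"
  shows "\<exists>c. (\<exists>i\<in>I. c i \<noteq> 0) \<and> (\<forall>j\<in>J. (\<Sum>i\<in>I. c i * u i j) = 0)"
  using assms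
proof (induction J arbitrary: I u rule: finite_induct)
  case empty
  then have "I \<noteq> {}" by auto
  then show ?case by (intro exI[of _ "\<lambda>_. 1"]) auto
next
  case (insert j J)
  show ?case
  proof (cases "\<forall>i\<in>I. u i j = 0")
    case True
    have "card J < card I" using insert by auto
    with insert.IH[of I u] insert.prems True show ?thesis by auto
  next
    case False
    then obtain i0 where i0: "i0 \<in> I" "u i0 j \<noteq> 0" by auto
    define u' where "u' i k = u i k - u i j / u i0 j * u i0 k" for i k
    have "card J < card (I - {i0})" using insert i0 by auto
    with insert.IH[of "I - {i0}" u'] insert.prems obtain c
      where c: "\<exists>i\<in>I - {i0}. c i \<noteq> 0" "\<forall>k\<in>J. (\<Sum>i\<in>I - {i0}. c i * u' i k) = 0" by auto
    \<comment> \<open>The coefficient of \<open>i0\<close> collects the multiples of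
      \<open>u i0\<close> that were subtracted in \<open>u'\<close>.\<close>
    define c' where "c' = c(i0 := - (\<Sum>i\<in>I - {i0}. c i * u i j / u i0 j))"
    have eq: "(\<Sum>i\<in>I. c' i * u i k) = (\<Sum>i\<in>I - {i0}. c i * u' i k)" for k
    proof -
      have "(\<Sum>i\<in>I. c' i * u i k) = c' i0 * u i0 k + (\<Sum>i\<in>I - {i0}. c' i * u i k)"
        using insert.prems i0 by (simp add: sum.remove)
      also have "(\<Sum>i\<in>I - {i0}. c' i * u i k) = (\<Sum>i\<in>I - {i0}. c i * u i k)"
        by (intro sum.cong) (auto simp: c'_def)
      also have "c' i0 * u i0 k = - (\<Sum>i\<in>I - {i0}. c i * u i j / u i0 j * u i0 k)"
        by (simp add: c'_def sum_distrib_right)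
      finally show ?thesis
        by (simp add: u'_def algebra_simps sum_subtractf)
    qed
    have "(\<Sum>i\<in>I. c' i * u i j) = 0"
      unfolding eq using i0 by (simp add: u'_def)
    moreover have "\<exists>i\<in>I. c' i \<noteq> 0" using c(1) by (auto simp: c'_def)
    ultimately show ?thesis using c(2) eq by (intro exI[of _ c']) auto
  qed
qed

text \<open>Monomials are enumerated by decoding \<open>n\<close> into a list of indices of
  generators. The same monomial occurs repeatedly, which is harmless since only spanning is
  used.\<close>

definition monomial_fun :: "(nat \<Rightarrow> 'a \<Rightarrow> 'b::comm_ring_1) \<Rightarrow> nat \<Rightarrow> 'a \<Rightarrow> 'b" where
  "monomial_fun e n x = (\<Prod>k\<leftarrow>from_nat n. e k x)"

text \<open>Each polynomial function is a combination of an initial segment of one fixed sequence.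
  The length of this segment is what the later counting argument for inverses compares.\<close>

lemma polyfun_countable_basis:
  fixes e :: "nat \<Rightarrow> 'a \<Rightarrow> 'b::comm_ring_1"
  assumes "f \<in> polyfun (range e)"
  shows "\<exists>N c. f = (\<lambda>x. \<Sum>i<N. c i * monomial_fun e i x)"
proof -
  define Q where "Q = {f. \<exists>N c. f = (\<lambda>x. \<Sum>i<N. c i * monomial_fun e i x)}"
  have mono: "(\<lambda>x. c * (\<Prod>k\<leftarrow>l. e k x)) \<in> Q" for c and l :: "nat list"
  proof -
    have "(\<Sum>i<Suc (to_nat l). (if i = to_nat l then c else 0) * monomial_fun e i x) =
        c * (\<Prod>k\<leftarrow>l. e k x)" for x
      by (simp add: monomial_fun_def)
    then show ?thesis unfolding Q_def
      by (intro CollectI exI[of _ "Suc (to_nat l)"] exI[of _ "\<lambda>i. if i = to_nat l then c else 0"])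
         presburger
  qed
  have ext: "\<exists>c. f = (\<lambda>x. \<Sum>i<M. c i * monomial_fun e i x)"
    if "f = (\<lambda>x. \<Sum>i<N. c i * monomial_fun e i x)" "N \<le> M" for f N M c
  proof -
    have "(\<Sum>i<M. (if i < N then c i else 0) * monomial_fun e i x) = f x" for x
    proof -
      have "f x = (\<Sum>i<N. (if i < N then c i else 0) * monomial_fun e i x)" using that by simp
      also have "\<dots> = (\<Sum>i<M. (if i < N then c i else 0) * monomial_fun e i x)"
        using that(2) by (intro sum.mono_neutral_left) auto
      finally show ?thesis by simp
    qed
    then show ?thesis by (intro exI[of _ "\<lambda>i. if i < N then c i else 0"]) auto
  qed
  have add: "(\<lambda>x. f x + g x) \<in> Q" if fg: "f \<in> Q" "g \<in> Q" for f g
  proof -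
    from fg obtain N c M d where f: "f = (\<lambda>x. \<Sum>i<N. c i * monomial_fun e i x)"
      and g: "g = (\<lambda>x. \<Sum>i<M. d i * monomial_fun e i x)" by (auto simp: Q_def)
    obtain c' d' where f: "f = (\<lambda>x. \<Sum>i<max N M. c' i * monomial_fun e i x)"
      and g: "g = (\<lambda>x. \<Sum>i<max N M. d' i * monomial_fun e i x)"
      using ext[OF f, of "max N M"] ext[OF g, of "max N M"] by auto
    have "(\<lambda>x. f x + g x) = (\<lambda>x. \<Sum>i<max N M. (c' i + d' i) * monomial_fun e i x)"
      by (subst f, subst g) (simp add: sum.distrib algebra_simps)
    then show ?thesis unfolding Q_def
      by (intro CollectI exI[of _ "max N M"] exI[of _ "\<lambda>i. c' i + d' i"])
  qed
  have zero: "(\<lambda>_. 0) \<in> Q" unfolding Q_def by (intro CollectI exI[of _ 0]) simp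
  have sum: "(\<lambda>x. \<Sum>i\<in>I. F i x) \<in> Q" if "\<And>i. i \<in> I \<Longrightarrow> F i \<in> Q" "finite I" for F and I :: "(nat \<times> nat) set"
    using that(2,1) by (induction I rule: finite_induct) (auto intro: zero add)
  have "f \<in> Q" using assms
  proof induction
    case (polyfun_const c) then show ?case using mono[of c "[]"] by simp
  next
    case (polyfun_gen f)
    then obtain k where "f = e k" by auto
    then show ?case using mono[of 1 "[k]"] by simp
  next
    case (polyfun_add f g) then show ?case by (intro add)
  next
    case (polyfun_mult f g)
    then obtain N c M d where f: "f = (\<lambda>x. \<Sum>i<N. c i * monomial_fun e i x)"
      and g: "g = (\<lambda>x. \<Sum>i<M. d i * monomial_fun e i x)" by (auto simp: Q_def)
    have "f x * g x = (\<Sum>ij\<in>{..<N} \<times> {..<M}. (c (fst ij) * d (snd ij)) *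
        (\<Prod>k\<leftarrow>from_nat (fst ij) @ from_nat (snd ij). e k x))" for x
      unfolding f g by (simp add: sum_product sum.cartesian_product monomial_fun_def split_def mult_ac)
    then have "(\<lambda>x. f x * g x) = (\<lambda>x. \<Sum>ij\<in>{..<N} \<times> {..<M}. (c (fst ij) * d (snd ij)) *
        (\<Prod>k\<leftarrow>from_nat (fst ij) @ from_nat (snd ij). e k x))" by blast
    then show ?case by (simp only:) (intro sum mono, simp)
  qed
  then show ?thesis by (simp add: Q_def)
qed

section \<open>Ideals of functions and common zeros\<close>

definition fun_ideal :: "('a \<Rightarrow> 'b::comm_ring_1) set \<Rightarrow> ('a \<Rightarrow> 'b) set \<Rightarrow> bool" where
  "fun_ideal R J \<longleftrightarrow> J \<subseteq> R \<and> (\<lambda>_. 0) \<in> J \<and> (\<forall>f\<in>J. \<forall>g\<in>J. (\<lambda>x. f x + g x) \<in> J) \<and>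
     (\<forall>f\<in>R. \<forall>g\<in>J. (\<lambda>x. f x * g x) \<in> J)"

lemma fun_idealD:
  assumes "fun_ideal R J"
  shows "J \<subseteq> R" "(\<lambda>_. 0) \<in> J" "f \<in> J \<Longrightarrow> g \<in> J \<Longrightarrow> (\<lambda>x. f x + g x) \<in> J"
    "f \<in> R \<Longrightarrow> g \<in> J \<Longrightarrow> (\<lambda>x. f x * g x) \<in> J"
  using assms by (auto simp: fun_ideal_def)

lemma fun_ideal_sum:
  assumes "fun_ideal R J" "\<And>i. i \<in> I \<Longrightarrow> f i \<in> J"
  shows "(\<lambda>x. \<Sum>i\<in>I. f i x) \<in> J"
  using assms(2) by (induction I rule: infinite_finite_induct) (auto intro: fun_idealD[OF assms(1)])

lemma fun_ideal_uminus:
  assumes "fun_ideal (polyfun X) J" "f \<in> J"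
  shows "(\<lambda>x. - f x) \<in> J"
  using fun_idealD(4)[OF assms(1) polyfun_const[of "-1"] assms(2)] by simp

text \<open>Amitsur's trick: the inverses of the \<open>a - c\<close> modulo \<open>J\<close> would be uncountably many elements of an
  algebra of countable dimension, hence linearly dependent; clearing denominators makes \<open>a\<close> algebraic
  modulo \<open>J\<close>, so that some \<open>a - c\<close> is not invertible after all.\<close>

lemma exists_nonunit_translate:
  fixes e :: "nat \<Rightarrow> 'a \<Rightarrow> complex"
  defines "R \<equiv> polyfun (range e)"
  assumes J: "fun_ideal R J" "(\<lambda>_. 1) \<notin> J" and a: "a \<in> R"
  shows "\<exists>c. \<forall>b\<in>R. (\<lambda>x. (a x - c) * b x - 1) \<notin> J"
proof (rule ccontr)
  assume "\<not> ?thesis"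
  then have "\<forall>c. \<exists>b. b \<in> R \<and> (\<lambda>x. (a x - c) * b x - 1) \<in> J" by blast
  then obtain b where b: "\<And>c. b c \<in> R" "\<And>c. (\<lambda>x. (a x - c) * b c x - 1) \<in> J"
    by metis
  have "\<forall>c. \<exists>N u. b c = (\<lambda>x. \<Sum>i<N. u i * monomial_fun e i x)"
    using polyfun_countable_basis b(1) unfolding R_def by blast
  then obtain N u where u: "\<And>c. b c = (\<lambda>x. \<Sum>i<N c. u c i * monomial_fun e i x)" by metis
  \<comment> \<open>There are uncountably many \<open>c\<close> but only countably many lengths
    \<open>N c\<close>, so some length \<open>n\<close> occurs infinitely often;
    \<open>n + 1\<close> inverses of this length are linearly dependent.\<close>
  have "\<exists>n. infinite {c. N c = n}"
  proof (rule ccontr)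
    assume "\<not> ?thesis"
    then have "countable (\<Union>n. {c. N c = n})" by (intro countable_UN) (auto intro: countable_finite)
    moreover have "(\<Union>n. {c. N c = n}) = UNIV" by auto
    ultimately show False using uncountable_UNIV_complex by simp
  qed
  then obtain n where "infinite {c. N c = n}" ..
  then obtain I where I: "finite I" "card I = Suc n" "\<And>c. c \<in> I \<Longrightarrow> N c = n"
    using infinite_arbitrarily_large[of "{c. N c = n}" "Suc n"] by auto
  obtain l where l: "\<exists>c\<in>I. l c \<noteq> 0" "\<forall>i\<in>{..<n}. (\<Sum>c\<in>I. l c * u c i) = 0"
    using exists_linear_dependence[of "{..<n}" I u] I by auto
  have dep: "(\<Sum>c\<in>I. l c * b c x) = 0" for x
  proof -
    have "(\<Sum>c\<in>I. l c * b c x) = (\<Sum>c\<in>I. \<Sum>i<n. l c * u c i * monomial_fun e i x)"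
      using I(3) by (intro sum.cong) (auto simp: u sum_distrib_left mult_ac)
    also have "\<dots> = (\<Sum>i<n. (\<Sum>c\<in>I. l c * u c i) * monomial_fun e i x)"
      by (subst sum.swap) (simp add: sum_distrib_right)
    also have "\<dots> = 0" using l(2) by simp
    finally show ?thesis .
  qed
  \<comment> \<open>The numerator of the sum of the l(c) / (y - c) over the common
    denominator.\<close>
  define p where "p = (\<Sum>c\<in>I. [:l c:] * (\<Prod>d\<in>I - {c}. [:- d, 1:]))"
  have p_eval: "poly p y = (\<Sum>c\<in>I. l c * (\<Prod>d\<in>I - {c}. (y - d)))" for y
    by (simp add: p_def poly_sum poly_prod)
  have "p \<noteq> 0"
  proof -
    obtain c where c: "c \<in> I" "l c \<noteq> 0" using l(1) by auto
    \<comment> \<open>At \<open>c\<close> all other summands contain the factor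
      \<open>c - c\<close>, and the remaining product is nonzero as the elements of \<open>I\<close>
      are distinct.\<close>
    have "poly p c = l c * (\<Prod>d\<in>I - {c}. (c - d)) +
        (\<Sum>c'\<in>I - {c}. l c' * (\<Prod>d\<in>I - {c'}. (c - d)))"
      unfolding p_eval using c I by (simp add: sum.remove)
    also have "(\<Sum>c'\<in>I - {c}. l c' * (\<Prod>d\<in>I - {c'}. (c - d))) = 0"
      using c I by (intro sum.neutral ballI) (auto intro!: prod_zero bexI[of _ c])
    finally have "poly p c \<noteq> 0" using c I by auto
    then show ?thesis by auto
  qed
  have pJ: "(\<lambda>x. poly p (a x)) \<in> J"
  proof -
    have "(\<lambda>x. \<Sum>c\<in>I. (l c * (\<Prod>d\<in>I - {c}. (a x - d))) * ((a x - c) * b c x - 1)) \<in> J"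
      using a b(2) unfolding R_def
      by (intro fun_ideal_sum[OF J(1)] fun_idealD(4)[OF J(1)])
         (auto simp: R_def intro!: polyfun_mult polyfun_const polyfun_prod polyfun_diff)
    moreover have "(\<Sum>c\<in>I. (l c * (\<Prod>d\<in>I - {c}. (a x - d))) * ((a x - c) * b c x - 1)) =
        - poly p (a x)" for x
    proof -
      have "(\<Sum>c\<in>I. (l c * (\<Prod>d\<in>I - {c}. (a x - d))) * ((a x - c) * b c x - 1)) =
          (\<Sum>c\<in>I. (\<Prod>d\<in>I. (a x - d)) * (l c * b c x)) - poly p (a x)"
        unfolding p_eval sum_subtractf[symmetric] using I
        by (intro sum.cong) (auto simp: prod.remove algebra_simps)
      also have "(\<Sum>c\<in>I. (\<Prod>d\<in>I. (a x - d)) * (l c * b c x)) = 0"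
        using dep[of x] by (simp flip: sum_distrib_left)
      finally show ?thesis by simp
    qed
    ultimately have "(\<lambda>x. - poly p (a x)) \<in> J" by simp
    from fun_ideal_uminus[OF J(1)[unfolded R_def] this] show ?thesis by simp
  qed
  \<comment> \<open>A nonzero polynomial splits into linear factors, and each factor at
    \<open>a\<close> is inverted modulo \<open>J\<close> by some \<open>b r\<close>; so even
    \<open>p\<close>, whose value at \<open>a\<close> lies in \<open>J\<close>, would be
    invertible.\<close>
  have unit: "\<exists>b\<in>R. (\<lambda>x. poly q (a x) * b x - 1) \<in> J" if "q \<noteq> 0" for q
    using that
  proof (induction "degree q" arbitrary: q)
    case 0
    then obtain k where "q = [:k:]" using degree_eq_zeroE[of q] by metis
    with 0 have "q = [:k:]" "k \<noteq> 0" by auto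
    then show ?case using fun_idealD(2)[OF J(1)]
      by (intro bexI[of _ "\<lambda>_. 1 / k"]) (auto simp: R_def intro: polyfun_const)
  next
    case (Suc n)
    then have "\<not> constant (poly q)" by (simp add: Fundamental_Theorem_Algebra.constant_degree)
    then obtain r where "poly q r = 0" using Fundamental_Theorem_Algebra.fundamental_theorem_of_algebra by blast
    then obtain q' where q': "q = [:- r, 1:] * q'" using poly_eq_0_iff_dvd[of q r] by auto
    then have "q' \<noteq> 0" "degree q' = n" using Suc by (auto simp: degree_mult_eq simp del: mult_pCons_left)
    then obtain b' where b': "b' \<in> R" "(\<lambda>x. poly q' (a x) * b' x - 1) \<in> J" using Suc by metis
    let ?j = "\<lambda>x. (a x - r) * b r x - 1" and ?k = "\<lambda>x. poly q' (a x) * b' x - 1"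
    have "?k \<in> R" using b' fun_idealD(1)[OF J(1)] by auto
    \<comment> \<open>The two products of an element and its inverse are 1 + j and 1 + k, and (1 +
      j)(1 + k) - 1 = j + k + k j.\<close>
    then have "(\<lambda>x. ?j x + (?k x + ?k x * ?j x)) \<in> J"
      using b b' by (intro fun_idealD(3,4)[OF J(1)])
    also have "(\<lambda>x. ?j x + (?k x + ?k x * ?j x)) = (\<lambda>x. poly q (a x) * (b r x * b' x) - 1)"
      unfolding q' by (auto simp: fun_eq_iff algebra_simps)
    finally show ?case using b b' by (intro bexI[of _ "\<lambda>x. b r x * b' x"]) (auto simp: R_def intro: polyfun_mult)
  qed
  obtain b' where b': "b' \<in> R" "(\<lambda>x. poly p (a x) * b' x - 1) \<in> J" using unit[OF \<open>p \<noteq> 0\<close>] by auto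
  have "(\<lambda>x. b' x * poly p (a x) + - (poly p (a x) * b' x - 1)) \<in> J"
    using pJ b' J(1) unfolding R_def
    by (intro fun_idealD(3)[OF J(1)] fun_idealD(4)[OF J(1)] fun_ideal_uminus) (auto simp: R_def)
  then show False using J(2) by (simp add: algebra_simps)
qed

inductive_set generated_ideal :: "('a \<Rightarrow> 'b::comm_ring_1) set \<Rightarrow> ('a \<Rightarrow> 'b) set \<Rightarrow> ('a \<Rightarrow> 'b) set" for R S where
  generated_ideal_zero: "(\<lambda>_. 0) \<in> generated_ideal R S"
| generated_ideal_step: "f \<in> generated_ideal R S \<Longrightarrow> r \<in> R \<Longrightarrow> s \<in> S \<Longrightarrow>
    (\<lambda>x. f x + r x * s x) \<in> generated_ideal R S"

lemma fun_ideal_generated_ideal: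
  assumes "S \<subseteq> polyfun X"
  shows "fun_ideal (polyfun X) (generated_ideal (polyfun X) S)"
proof -
  have "f \<in> polyfun X" if "f \<in> generated_ideal (polyfun X) S" for f
    using that by induction (use assms in \<open>auto intro!: polyfun_add polyfun_mult intro: polyfun_const\<close>)
  moreover have "(\<lambda>x. f x + g x) \<in> generated_ideal (polyfun X) S"
    if "g \<in> generated_ideal (polyfun X) S" "f \<in> generated_ideal (polyfun X) S" for f g
    using that
  proof (induction)
    case (generated_ideal_step g r s)
    then have "(\<lambda>x. (f x + g x) + r x * s x) \<in> generated_ideal (polyfun X) S"
      by (intro generated_ideal.intros)
    then show ?case by (simp add: add.assoc)
  qed simp
  moreover have "(\<lambda>x. f x * g x) \<in> generated_ideal (polyfun X) S"
    if "g \<in> generated_ideal (polyfun X) S" "f \<in> polyfun X" for f g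
    using that
  proof (induction)
    case generated_ideal_zero then show ?case by (simp add: generated_ideal.intros)
  next
    case (generated_ideal_step g r s)
    then have "(\<lambda>x. f x * g x + (f x * r x) * s x) \<in> generated_ideal (polyfun X) S"
      by (intro generated_ideal.intros polyfun_mult)
    then show ?case by (simp add: algebra_simps)
  qed
  ultimately show ?thesis by (auto simp: fun_ideal_def generated_ideal.intros)
qed

text \<open>A derivation of \<open>f\<close> uses finitely many generators. Applied to the constant
  1 this turns an improper ideal into a finite set of equations without common zero.\<close>

lemma generated_ideal_finite_support:
  assumes "f \<in> generated_ideal R S"
  shows "\<exists>T. finite T \<and> T \<subseteq> S \<and> (\<forall>x. (\<forall>s\<in>T. s x = 0) \<longrightarrow> f x = 0)"
  using assms
proof induction
  case generated_ideal_zero then show ?case by (intro exI[of _ "{}"]) auto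
next
  case (generated_ideal_step f r s)
  then obtain T where "finite T" "T \<subseteq> S" "\<forall>x. (\<forall>s\<in>T. s x = 0) \<longrightarrow> f x = 0" by auto
  then show ?case using generated_ideal_step by (intro exI[of _ "insert s T"]) auto
qed

abbreviation coordinate_funs :: "(('k \<Rightarrow> 'b) \<Rightarrow> 'b) set" where
  "coordinate_funs \<equiv> range (\<lambda>k x. x k)"

text \<open>The ideal of \<open>S\<close> is proper, since 1 would already come from a finite
  subset. In a maximal proper ideal \<open>M\<close> above it, some x_k - c is not invertible modulo
  \<open>M\<close>, hence lies in \<open>M\<close>, for every coordinate k; these values c are the
  coordinates of a common zero.\<close>

theorem countable_nullstellensatz:
  fixes S :: "(('k::countable \<Rightarrow> complex) \<Rightarrow> complex) set"
  assumes S: "S \<subseteq> polyfun coordinate_funs"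
    and fin: "\<And>T. finite T \<Longrightarrow> T \<subseteq> S \<Longrightarrow> \<exists>x. \<forall>s\<in>T. s x = 0"
  shows "\<exists>x. \<forall>s\<in>S. s x = 0"
proof -
  define e where "e n x = x (from_nat n :: 'k)" for n and x :: "'k \<Rightarrow> complex"
  have "coordinate_funs = range e"
    unfolding e_def by (auto simp: image_iff) (metis from_nat_to_nat)
  define R where "R = polyfun (range e)"
  have S: "S \<subseteq> R" using S \<open>coordinate_funs = range e\<close> by (simp add: R_def)
  define \<A> where "\<A> = {J. fun_ideal R J \<and> S \<subseteq> J \<and> (\<lambda>_. 1) \<notin> J}"
  let ?I = "generated_ideal R S"
  have "?I \<in> \<A>"
  proof -
    have "s \<in> ?I" if "s \<in> S" for s
      using generated_ideal_step[OF generated_ideal_zero polyfun_const[of 1], of s S] that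
      by (auto simp: R_def)
    moreover have "(\<lambda>_. 1) \<notin> ?I" using generated_ideal_finite_support[of "\<lambda>_. 1" R S] fin by fastforce
    ultimately show ?thesis using fun_ideal_generated_ideal S by (auto simp: \<A>_def R_def)
  qed
  moreover have "\<Union>C \<in> \<A>" if ne: "C \<noteq> {}" and ch: "subset.chain \<A> C" for C
  proof -
    have C: "fun_ideal R J" "S \<subseteq> J" "(\<lambda>_. 1) \<notin> J" if "J \<in> C" for J
      using ch that by (auto simp: subset.chain_def \<A>_def)
    have "(\<lambda>x. f x + g x) \<in> \<Union>C" if "f \<in> \<Union>C" "g \<in> \<Union>C" for f g
    proof -
      from that obtain J K where "J \<in> C" "K \<in> C" "f \<in> J" "g \<in> K" by auto
      moreover from this ch have "J \<subseteq> K \<or> K \<subseteq> J" by (auto simp: subset_chain_def)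
      ultimately show ?thesis using fun_idealD(3)[OF C(1)] by blast
    qed
    moreover obtain J where "J \<in> C" using ne by auto
    ultimately show ?thesis using C unfolding \<A>_def fun_ideal_def by blast
  qed
  ultimately obtain M where M: "M \<in> \<A>" and max: "\<And>K. K \<in> \<A> \<Longrightarrow> M \<subseteq> K \<Longrightarrow> K = M"
    using subset_Zorn_nonempty[of \<A>] by blast
  have Mi: "fun_ideal R M" "S \<subseteq> M" "(\<lambda>_. 1) \<notin> M" using M by (auto simp: \<A>_def)
  have "\<exists>c. (\<lambda>x. x k - c) \<in> M" for k :: 'k
  proof -
    have kR: "(\<lambda>x. x k) \<in> R" using \<open>coordinate_funs = range e\<close> unfolding R_def
      by (intro polyfun_gen) auto
    then obtain c where c: "\<And>b. b \<in> R \<Longrightarrow> (\<lambda>x. (x k - c) * b x - 1) \<notin> M"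
      using exists_nonunit_translate[of e M "\<lambda>x. x k"] Mi by (auto simp: R_def)
    \<comment> \<open>The ideal generated by \<open>M\<close> and x_k - c; it is proper because x_k
      - c has no inverse modulo \<open>M\<close>, so maximality puts x_k - c into
      \<open>M\<close>.\<close>
    define K where "K = {(\<lambda>x. j x + r x * (x k - c)) | j r. j \<in> M \<and> r \<in> R}"
    have memK: "(\<lambda>x. j x + r x * (x k - c)) \<in> K" if "j \<in> M" "r \<in> R" for j r
      using that by (auto simp: K_def)
    have sub: "M \<subseteq> K" using memK[of _ "\<lambda>_. 0"] by (auto simp: R_def polyfun_const)
    have mem: "(\<lambda>x. x k - c) \<in> K"
      using memK[of "\<lambda>_. 0" "\<lambda>_. 1"] fun_idealD(2)[OF Mi(1)] by (auto simp: R_def polyfun_const)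
    have "fun_ideal R K"
    proof -
      have "K \<subseteq> R" using fun_idealD(1)[OF Mi(1)] kR unfolding K_def R_def
        by (auto intro!: polyfun_add polyfun_mult polyfun_diff polyfun_const)
      moreover have "(\<lambda>x. f x + g x) \<in> K" if "f \<in> K" "g \<in> K" for f g
      proof -
        from that obtain j r j' r' where *: "f = (\<lambda>x. j x + r x * (x k - c))" "j \<in> M" "r \<in> R"
          "g = (\<lambda>x. j' x + r' x * (x k - c))" "j' \<in> M" "r' \<in> R" unfolding K_def by auto
        have "(\<lambda>x. (j x + j' x) + (r x + r' x) * (x k - c)) \<in> K"
          using * by (intro memK fun_idealD(3)[OF Mi(1)]) (auto simp: R_def intro: polyfun_add)
        then show ?thesis by (simp add: * algebra_simps)
      qed
      moreover have "(\<lambda>x. f x * g x) \<in> K" if "f \<in> R" "g \<in> K" for f g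
      proof -
        from that obtain j r where *: "g = (\<lambda>x. j x + r x * (x k - c))" "j \<in> M" "r \<in> R"
          unfolding K_def by auto
        have "(\<lambda>x. (f x * j x) + (f x * r x) * (x k - c)) \<in> K"
          using * that by (intro memK fun_idealD(4)[OF Mi(1)]) (auto simp: R_def intro: polyfun_mult)
        then show ?thesis by (simp add: * algebra_simps)
      qed
      moreover have "(\<lambda>_. 0) \<in> K" using sub fun_idealD(2)[OF Mi(1)] by auto
      ultimately show ?thesis by (auto simp: fun_ideal_def)
    qed
    moreover have "(\<lambda>_. 1) \<notin> K"
    proof
      assume "(\<lambda>_. 1) \<in> K"
      then obtain j r where "(\<lambda>_. 1) = (\<lambda>x. j x + r x * (x k - c))" and j: "j \<in> M" "r \<in> R"
        by (auto simp: K_def)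
      then have "1 = j x + r x * (x k - c)" for x by metis
      then have "(x k - c) * r x - 1 = - j x" for x by (metis add_diff_cancel_right' diff_add_cancel minus_diff_eq mult.commute add.commute)
      then show False using c[OF j(2)] fun_ideal_uminus[OF Mi(1)[unfolded R_def] j(1)] by simp
    qed
    ultimately have "K \<in> \<A>" using sub Mi by (auto simp: \<A>_def)
    then show ?thesis using max[of K] sub mem by auto
  qed
  then obtain c where c: "\<And>k. (\<lambda>x. x k - c k) \<in> M" by metis
  \<comment> \<open>Reduction modulo \<open>M\<close> is evaluation at \<open>c\<close>; an element
    of \<open>S\<close> that does not vanish there would make a nonzero constant lie in
    \<open>M\<close>.\<close>
  have cong: "(\<lambda>x. f x - f c) \<in> M" if "f \<in> R" for f
    using that unfolding R_def
  proof induction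
    case (polyfun_const d) then show ?case using fun_idealD(2)[OF Mi(1)] by simp
  next
    case (polyfun_gen f) then show ?case using c by (auto simp: e_def)
  next
    case (polyfun_add f g)
    then have "(\<lambda>x. (f x - f c) + (g x - g c)) \<in> M" by (intro fun_idealD(3)[OF Mi(1)])
    then show ?case by (simp add: algebra_simps)
  next
    case (polyfun_mult f g)
    then have "(\<lambda>x. f x * (g x - g c) + g c * (f x - f c)) \<in> M"
      by (intro fun_idealD(3,4)[OF Mi(1)]) (auto simp: R_def polyfun_const)
    then show ?case by (simp add: algebra_simps)
  qed
  have "s c = 0" if "s \<in> S" for s
  proof (rule ccontr)
    assume "s c \<noteq> 0"
    have "(\<lambda>x. s x + - (s x - s c)) \<in> M"
      using that S Mi cong by (intro fun_idealD(3)[OF Mi(1)] fun_ideal_uminus[OF Mi(1)[unfolded R_def]]) auto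
    then have "(\<lambda>x. s c) \<in> M" by simp
    from fun_idealD(4)[OF Mi(1) _ this, of "\<lambda>_. 1 / s c"] show False
      using Mi(3) \<open>s c \<noteq> 0\<close> by (simp add: R_def polyfun_const)
  qed
  then show ?thesis by blast
qed



section \<open>The exponential of a matrix\<close>

text \<open>Square matrices with the row sum norm, a submultiplicative norm in which the identity has norm 1;
  the product of \<^typ>\<open>'a^'n^'n\<close> as a ring would be the entrywise one.\<close>

typedef ('a, 'n::finite) sqm = "UNIV :: ('a^'n^'n) set" morphisms mat_of Sqm ..

declare Sqm_inverse[OF UNIV_I, simp] mat_of_inverse[simp]

lemma sqm_eq_iff: "A = B \<longleftrightarrow> mat_of A = mat_of B"
  by (simp add: mat_of_inject)

lemma matrix_mult_add:
  fixes A B :: "'a::semiring_1^'n^'m"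
  shows "(A + B) ** C = A ** C + B ** C" "D ** (A + B) = D ** A + D ** B"
  by (simp_all add: vec_eq_iff matrix_matrix_mult_def algebra_simps sum.distrib)

instantiation sqm :: (ring_1, finite) ring_1
begin
definition "0 = Sqm 0"
definition "1 = Sqm (mat 1)"
definition "A + B = Sqm (mat_of A + mat_of B)"
definition "A - B = Sqm (mat_of A - mat_of B)"
definition "- A = Sqm (- mat_of A)"
definition "A * B = Sqm (mat_of A ** mat_of B)"
instance
proof
  have "(mat 1 :: 'a^'b^'b) $ undefined $ undefined \<noteq> 0" by (simp add: mat_def)
  then have "(mat 1 :: 'a^'b^'b) \<noteq> 0" by (metis zero_index)
  then show "(0 :: ('a, 'b) sqm) \<noteq> 1" by (metis Sqm_inverse UNIV_I one_sqm_def zero_sqm_def)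
qed (simp_all add: sqm_eq_iff zero_sqm_def one_sqm_def plus_sqm_def minus_sqm_def uminus_sqm_def
    times_sqm_def matrix_mul_assoc matrix_mult_add add_ac)
end

lemma mat_of_simps [simp]:
  "mat_of 0 = 0" "mat_of 1 = mat 1" "mat_of (A + B) = mat_of A + mat_of B"
  "mat_of (A - B) = mat_of A - mat_of B" "mat_of (- A) = - mat_of A"
  "mat_of (A * B) = mat_of A ** mat_of B"
  by (simp_all add: zero_sqm_def one_sqm_def plus_sqm_def minus_sqm_def uminus_sqm_def times_sqm_def)

lemma matrix_mult_scaleR:
  fixes A :: "'a::real_algebra_1^'n^'m" and B :: "'a^'k^'n"
  shows "(c *\<^sub>R A) ** B = c *\<^sub>R (A ** B)" "A ** (c *\<^sub>R B) = c *\<^sub>R (A ** B)"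
  by (simp_all add: vec_eq_iff matrix_matrix_mult_def scaleR_sum_right)

instantiation sqm :: (real_algebra_1, finite) real_algebra_1
begin
definition "scaleR c A = Sqm (c *\<^sub>R mat_of A)"
instance
  by standard (simp_all add: sqm_eq_iff scaleR_sqm_def matrix_mult_scaleR algebra_simps)
end

lemma mat_of_scaleR [simp]: "mat_of (c *\<^sub>R A) = c *\<^sub>R mat_of A"
  by (simp add: scaleR_sqm_def)

instantiation sqm :: (real_normed_field, finite) real_normed_algebra_1
begin
definition "norm A = (MAX i. \<Sum>j\<in>UNIV. norm (mat_of A $ i $ j))"
definition "sgn (A :: ('a, 'b) sqm) = A /\<^sub>R norm A"
definition "dist (A :: ('a, 'b) sqm) B = norm (A - B)"
definition "(uniformity :: (('a, 'b) sqm \<times> ('a, 'b) sqm) filter) =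
  (INF e\<in>{0<..}. principal {(x, y). dist x y < e})"
definition "open (S :: ('a, 'b) sqm set) = (\<forall>x\<in>S. \<forall>\<^sub>F (x', y) in uniformity. x' = x \<longrightarrow> y \<in> S)"

lemma row_le_norm: "(\<Sum>j\<in>UNIV. norm (mat_of A $ i $ j)) \<le> norm (A :: ('a, 'b) sqm)"
  unfolding norm_sqm_def by (intro Max_ge) auto

lemma norm_sqm_le: "(\<And>i. (\<Sum>j\<in>UNIV. norm (mat_of A $ i $ j)) \<le> c) \<Longrightarrow> norm (A :: ('a, 'b) sqm) \<le> c"
  unfolding norm_sqm_def by (subst Max_le_iff) auto

lemma norm_sqm_nonneg: "0 \<le> norm (A :: ('a, 'b) sqm)"
  using row_le_norm[of A undefined] by (meson order_trans norm_ge_zero sum_nonneg)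

instance
proof
  fix A B :: "('a, 'b) sqm" and r :: real
  show "norm A = 0 \<longleftrightarrow> A = 0"
  proof
    assume "norm A = 0"
    then have "(\<Sum>j\<in>UNIV. norm (mat_of A $ i $ j)) = 0" for i
      using row_le_norm[of A i] by (simp add: sum_nonneg antisym)
    then show "A = 0" by (simp add: sqm_eq_iff vec_eq_iff sum_nonneg_eq_0_iff)
  next
    assume "A = 0" then show "norm A = 0" by (simp add: norm_sqm_def)
  qed
  show "norm (A + B) \<le> norm A + norm B"
  proof (rule norm_sqm_le)
    fix i
    have "(\<Sum>j\<in>UNIV. norm (mat_of (A + B) $ i $ j)) \<le>
        (\<Sum>j\<in>UNIV. norm (mat_of A $ i $ j)) + (\<Sum>j\<in>UNIV. norm (mat_of B $ i $ j))"
      unfolding sum.distrib[symmetric] by (intro sum_mono) (simp add: norm_triangle_ineq)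
    then show "(\<Sum>j\<in>UNIV. norm (mat_of (A + B) $ i $ j)) \<le> norm A + norm B"
      using row_le_norm[of A i] row_le_norm[of B i] by linarith
  qed
  show "norm (r *\<^sub>R A) = \<bar>r\<bar> * norm A"
  proof -
    have "norm (r *\<^sub>R A) = (MAX i. \<bar>r\<bar> * (\<Sum>j\<in>UNIV. norm (mat_of A $ i $ j)))"
      by (simp add: norm_sqm_def sum_distrib_left)
    also have "\<dots> = \<bar>r\<bar> * norm A"
      unfolding norm_sqm_def
      using mono_Max_commute[of "\<lambda>x. \<bar>r\<bar> * x" "range (\<lambda>i. \<Sum>j\<in>UNIV. norm (mat_of A $ i $ j))"]
      by (simp add: image_image mono_def mult_left_mono)
    finally show ?thesis .
  qed
  show "norm (A * B) \<le> norm A * norm B"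
  proof (rule norm_sqm_le)
    fix i
    have "(\<Sum>j\<in>UNIV. norm (mat_of (A * B) $ i $ j)) \<le>
        (\<Sum>j\<in>UNIV. \<Sum>k\<in>UNIV. norm (mat_of A $ i $ k) * norm (mat_of B $ k $ j))"
      by (intro sum_mono) (auto simp: matrix_matrix_mult_def simp flip: norm_mult intro!: norm_sum)
    also have "\<dots> = (\<Sum>k\<in>UNIV. norm (mat_of A $ i $ k) * (\<Sum>j\<in>UNIV. norm (mat_of B $ k $ j)))"
      by (subst sum.swap) (simp add: sum_distrib_left)
    also have "\<dots> \<le> (\<Sum>k\<in>UNIV. norm (mat_of A $ i $ k) * norm B)"
      by (intro sum_mono mult_left_mono row_le_norm) auto
    also have "\<dots> = (\<Sum>k\<in>UNIV. norm (mat_of A $ i $ k)) * norm B" by (simp add: sum_distrib_right)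
    also have "\<dots> \<le> norm A * norm B" by (intro mult_right_mono row_le_norm norm_sqm_nonneg)
    finally show "(\<Sum>j\<in>UNIV. norm (mat_of (A * B) $ i $ j)) \<le> norm A * norm B" .
  qed
  have "(\<Sum>j\<in>UNIV. norm ((mat 1 :: 'a^'b^'b) $ i $ j)) = 1" for i
    by (simp add: mat_def if_distrib[of norm] cong: if_cong)
  then show "norm (1 :: ('a, 'b) sqm) = 1" by (simp add: norm_sqm_def)
qed (simp_all add: sgn_sqm_def dist_sqm_def uniformity_sqm_def open_sqm_def)
end

lemma bounded_linear_mat_of: "bounded_linear (mat_of :: ('a::real_normed_field, 'n::finite) sqm \<Rightarrow> _)"
proof (rule bounded_linear_intro[where K = "real CARD('n)"])
  fix A :: "('a, 'n) sqm"
  have "norm (mat_of A) \<le> (\<Sum>i\<in>UNIV. norm (mat_of A $ i))"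
    unfolding norm_vec_def[of "mat_of A"] by (intro L2_set_le_sum) auto
  also have "\<dots> \<le> (\<Sum>i\<in>(UNIV :: 'n set). norm A)"
  proof (intro sum_mono)
    fix i
    have "norm (mat_of A $ i) \<le> (\<Sum>j\<in>UNIV. norm (mat_of A $ i $ j))"
      unfolding norm_vec_def[of "mat_of A $ i"] by (intro L2_set_le_sum) auto
    then show "norm (mat_of A $ i) \<le> norm A" using row_le_norm[of A i] by linarith
  qed
  finally show "norm (mat_of A) \<le> norm A * real CARD('n)" by (simp add: mult.commute)
qed auto

lemma bounded_linear_Sqm: "bounded_linear (Sqm :: _ \<Rightarrow> ('a::real_normed_field, 'n::finite) sqm)"
proof (rule bounded_linear_intro[where K = "real CARD('n)"])
  fix A :: "'a^'n^'n"
  show "norm (Sqm A) \<le> norm A * real CARD('n)"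
  proof (rule norm_sqm_le)
    fix i
    have "(\<Sum>j\<in>UNIV. norm (A $ i $ j)) \<le> (\<Sum>j\<in>(UNIV :: 'n set). norm A)"
      by (intro sum_mono) (meson Finite_Cartesian_Product.norm_nth_le order_trans)
    then show "(\<Sum>j\<in>UNIV. norm (mat_of (Sqm A) $ i $ j)) \<le> norm A * real CARD('n)"
      by (simp add: mult.commute)
  qed
qed (auto simp: sqm_eq_iff)

instance sqm :: ("{real_normed_field,banach}", finite) banach
proof
  fix X :: "nat \<Rightarrow> ('a, 'b) sqm"
  assume "Cauchy X"
  then have "Cauchy (\<lambda>n. mat_of (X n))" by (rule bounded_linear.Cauchy[OF bounded_linear_mat_of])
  then obtain L where "(\<lambda>n. mat_of (X n)) \<longlonglongrightarrow> L" using convergent_eq_Cauchy by blast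
  then have "(\<lambda>n. Sqm (mat_of (X n))) \<longlonglongrightarrow> Sqm L"
    by (rule bounded_linear.tendsto[OF bounded_linear_Sqm])
  then show "convergent X" by (auto simp: convergent_def)
qed

section \<open>Powers of elements near the identity and the exponential\<close>

lemma exp_scaleR_power:
  fixes X :: "'b::{real_normed_algebra_1,banach}"
  shows "exp (t *\<^sub>R X) ^ m = exp ((real m * t) *\<^sub>R X)"
proof (induction m)
  case (Suc m)
  have "exp ((real (Suc m) * t) *\<^sub>R X) = exp (t *\<^sub>R X + (real m * t) *\<^sub>R X)"
    by (simp add: algebra_simps)
  also have "\<dots> = exp (t *\<^sub>R X) * exp ((real m * t) *\<^sub>R X)"
    by (intro exp_add_commuting) (simp add: algebra_simps)
  finally show ?case using Suc by simp
qed simp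

text \<open>Telescoping. As \<open>B\<close> is at least 1, the exponent \<open>m\<close> may stand
  in place of the sharper \<open>m - 1\<close>.\<close>

lemma norm_power_diff_le:
  fixes y z :: "'b::real_normed_algebra_1"
  assumes "norm y \<le> B" "norm z \<le> B" "1 \<le> B"
  shows "norm (y ^ m - z ^ m) \<le> real m * B ^ m * norm (y - z)"
proof (induction m)
  case (Suc m)
  have "norm (y ^ Suc m - z ^ Suc m) = norm (y * (y ^ m - z ^ m) + (y - z) * z ^ m)"
    by (simp add: algebra_simps)
  also have "\<dots> \<le> norm y * norm (y ^ m - z ^ m) + norm (y - z) * norm (z ^ m)"
    by (intro order_trans[OF norm_triangle_ineq] add_mono norm_mult_ineq)
  also have "\<dots> \<le> B * (real m * B ^ m * norm (y - z)) + norm (y - z) * B ^ Suc m"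
  proof (intro add_mono mult_mono Suc)
    have "norm (z ^ m) \<le> norm z ^ m" by (rule norm_power_ineq)
    also have "\<dots> \<le> B ^ m" using assms by (intro power_mono) auto
    also have "\<dots> \<le> B ^ Suc m" using assms by (intro power_increasing) auto
    finally show "norm (z ^ m) \<le> B ^ Suc m" .
  qed (use assms in auto)
  finally show ?case by (simp add: algebra_simps)
qed simp

text \<open>Both y_k and z_k = exp (e_k X) equal 1 + e_k X up to o(e_k). About t / e_k factors
  multiply this error only by a bounded multiple of 1 / e_k, since the factors have norm at most exp
  (e_k C) and their product is bounded by exp (t C).\<close>

lemma power_tendsto_exp:
  fixes X :: "'b::{real_normed_algebra_1,banach}"
  assumes e: "\<And>k. 0 < e k" "e \<longlonglongrightarrow> 0"
    and y: "(\<lambda>k. (y k - 1) /\<^sub>R e k) \<longlonglongrightarrow> X" and t: "0 \<le> t"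
  shows "(\<lambda>k. y k ^ nat \<lfloor>t / e k\<rfloor>) \<longlonglongrightarrow> exp (t *\<^sub>R X)"
proof -
  define z where "z k = exp (e k *\<^sub>R X)" for k
  define m where "m k = nat \<lfloor>t / e k\<rfloor>" for k
  \<comment> \<open>The summand 1 leaves room: the difference quotients of \<open>y\<close> tend to
    \<open>X\<close>, so their norms are eventually below \<open>C\<close>.\<close>
  define C where "C = norm X + 1"
  have m_le: "real (m k) * e k \<le> t" for k
  proof -
    have "real (m k) \<le> t / e k" using t e(1)[of k] by (simp add: m_def)
    then show ?thesis using e(1)[of k] by (simp add: field_simps)
  qed
  have m_ge: "t - e k \<le> real (m k) * e k" for k
  proof -
    have "t / e k - 1 \<le> real (m k)" unfolding m_def by linarith
    then show ?thesis using e(1)[of k] by (simp add: field_simps)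
  qed
  have me: "(\<lambda>k. real (m k) * e k) \<longlonglongrightarrow> t"
  proof (rule tendsto_sandwich[of "\<lambda>k. t - e k" _ _ "\<lambda>_. t"])
    show "(\<lambda>k. t - e k) \<longlonglongrightarrow> t" using tendsto_diff[OF tendsto_const e(2), of t] by simp
  qed (use m_le m_ge in auto)
  have zm: "(\<lambda>k. z k ^ m k) \<longlonglongrightarrow> exp (t *\<^sub>R X)"
  proof -
    have "isCont (\<lambda>t. exp (t *\<^sub>R X)) t"
      by (rule has_vector_derivative_continuous[OF exp_scaleR_has_vector_derivative_right])
    from isCont_tendsto_compose[OF this me] show ?thesis by (simp add: z_def exp_scaleR_power)
  qed
  have zd: "(\<lambda>k. (z k - 1) /\<^sub>R e k) \<longlonglongrightarrow> X"
  proof -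
    have "((\<lambda>t. exp (t *\<^sub>R X)) has_derivative (\<lambda>h. h *\<^sub>R X)) (at 0)"
      using exp_scaleR_has_vector_derivative_right[of X 0 UNIV] by (simp add: has_vector_derivative_def)
    then have "((\<lambda>h. norm (exp (h *\<^sub>R X) - 1 - h *\<^sub>R X) / norm h) \<longlongrightarrow> 0) (at 0)"
      by (simp add: has_derivative_at)
    moreover have "filterlim e (at 0) sequentially"
      using e by (auto simp: filterlim_at intro!: always_eventually) (metis less_irrefl)
    ultimately have "(\<lambda>k. norm (z k - 1 - e k *\<^sub>R X) / norm (e k)) \<longlonglongrightarrow> 0"
      unfolding z_def by (rule filterlim_compose)
    moreover have "norm (z k - 1 - e k *\<^sub>R X) / norm (e k) = norm ((z k - 1) /\<^sub>R e k - X)" for k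
    proof -
      have "(z k - 1) /\<^sub>R e k - X = (z k - 1 - e k *\<^sub>R X) /\<^sub>R e k"
        using e(1)[of k] by (simp add: scaleR_diff_right)
      then show ?thesis by (simp add: divide_inverse mult.commute)
    qed
    ultimately show ?thesis using LIM_zero_cancel tendsto_norm_zero_cancel by fastforce
  qed
  have nz: "norm (z k) \<le> exp (e k * C)" for k
  proof -
    have "norm (z k) \<le> exp (norm (e k *\<^sub>R X))" unfolding z_def by (rule norm_exp)
    also have "\<dots> \<le> exp (e k * C)" using e(1)[of k] by (simp add: C_def)
    finally show ?thesis .
  qed
  have "(\<lambda>k. norm ((y k - 1) /\<^sub>R e k)) \<longlonglongrightarrow> norm X" using y by (rule tendsto_norm)
  then have "\<forall>\<^sub>F k in sequentially. norm ((y k - 1) /\<^sub>R e k) < C"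
    by (rule order_tendstoD) (simp add: C_def)
  then have ny: "\<forall>\<^sub>F k in sequentially. norm (y k) \<le> exp (e k * C)"
  proof eventually_elim
    case (elim k)
    have "norm (y k - 1) \<le> e k * C"
    proof -
      have "norm (y k - 1) / e k < C" using elim e(1)[of k] by (simp add: divide_inverse mult.commute)
      then show ?thesis using e(1)[of k] by (simp add: field_simps)
    qed
    moreover have "norm (y k) \<le> norm (y k - 1) + 1" using norm_triangle_ineq[of "y k - 1" 1] by simp
    ultimately show ?case using exp_ge_add_one_self[of "e k * C"] by linarith
  qed
  have "(\<lambda>k. y k ^ m k - z k ^ m k) \<longlonglongrightarrow> 0"
  proof (rule Lim_null_comparison)
    show "\<forall>\<^sub>F k in sequentially. norm (y k ^ m k - z k ^ m k) \<le>
      t * exp (t * C) * norm ((y k - 1) /\<^sub>R e k - (z k - 1) /\<^sub>R e k)"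
      using ny
    proof eventually_elim
      case (elim k)
      have C0: "0 \<le> C" by (simp add: C_def)
      have "norm (y k ^ m k - z k ^ m k) \<le> real (m k) * exp (e k * C) ^ m k * norm (y k - z k)"
        using elim nz C0 e(1)[of k] by (intro norm_power_diff_le) auto
      also have "exp (e k * C) ^ m k = exp ((real (m k) * e k) * C)"
        by (simp add: exp_of_nat_mult[symmetric] mult_ac)
      also have "real (m k) * exp ((real (m k) * e k) * C) * norm (y k - z k) =
          (real (m k) * e k) * exp ((real (m k) * e k) * C) * (norm (y k - z k) / e k)"
        using e(1)[of k] by simp
      also have "\<dots> \<le> t * exp (t * C) * (norm (y k - z k) / e k)"
        using m_le[of k] C0 e(1)[of k] t
        by (intro mult_right_mono mult_mono) (auto intro!: mult_right_mono)
      also have "norm (y k - z k) / e k = norm ((y k - 1) /\<^sub>R e k - (z k - 1) /\<^sub>R e k)"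
        using e(1)[of k] by (simp add: scaleR_diff_right[symmetric] divide_inverse mult.commute)
      finally show ?case .
    qed
    show "(\<lambda>k. t * exp (t * C) * norm ((y k - 1) /\<^sub>R e k - (z k - 1) /\<^sub>R e k)) \<longlonglongrightarrow> 0"
      by (intro tendsto_mult_right_zero tendsto_norm_zero) (use tendsto_diff[OF y zd] in simp)
  qed
  from tendsto_add[OF this zm] show ?thesis by (simp add: m_def)
qed

definition mexp :: "'a::{real_normed_field,banach}^'n^'n \<Rightarrow> 'a^'n^'n" where
  "mexp A = mat_of (exp (Sqm A))"

lemma Sqm_mat_1: "Sqm (mat 1) = 1" and Sqm_0: "Sqm 0 = 0"
  and Sqm_mult: "Sqm (A ** B) = Sqm A * Sqm B" and Sqm_add: "Sqm (A + B) = Sqm A + Sqm B"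
  and Sqm_diff: "Sqm (A - B) = Sqm A - Sqm B"
  and Sqm_scaleR: "Sqm (c *\<^sub>R A) = c *\<^sub>R Sqm A"
  by (simp_all add: sqm_eq_iff)

lemma mexp_0 [simp]: "mexp 0 = mat 1"
  by (simp add: mexp_def Sqm_0)

lemma mexp_add:
  fixes A B :: "'a::{real_normed_field,banach}^'n^'n"
  shows "A ** B = B ** A \<Longrightarrow> mexp (A + B) = mexp A ** mexp B"
  using exp_add_commuting[of "Sqm A" "Sqm B"] by (simp add: mexp_def Sqm_add sqm_eq_iff)

lemma mexp_scaleR_add: "mexp ((s + t) *\<^sub>R A) = mexp (s *\<^sub>R A) ** mexp (t *\<^sub>R A)"
  unfolding scaleR_left_distrib by (rule mexp_add) (simp add: matrix_mult_scaleR mult.commute)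

lemma mexp_mult_uminus: "mexp A ** mexp (- A) = mat 1" "mexp (- A) ** mexp A = mat 1"
  using mexp_scaleR_add[of 1 "-1" A] mexp_scaleR_add[of "-1" 1 A] by simp_all

lemma invertible_mexp: "invertible (mexp A)"
  using mexp_mult_uminus unfolding invertible_def by blast

lemma mexp_has_vector_derivative:
  "((\<lambda>t. mexp (t *\<^sub>R A)) has_vector_derivative mexp (t *\<^sub>R A) ** A) (at t within T)"
  using bounded_linear.has_vector_derivative[OF bounded_linear_mat_of
      exp_scaleR_has_vector_derivative_right[of "Sqm A" t T]]
  by (simp add: mexp_def Sqm_scaleR)

text \<open>The map may be applied to the exponential series term by term. Only real linearity is
  asked for, which admits complex conjugation of the entries beside the inclusion of the real
  matrices and conjugation by a group element.\<close>

lemma mexp_hom: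
  fixes \<phi> :: "'a::{real_normed_field,banach}^'n^'n \<Rightarrow> 'b::{real_normed_field,banach}^'n^'n"
  assumes "bounded_linear \<phi>" "\<And>A B. \<phi> (A ** B) = \<phi> A ** \<phi> B" "\<phi> (mat 1) = mat 1"
  shows "\<phi> (mexp A) = mexp (\<phi> A)"
proof -
  define \<psi> where "\<psi> X = Sqm (\<phi> (mat_of X))" for X
  have bl: "bounded_linear \<psi>"
    unfolding \<psi>_def
    by (intro bounded_linear_compose[OF bounded_linear_Sqm] bounded_linear_compose[OF assms(1)]
        bounded_linear_mat_of)
  have pow: "\<psi> (X ^ k) = \<psi> X ^ k" for X k
    by (induction k) (simp_all add: \<psi>_def assms Sqm_mult Sqm_mat_1)
  have "(\<lambda>n. \<psi> (X ^ n /\<^sub>R fact n)) sums \<psi> (exp X)" for X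
    by (rule bounded_linear.sums[OF bl exp_converges])
  then have "(\<lambda>n. \<psi> X ^ n /\<^sub>R fact n) sums \<psi> (exp X)" for X
    by (simp add: linear_cmul[OF bounded_linear.linear[OF bl]] pow)
  then have "\<psi> (exp X) = exp (\<psi> X)" for X using exp_converges sums_unique2 by blast
  from this[of "Sqm A"] show ?thesis by (simp add: \<psi>_def mexp_def sqm_eq_iff)
qed

text \<open>The partial sums are polynomials in the entries of \<open>F\<close>. On a closed disc
  the norm of \<open>F\<close> is bounded by some \<open>M\<close>, and the exponential series of
  \<open>M\<close> dominates them.\<close>

lemma holomorphic_on_mexp:
  fixes F :: "complex \<Rightarrow> complex^'n^'n"
  assumes F: "\<And>i j. (\<lambda>z. F z $ i $ j) holomorphic_on UNIV"
  shows "(\<lambda>z. mexp (F z) $ i $ j) holomorphic_on UNIV"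
proof (rule holomorphic_uniform_sequence)
  let ?p = "\<lambda>z k. mat_of (Sqm (F z) ^ k)"
  have hol: "(\<lambda>z. ?p z k $ i $ j) holomorphic_on UNIV" for k i j
  proof (induction k arbitrary: i j)
    case 0
    then show ?case by (simp add: mat_def)
  next
    case (Suc k)
    then show ?case using F by (simp add: matrix_matrix_mult_def) (intro holomorphic_intros)
  qed
  show "(\<lambda>z. \<Sum>k<m. ?p z k $ i $ j / fact k) holomorphic_on UNIV" for m
    by (intro holomorphic_intros hol) auto
  fix z0 :: complex
  have "continuous_on (cball z0 1) (\<lambda>z. norm (Sqm (F z)))"
  proof (intro continuous_on_norm bounded_linear.continuous_on[OF bounded_linear_Sqm])
    have "continuous_on (cball z0 1) (\<lambda>z. F z $ i $ j)" for i j
      using holomorphic_on_imp_continuous_on[OF F] continuous_on_subset by blast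
    then show "continuous_on (cball z0 1) F"
      unfolding continuous_on_def by (intro ballI vec_tendstoI) auto
  qed
  then have "bounded ((\<lambda>z. norm (Sqm (F z))) ` cball z0 1)"
    by (intro compact_imp_bounded compact_continuous_image) auto
  then obtain M where M: "\<And>z. z \<in> cball z0 1 \<Longrightarrow> norm (Sqm (F z)) \<le> M" and "M > 0"
    unfolding bounded_pos by (force simp del: mem_cball)
  have entry: "norm (mat_of X $ i $ j) \<le> norm X" for X :: "(complex, 'n) sqm"
  proof -
    have "norm (mat_of X $ i $ j) \<le> (\<Sum>j\<in>UNIV. norm (mat_of X $ i $ j))"
      by (rule member_le_sum) auto
    then show ?thesis using row_le_norm[of X i] by linarith
  qed
  have "uniform_limit (cball z0 1) (\<lambda>m z. \<Sum>k<m. ?p z k $ i $ j / fact k)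
      (\<lambda>z. suminf (\<lambda>k. ?p z k $ i $ j / fact k)) sequentially"
  proof (rule Weierstrass_m_test)
    fix k z assume z: "z \<in> cball z0 1"
    have "norm (?p z k $ i $ j) \<le> norm (Sqm (F z)) ^ k"
      by (rule order_trans[OF entry norm_power_ineq])
    also have "\<dots> \<le> M ^ k" by (intro power_mono M z) auto
    finally show "norm (?p z k $ i $ j / fact k) \<le> M ^ k /\<^sub>R fact k"
      by (simp add: norm_mult norm_inverse divide_inverse mult.commute mult_left_mono)
  next
    show "summable (\<lambda>k. M ^ k /\<^sub>R fact k)" using exp_converges[of M] sums_summable by blast
  qed
  moreover have "suminf (\<lambda>k. ?p z k $ i $ j / fact k) = mexp (F z) $ i $ j" for z
  proof -
    have bl: "bounded_linear (\<lambda>X. mat_of X $ i $ j)"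
      by (intro bounded_linear_compose[OF bounded_linear_vec_nth] bounded_linear_mat_of)
    from bounded_linear.sums[OF this exp_converges[of "Sqm (F z)"]]
    have "(\<lambda>k. ?p z k $ i $ j / fact k) sums (mexp (F z) $ i $ j)"
      by (simp add: mexp_def scaleR_conv_of_real[where 'a = complex] divide_inverse mult.commute)
    then show ?thesis by (rule sums_unique[symmetric])
  qed
  ultimately show "\<exists>d>0. cball z0 d \<subseteq> UNIV \<and> uniform_limit (cball z0 d)
      (\<lambda>m z. \<Sum>k<m. ?p z k $ i $ j / fact k) (\<lambda>z. mexp (F z) $ i $ j) sequentially"
    by (intro exI[of _ 1]) auto
qed auto



section \<open>Closed matrix groups and their Lie algebras\<close>

lemma bounded_bilinear_matrix_mult:
  "bounded_bilinear ((**) :: 'a::real_normed_field^'n^'n \<Rightarrow> 'a^'n^'n \<Rightarrow> 'a^'n^'n)"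
proof
  fix A A' B B' :: "'a^'n^'n" and r :: real
  show "(A + A') ** B = A ** B + A' ** B" "A ** (B + B') = A ** B + A ** B'"
    "(r *\<^sub>R A) ** B = r *\<^sub>R (A ** B)" "A ** (r *\<^sub>R B) = r *\<^sub>R (A ** B)"
    by (simp_all add: matrix_mult_add matrix_mult_scaleR)
  obtain K where K: "K > 0" "\<And>X :: ('a, 'n) sqm. norm (mat_of X) \<le> norm X * K"
    using bounded_linear.pos_bounded[OF bounded_linear_mat_of] by blast
  obtain L where L: "L > 0" "\<And>X :: 'a^'n^'n. norm (Sqm X) \<le> norm X * L"
    using bounded_linear.pos_bounded[OF bounded_linear_Sqm] by blast
  have "norm (A ** B) \<le> norm A * norm B * (L * L * K)" for A B :: "'a^'n^'n"
  proof -
    have "norm (A ** B) \<le> norm (Sqm A * Sqm B) * K" using K(2)[of "Sqm A * Sqm B"] by simp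
    also have "\<dots> \<le> (norm (Sqm A) * norm (Sqm B)) * K"
      using K(1) by (intro mult_right_mono norm_mult_ineq) auto
    also have "\<dots> \<le> ((norm A * L) * (norm B * L)) * K"
      using K(1) L by (intro mult_right_mono mult_mono) auto
    finally show ?thesis by (simp add: mult_ac)
  qed
  then show "\<exists>K. \<forall>(A :: 'a^'n^'n) (B :: 'a^'n^'n). norm (A ** B) \<le> norm A * norm B * K" by blast
qed

lemmas tendsto_matrix_mult = bounded_bilinear.tendsto[OF bounded_bilinear_matrix_mult]

lemma matrix_inv_mult [simp]:
  assumes "invertible A"
  shows "A ** matrix_inv A = mat 1" "matrix_inv A ** A = mat 1"
  using someI_ex[OF assms[unfolded invertible_def]] unfolding matrix_inv_def by auto

lemma matrix_inv_eqI:
  fixes A B :: "'a::semiring_1^'n^'n"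
  shows "A ** B = mat 1 \<Longrightarrow> B ** A = mat 1 \<Longrightarrow> matrix_inv A = B"
  by (metis invertible_def matrix_inv_mult(2) matrix_mul_assoc matrix_mul_lid matrix_mul_rid)

lemma invertible_mat_1: "invertible (mat 1 :: 'a::semiring_1^'n^'n)"
  unfolding invertible_def by (intro exI[of _ "mat 1"]) simp

lemma invertible_matrix_inv:
  fixes A :: "'a::semiring_1^'n^'n"
  shows "invertible A \<Longrightarrow> invertible (matrix_inv A)"
  using matrix_inv_mult[of A] unfolding invertible_def by blast

text \<open>With z = 1 + u and inverse w one has w - 1 = - w u. Once u has norm below 1/2 this
  bounds w by 2 and then w - 1 by twice the norm of u.\<close>

lemma tendsto_matrix_inv_1:
  fixes z :: "nat \<Rightarrow> 'a::real_normed_field^'n^'n"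
  assumes z: "z \<longlonglongrightarrow> mat 1" and inv: "\<And>k. invertible (z k)"
  shows "(\<lambda>k. matrix_inv (z k)) \<longlonglongrightarrow> mat 1"
proof -
  define u where "u k = Sqm (z k) - 1" for k
  define w where "w k = Sqm (matrix_inv (z k))" for k
  have "(\<lambda>k. Sqm (z k)) \<longlonglongrightarrow> Sqm (mat 1)" by (rule bounded_linear.tendsto[OF bounded_linear_Sqm z])
  then have u0: "u \<longlonglongrightarrow> 0" unfolding u_def by (simp add: LIM_zero Sqm_mat_1)
  have w: "w k - 1 = - (w k * u k)" for k
    using inv[of k] by (simp add: w_def u_def algebra_simps sqm_eq_iff)
  have "\<forall>\<^sub>F k in sequentially. norm (u k) < 1 / 2"
    using tendstoD[OF u0, of "1 / 2"] by simp
  then have "\<forall>\<^sub>F k in sequentially. norm (w k - 1) \<le> 2 * norm (u k)"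
  proof eventually_elim
    case (elim k)
    have le: "norm (w k - 1) \<le> norm (w k) * norm (u k)" unfolding w by (simp add: norm_mult_ineq)
    have "norm (w k) * norm (u k) \<le> norm (w k) * (1 / 2)" using elim by (intro mult_left_mono) auto
    moreover have "norm (w k) \<le> norm (w k - 1) + 1" using norm_triangle_ineq[of "w k - 1" 1] by simp
    ultimately have "norm (w k) \<le> 2" using le by linarith
    then show ?case using le mult_right_mono[of "norm (w k)" 2 "norm (u k)"] by simp
  qed
  moreover have "(\<lambda>k. 2 * norm (u k)) \<longlonglongrightarrow> 0"
    by (intro tendsto_mult_right_zero tendsto_norm_zero u0)
  ultimately have "(\<lambda>k. w k - 1) \<longlonglongrightarrow> 0" by (rule Lim_null_comparison)
  then have "w \<longlonglongrightarrow> 1" by (rule LIM_zero_cancel)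
  from bounded_linear.tendsto[OF bounded_linear_mat_of this] show ?thesis by (simp add: w_def)
qed

lemma group_GL: "group (GL :: ('a::field^'n^'n) monoid)"
proof (rule groupI)
  fix A B C :: "'a^'n^'n"
  show "A \<otimes>\<^bsub>GL\<^esub> B \<in> carrier GL" if "A \<in> carrier GL" "B \<in> carrier GL"
    using that by (simp add: GL_def invertible_mult)
  show "A \<otimes>\<^bsub>GL\<^esub> B \<otimes>\<^bsub>GL\<^esub> C = A \<otimes>\<^bsub>GL\<^esub> (B \<otimes>\<^bsub>GL\<^esub> C)"
    by (simp add: GL_def matrix_mul_assoc)
  show "\<exists>B\<in>carrier GL. B \<otimes>\<^bsub>GL\<^esub> A = \<one>\<^bsub>GL\<^esub>" if "A \<in> carrier GL"
    using that by (intro bexI[of _ "matrix_inv A"]) (auto simp: GL_def invertible_matrix_inv)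
qed (auto simp: GL_def invertible_mat_1)

lemma inv_GL: "invertible A \<Longrightarrow> inv\<^bsub>GL\<^esub> A = matrix_inv A"
  for A :: "'a::field^'n^'n"
  using group.inv_equality[OF group_GL, of "matrix_inv A" A] matrix_inv_mult[of A]
    invertible_matrix_inv[of A]
  by (simp add: GL_def)

lemma subgroup_GL_iff:
  fixes K :: "('a::field^'n^'n) set"
  shows "subgroup K GL \<longleftrightarrow> (\<forall>A\<in>K. invertible A) \<and> mat 1 \<in> K \<and> (\<forall>A\<in>K. \<forall>B\<in>K. A ** B \<in> K) \<and>
    (\<forall>A\<in>K. matrix_inv A \<in> K)" (is "?L \<longleftrightarrow> ?R")
proof
  assume ?L
  then have inv: "invertible A" if "A \<in> K" for A using that subgroup.subset[OF \<open>?L\<close>] by (auto simp: GL_def)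
  have "mat 1 \<in> K" using subgroup.one_closed[OF \<open>?L\<close>] by (simp add: GL_def)
  moreover have "A ** B \<in> K" if "A \<in> K" "B \<in> K" for A B
    using subgroup.m_closed[OF \<open>?L\<close> that] by (simp add: GL_def)
  moreover have "matrix_inv A \<in> K" if "A \<in> K" for A
    using subgroup.m_inv_closed[OF \<open>?L\<close> that] inv[OF that] by (simp add: inv_GL)
  ultimately show ?R using inv by blast
next
  assume ?R
  show ?L
  proof (rule group.subgroupI[OF group_GL])
    show "K \<subseteq> carrier GL" "K \<noteq> {}" using \<open>?R\<close> by (auto simp: GL_def)
    show "inv\<^bsub>GL\<^esub> A \<in> K" if "A \<in> K" for A using that \<open>?R\<close> by (simp add: inv_GL)
    show "A \<otimes>\<^bsub>GL\<^esub> B \<in> K" if "A \<in> K" "B \<in> K" for A B using that \<open>?R\<close> by (simp add: GL_def)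
  qed
qed

text \<open>Closedness is relative to the general linear group: a limit has to belong to
  \<open>K\<close> only if it is invertible.\<close>

definition closed_matrix_group :: "('a::real_normed_field^'n^'n) set \<Rightarrow> bool" where
  "closed_matrix_group K \<longleftrightarrow> subgroup K GL \<and>
     (\<forall>y L. range y \<subseteq> K \<longrightarrow> y \<longlonglongrightarrow> L \<longrightarrow> invertible L \<longrightarrow> L \<in> K)"

lemma closed_matrix_groupD:
  assumes "closed_matrix_group K"
  shows "A \<in> K \<Longrightarrow> invertible A" "mat 1 \<in> K" "A \<in> K \<Longrightarrow> B \<in> K \<Longrightarrow> A ** B \<in> K"
    "A \<in> K \<Longrightarrow> matrix_inv A \<in> K"
    "(\<And>k::nat. y k \<in> K) \<Longrightarrow> y \<longlonglongrightarrow> L \<Longrightarrow> invertible L \<Longrightarrow> L \<in> K"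
proof -
  have K: "subgroup K GL" "\<And>y L. range y \<subseteq> K \<Longrightarrow> y \<longlonglongrightarrow> L \<Longrightarrow> invertible L \<Longrightarrow> L \<in> K"
    using assms unfolding closed_matrix_group_def by blast+
  show "A \<in> K \<Longrightarrow> invertible A" "mat 1 \<in> K" "A \<in> K \<Longrightarrow> B \<in> K \<Longrightarrow> A ** B \<in> K"
    "A \<in> K \<Longrightarrow> matrix_inv A \<in> K"
    using K(1) by (simp_all add: subgroup_GL_iff)
  show "(\<And>k::nat. y k \<in> K) \<Longrightarrow> y \<longlonglongrightarrow> L \<Longrightarrow> invertible L \<Longrightarrow> L \<in> K"
    by (rule K(2)) auto
qed

text \<open>The Lie algebra through one-parameter groups. It agrees with \<open>lie_algebra\<close>
  on closed groups, and intersections and conjugates are immediate in this form.\<close>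

definition lie_exp :: "('a::{real_normed_field,banach}^'n^'n) set \<Rightarrow> ('a^'n^'n) set" where
  "lie_exp K = {X. \<forall>t. mexp (t *\<^sub>R X) \<in> K}"

lemma mat_of_power_mem:
  assumes "closed_matrix_group K" "A \<in> K"
  shows "mat_of (Sqm A ^ m) \<in> K"
proof (induction m)
  case 0
  show ?case using closed_matrix_groupD(2)[OF assms(1)] by simp
next
  case (Suc m)
  show ?case using closed_matrix_groupD(3)[OF assms(1) assms(2) Suc] by simp
qed

text \<open>The powers of \<open>y k\<close> with exponent about t / e_k lie in \<open>K\<close> and
  tend to exp (t X), which is invertible and so lies in \<open>K\<close>. Negative t are reached by
  inverses.\<close>

lemma lie_expI_sequence:
  fixes K :: "('a::{real_normed_field,banach}^'n^'n) set"
  assumes K: "closed_matrix_group K" and y: "\<And>k. y k \<in> K"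
    and e: "\<And>k. 0 < e k" "e \<longlonglongrightarrow> 0" and lim: "(\<lambda>k. (y k - mat 1) /\<^sub>R e k) \<longlonglongrightarrow> X"
  shows "X \<in> lie_exp K"
proof -
  have pos: "mexp (t *\<^sub>R X) \<in> K" if "0 \<le> t" for t
  proof -
    have "(\<lambda>k. (Sqm (y k) - 1) /\<^sub>R e k) \<longlonglongrightarrow> Sqm X"
      using bounded_linear.tendsto[OF bounded_linear_Sqm lim] by (simp add: Sqm_scaleR Sqm_diff Sqm_mat_1)
    from bounded_linear.tendsto[OF bounded_linear_mat_of power_tendsto_exp[OF e this that]]
    have "(\<lambda>k. mat_of (Sqm (y k) ^ nat \<lfloor>t / e k\<rfloor>)) \<longlonglongrightarrow> mexp (t *\<^sub>R X)"
      by (simp add: mexp_def Sqm_scaleR)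
    then show ?thesis
      by (rule closed_matrix_groupD(5)[OF K mat_of_power_mem[OF K y] _ invertible_mexp])
  qed
  have "mexp (t *\<^sub>R X) \<in> K" for t
  proof (cases "0 \<le> t")
    case False
    then have "matrix_inv (mexp ((- t) *\<^sub>R X)) \<in> K" using pos[of "- t"] closed_matrix_groupD(4)[OF K] by simp
    moreover have "matrix_inv (mexp ((- t) *\<^sub>R X)) = mexp (t *\<^sub>R X)"
      using mexp_mult_uminus[of "t *\<^sub>R X"] by (intro matrix_inv_eqI) auto
    ultimately show ?thesis by simp
  qed (rule pos)
  then show ?thesis by (simp add: lie_exp_def)
qed

lemma lie_expI_curve:
  fixes K :: "('a::{real_normed_field,banach}^'n^'n) set"
  assumes K: "closed_matrix_group K" and \<gamma>: "\<And>t. \<gamma> t \<in> K" "\<gamma> 0 = mat 1"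
    and der: "(\<gamma> has_vector_derivative X) (at 0)"
  shows "X \<in> lie_exp K"
proof (rule lie_expI_sequence[OF K])
  let ?e = "\<lambda>k. inverse (real (Suc k))"
  show "\<gamma> (?e k) \<in> K" "0 < ?e k" for k using \<gamma> by auto
  show "?e \<longlonglongrightarrow> 0" by (rule LIMSEQ_inverse_real_of_nat)
  have "((\<lambda>h. norm (\<gamma> h - mat 1 - h *\<^sub>R X) / norm h) \<longlongrightarrow> 0) (at 0)"
    using der \<gamma>(2) by (simp add: has_vector_derivative_def has_derivative_at)
  moreover have "filterlim ?e (at 0) sequentially"
    using LIMSEQ_inverse_real_of_nat by (auto simp: filterlim_at)
  ultimately have "(\<lambda>k. norm (\<gamma> (?e k) - mat 1 - ?e k *\<^sub>R X) / norm (?e k)) \<longlonglongrightarrow> 0"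
    by (rule filterlim_compose)
  moreover have "norm (\<gamma> (?e k) - mat 1 - ?e k *\<^sub>R X) / norm (?e k) =
      norm ((\<gamma> (?e k) - mat 1) /\<^sub>R ?e k - X)" for k
  proof -
    have "(\<gamma> (?e k) - mat 1) /\<^sub>R ?e k - X = (\<gamma> (?e k) - mat 1 - ?e k *\<^sub>R X) /\<^sub>R ?e k"
      by (simp add: scaleR_diff_right)
    then show ?thesis by (simp only: norm_scaleR) (simp add: divide_inverse mult.commute)
  qed
  ultimately have "(\<lambda>k. norm ((\<gamma> (?e k) - mat 1) /\<^sub>R ?e k - X)) \<longlonglongrightarrow> 0" by (simp only:)
  then show "(\<lambda>k. (\<gamma> (?e k) - mat 1) /\<^sub>R ?e k) \<longlonglongrightarrow> X"
    by (rule LIM_zero_cancel[OF tendsto_norm_zero_cancel])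
qed

text \<open>For sums: the curve exp (t X) exp (t Y) runs in \<open>K\<close> and has velocity X + Y
  at 0.\<close>

lemma subspace_lie_exp:
  assumes K: "closed_matrix_group (K :: ('a::{real_normed_field,banach}^'n^'n) set)"
  shows "Real_Vector_Spaces.subspace (lie_exp K)"
proof (rule Real_Vector_Spaces.real_vector.subspaceI)
  show "0 \<in> lie_exp K" using closed_matrix_groupD[OF K] by (simp add: lie_exp_def)
  show "c *\<^sub>R X \<in> lie_exp K" if "X \<in> lie_exp K" for c X using that by (simp add: lie_exp_def)
  fix X Y assume XY: "X \<in> lie_exp K" "Y \<in> lie_exp K"
  show "X + Y \<in> lie_exp K"
  proof (rule lie_expI_curve[OF K])
    show "mexp (t *\<^sub>R X) ** mexp (t *\<^sub>R Y) \<in> K" for t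
      using XY closed_matrix_groupD(3)[OF K] by (simp add: lie_exp_def)
    show "((\<lambda>t. mexp (t *\<^sub>R X) ** mexp (t *\<^sub>R Y)) has_vector_derivative X + Y) (at 0)"
      using bounded_bilinear.has_vector_derivative[OF bounded_bilinear_matrix_mult
          mexp_has_vector_derivative[of X 0] mexp_has_vector_derivative[of Y 0]]
      by (simp add: add.commute)
  qed simp
qed

lemma lie_algebra_eq_lie_exp:
  assumes "closed_matrix_group K"
  shows "lie_algebra K = lie_exp K"
proof
  show "lie_algebra K \<subseteq> lie_exp K"
    unfolding lie_algebra_def by (auto intro!: lie_expI_curve[OF assms])
  show "lie_exp K \<subseteq> lie_algebra K"
  proof
    fix X assume X: "X \<in> lie_exp K"
    have "continuous_on UNIV (\<lambda>t. mexp (t *\<^sub>R X))"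
      by (intro continuous_at_imp_continuous_on ballI
          has_vector_derivative_continuous[OF mexp_has_vector_derivative])
    then have "continuous_on UNIV (\<lambda>t. mexp (t *\<^sub>R X) ** X)"
      by (intro bounded_bilinear.continuous_on[OF bounded_bilinear_matrix_mult] continuous_on_const)
    then have "(\<lambda>t. mexp (t *\<^sub>R X)) C1_differentiable_on UNIV"
      unfolding C1_differentiable_on_def using mexp_has_vector_derivative
      by (intro exI[of _ "\<lambda>t. mexp (t *\<^sub>R X) ** X"] conjI ballI)
    then show "X \<in> lie_algebra K"
      using X mexp_has_vector_derivative[of X 0 UNIV] unfolding lie_algebra_def lie_exp_def
      by (intro CollectI exI[of _ "\<lambda>t. mexp (t *\<^sub>R X)"]) auto
  qed
qed

text \<open>For \<open>g\<close> near the identity let \<open>z\<close> be a point of \<open>Z\<close> nearest to \<open>g\<close>; then \<open>z\<^sup>-\<^sup>1 g - 1\<close> is almost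
  orthogonal to the Lie algebra of \<open>Z\<close>. If \<open>g \<notin> Z\<close>, the limit direction of \<open>z\<^sup>-\<^sup>1 g - 1\<close> as \<open>g\<close> tends to
  the identity lies in the Lie algebra of \<open>G\<close>, a contradiction.\<close>

theorem closed_matrix_group_open_subgroup:
  fixes G Z :: "(complex^'n^'n) set"
  assumes G: "closed_matrix_group G" and Z: "closed_matrix_group Z" and sub: "Z \<subseteq> G"
    and lie: "lie_exp G \<subseteq> lie_exp Z"
  shows "\<exists>e>0. \<forall>A\<in>G. dist A (mat 1) < e \<longrightarrow> A \<in> Z"
proof (rule ccontr)
  assume "\<not> ?thesis"
  then have "\<forall>k. \<exists>A. A \<in> G \<and> dist A (mat 1) < inverse (real (Suc k)) \<and> A \<notin> Z"
    using of_nat_0_less_iff inverse_positive_iff_positive by (metis zero_less_Suc)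
  then obtain g where g: "\<And>k. g k \<in> G" "\<And>k. dist (g k) (mat 1) < inverse (real (Suc k))" "\<And>k. g k \<notin> Z"
    by metis
  have g1: "g \<longlonglongrightarrow> mat 1"
    by (rule metric_tendsto_imp_tendsto[OF LIMSEQ_inverse_real_of_nat])
       (use g(2) in \<open>auto intro!: always_eventually less_imp_le\<close>)
  have "open {A :: complex^'n^'n. det A \<noteq> 0}"
  proof -
    have "continuous_on UNIV (det :: complex^'n^'n \<Rightarrow> complex)"
      unfolding det_def by (intro continuous_intros)
    from open_vimage[OF _ this, of "- {0}"] show ?thesis by (auto simp: vimage_def)
  qed
  \<comment> \<open>\<open>Z\<close> is closed only among invertible matrices; within a closed ball
    of invertible matrices it is truly closed, so nearest points exist.\<close>
  then obtain r where r: "r > 0" "cball (mat 1) r \<subseteq> {A :: complex^'n^'n. det A \<noteq> 0}"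
    using open_contains_cball by (metis (mono_tags, lifting) det_I mem_Collect_eq zero_neq_one)
  define C where "C = Z \<inter> cball (mat 1) r"
  have "closed C"
    unfolding closed_sequential_limits
  proof (intro allI impI)
    fix y L assume y: "(\<forall>k. y k \<in> C) \<and> y \<longlonglongrightarrow> L"
    then have "L \<in> cball (mat 1) r"
      using closed_sequentially[OF closed_cball, of y] by (auto simp: C_def)
    moreover from this have "invertible L" using r by (auto simp: invertible_det_nz)
    ultimately show "L \<in> C" using y closed_matrix_groupD(5)[OF Z, of y L] by (auto simp: C_def)
  qed
  have one: "mat 1 \<in> C" using closed_matrix_groupD(2)[OF Z] r by (auto simp: C_def)
  have "\<forall>k. \<exists>z\<in>C. \<forall>w\<in>C. dist (g k) z \<le> dist (g k) w"
  proof
    fix k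
    show "\<exists>z\<in>C. \<forall>w\<in>C. dist (g k) z \<le> dist (g k) w"
      by (rule distance_attains_inf[OF \<open>closed C\<close>, of "g k"]) (use one in auto)
  qed
  then obtain z where z: "\<And>k. z k \<in> C" "\<And>k w. w \<in> C \<Longrightarrow> dist (g k) (z k) \<le> dist (g k) w" by metis
  have zZ: "z k \<in> Z" for k using z by (auto simp: C_def)
  have z1: "z \<longlonglongrightarrow> mat 1"
  proof (rule metric_tendsto_imp_tendsto[OF tendsto_mult_right_zero[OF LIMSEQ_inverse_real_of_nat, of 2]])
    have "dist (z k) (mat 1) \<le> 2 * inverse (real (Suc k))" for k
      using z(2)[OF one, of k] g(2)[of k] dist_triangle2[of "z k" "mat 1" "g k"]
      by (simp add: dist_commute)
    then show "\<forall>\<^sub>F k in sequentially. dist (z k) (mat 1) \<le> dist (2 * inverse (real (Suc k))) 0"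
      by (intro always_eventually) auto
  qed
  define y where "y k = matrix_inv (z k) ** g k" for k
  have zy: "z k ** y k = g k" for k
    using closed_matrix_groupD(1)[OF Z zZ] by (simp add: y_def matrix_mul_assoc)
  have yG: "y k \<in> G" for k
    unfolding y_def using closed_matrix_groupD(3,4)[OF G] g zZ sub by blast
  have "y k \<noteq> mat 1" for k using zy[of k] g(3)[of k] zZ[of k] by auto
  define e where "e k = norm (y k - mat 1)" for k
  have e: "e k > 0" for k using \<open>y k \<noteq> mat 1\<close> by (simp add: e_def)
  have "y \<longlonglongrightarrow> mat 1"
  proof -
    have zi: "(\<lambda>k. matrix_inv (z k)) \<longlonglongrightarrow> mat 1"
      by (rule tendsto_matrix_inv_1[OF z1 closed_matrix_groupD(1)[OF Z zZ]])
    from tendsto_matrix_mult[OF zi g1] show ?thesis by (simp add: y_def[abs_def])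
  qed
  then have e0: "e \<longlonglongrightarrow> 0" unfolding e_def by (simp add: LIM_zero tendsto_norm_zero)
  have "\<forall>k. (y k - mat 1) /\<^sub>R e k \<in> sphere 0 1" using e by (simp add: e_def)
  then obtain X \<sigma> where X: "X \<in> sphere 0 1" and \<sigma>: "strict_mono (\<sigma> :: nat \<Rightarrow> nat)"
    and lim: "((\<lambda>k. (y k - mat 1) /\<^sub>R e k) \<circ> \<sigma>) \<longlonglongrightarrow> X"
    by (rule seq_compactE[OF compact_imp_seq_compact[OF compact_sphere]])
  have "X \<in> lie_exp G"
    using lim e LIMSEQ_subseq_LIMSEQ[OF e0 \<sigma>] yG
    by (intro lie_expI_sequence[OF G, of "y \<circ> \<sigma>" "e \<circ> \<sigma>"]) (auto simp: o_def)
  then have XZ: "mexp (t *\<^sub>R X) \<in> Z" for t using lie by (auto simp: lie_exp_def)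
  \<comment> \<open>The curve z_k exp (t X) stays in \<open>Z\<close>, and for small t in the ball,
    while z_k is nearest to g_k. So the squared distance to g_k has derivative 0 at t = 0.\<close>
  have orth: "\<forall>\<^sub>F k in sequentially. inner (z k ** (y k - mat 1)) (z k ** X) = 0"
  proof -
    have "\<forall>\<^sub>F k in sequentially. dist (z k) (mat 1) < r" using z1 r(1) by (rule tendstoD)
    then show ?thesis
    proof eventually_elim
      case (elim k)
      define f where "f t = (norm (g k - z k ** mexp (t *\<^sub>R X)))\<^sup>2" for t
      have der: "((\<lambda>t. g k - z k ** mexp (t *\<^sub>R X)) has_vector_derivative - (z k ** X)) (at 0)"
        using bounded_bilinear.has_vector_derivative[OF bounded_bilinear_matrix_mult
            has_vector_derivative_const mexp_has_vector_derivative[of X 0], of "z k"]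
        by (auto intro!: derivative_eq_intros)
      then have "(f has_real_derivative 2 * inner (g k - z k) (- (z k ** X))) (at 0)"
        unfolding f_def power2_norm_eq_inner has_real_derivative_iff_has_vector_derivative
        using bounded_bilinear.has_vector_derivative[OF bounded_bilinear_inner der der]
        by (simp add: inner_commute)
      moreover
      have "continuous (at 0) (\<lambda>t. z k ** mexp (t *\<^sub>R X))"
        using der by (intro has_vector_derivative_continuous[OF bounded_bilinear.has_vector_derivative[OF
              bounded_bilinear_matrix_mult has_vector_derivative_const mexp_has_vector_derivative]])
      then have "((\<lambda>t. z k ** mexp (t *\<^sub>R X)) \<longlongrightarrow> z k) (at 0)" by (simp add: continuous_within)
      then have "((\<lambda>t. dist (z k ** mexp (t *\<^sub>R X)) (mat 1)) \<longlongrightarrow> dist (z k) (mat 1)) (at 0)"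
        by (intro tendsto_intros)
      from order_tendstoD(2)[OF this elim] obtain d where d: "d > 0"
        "\<And>t. t \<noteq> 0 \<Longrightarrow> dist t 0 < d \<Longrightarrow> dist (z k ** mexp (t *\<^sub>R X)) (mat 1) < r"
        unfolding eventually_at by auto
      have "f 0 \<le> f t" if "\<bar>0 - t\<bar> < d" for t
      proof (cases "t = 0")
        case False
        then have "z k ** mexp (t *\<^sub>R X) \<in> C"
          using d(2)[of t] that closed_matrix_groupD(3)[OF Z zZ XZ]
          by (auto simp: C_def dist_commute less_imp_le)
        from z(2)[OF this, of k] show ?thesis by (simp add: f_def dist_norm power_mono)
      qed simp
      ultimately have "2 * inner (g k - z k) (- (z k ** X)) = 0"
        using DERIV_local_min d(1) by blast
      moreover have "g k - z k = z k ** (y k - mat 1)"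
        using zy[of k] by (metis bounded_bilinear.diff_right[OF bounded_bilinear_matrix_mult] matrix_mul_rid)
      ultimately show ?case by simp
    qed
  qed
  \<comment> \<open>Dividing the orthogonality by e_k and passing to the limit gives <X, X> = 0,
    although \<open>X\<close> has norm 1.\<close>
  have "(\<lambda>k. inner (z (\<sigma> k) ** ((y (\<sigma> k) - mat 1) /\<^sub>R e (\<sigma> k))) (z (\<sigma> k) ** X)) \<longlonglongrightarrow>
      inner (mat 1 ** X) (mat 1 ** X)"
    using lim LIMSEQ_subseq_LIMSEQ[OF z1 \<sigma>]
    by (intro tendsto_inner tendsto_matrix_mult tendsto_const) (auto simp: o_def)
  moreover have "\<forall>\<^sub>F k in sequentially.
      inner (z (\<sigma> k) ** ((y (\<sigma> k) - mat 1) /\<^sub>R e (\<sigma> k))) (z (\<sigma> k) ** X) = 0"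
    using eventually_subseq[OF \<sigma> orth] by eventually_elim (simp add: matrix_mult_scaleR)
  ultimately have "inner (mat 1 ** X) (mat 1 ** X) = 0"
    by (intro LIMSEQ_unique[OF _ tendsto_eventually])
  then show False using X by simp
qed



section \<open>Polynomial functions of the entries of a matrix\<close>

abbreviation entry_funs :: "('a^'n^'m \<Rightarrow> 'a) set" where
  "entry_funs \<equiv> range (\<lambda>(i, j) A. A $ i $ j)"

lemma entry_fun_mem: "(\<lambda>A. A $ i $ j) \<in> entry_funs"
  by force

lemma polyfun_entry: "(\<lambda>A. A $ i $ j) \<in> polyfun entry_funs"
  by (intro polyfun_gen entry_fun_mem)

lemma polyfun_det: "det \<in> polyfun entry_funs"
  unfolding det_def[abs_def]
  by (intro polyfun_sum polyfun_mult polyfun_const polyfun_prod polyfun_entry)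

lemma polyfun_compose_entries:
  fixes f :: "'a::comm_ring_1^'n^'m \<Rightarrow> 'a"
  assumes "f \<in> polyfun entry_funs" and "\<And>i j. (\<lambda>x. M x $ i $ j) \<in> polyfun Y"
  shows "(\<lambda>x. f (M x)) \<in> polyfun Y"
proof (rule polyfun_compose[OF assms(1)])
  fix g :: "'a^'n^'m \<Rightarrow> 'a" assume "g \<in> entry_funs"
  then obtain i j where "g = (\<lambda>A. A $ i $ j)" by auto
  then show "(\<lambda>x. g (M x)) \<in> polyfun Y" using assms(2) by simp
qed

lemma polyfun_tendsto:
  fixes f :: "'a::real_normed_field^'n^'m \<Rightarrow> 'a"
  assumes "f \<in> polyfun entry_funs" "(M \<longlongrightarrow> L) F"
  shows "((\<lambda>x. f (M x)) \<longlongrightarrow> f L) F"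
  using assms(1) by induction (use assms(2) in \<open>auto intro!: tendsto_intros\<close>)

lemma polyfun_holomorphic:
  fixes f :: "complex^'n^'m \<Rightarrow> complex"
  assumes "f \<in> polyfun entry_funs" "\<And>i j. (\<lambda>z. M z $ i $ j) holomorphic_on S"
  shows "(\<lambda>z. f (M z)) holomorphic_on S"
  using assms(1) by induction (use assms(2) in \<open>auto intro!: holomorphic_intros\<close>)

lemma eval_poly_in_polyfun: "eval_poly p \<in> polyfun entry_funs"
  unfolding eval_poly_def[abs_def]
  by (intro polyfun_sum polyfun_mult polyfun_const polyfun_prod polyfun_power polyfun_entry)

definition entry_monomial :: "('n \<times> 'n \<Rightarrow>\<^sub>0 nat) \<Rightarrow> complex^'n^'n \<Rightarrow> complex" where
  "entry_monomial m A = (\<Prod>i\<in>UNIV. \<Prod>j\<in>UNIV. A $ i $ j ^ Poly_Mapping.lookup m (i, j))"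

lemma entry_monomial_add: "entry_monomial (m + m') A = entry_monomial m A * entry_monomial m' A"
  by (simp add: entry_monomial_def lookup_add power_add prod.distrib)

lemma eval_poly_superset:
  assumes "finite S" "Poly_Mapping.keys p \<subseteq> S"
  shows "eval_poly p A = (\<Sum>m\<in>S. Poly_Mapping.lookup p m * entry_monomial m A)"
  unfolding eval_poly_def entry_monomial_def[symmetric]
  using assms by (intro sum.mono_neutral_left) (auto simp: in_keys_iff)

lemma eval_poly_add: "eval_poly (p + q) A = eval_poly p A + eval_poly q A"
proof -
  let ?S = "Poly_Mapping.keys p \<union> Poly_Mapping.keys q"
  have "eval_poly (p + q) A = (\<Sum>m\<in>?S. Poly_Mapping.lookup (p + q) m * entry_monomial m A)"
    by (intro eval_poly_superset) (auto dest: subsetD[OF Poly_Mapping.keys_add])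
  also have "\<dots> = (\<Sum>m\<in>?S. Poly_Mapping.lookup p m * entry_monomial m A) +
      (\<Sum>m\<in>?S. Poly_Mapping.lookup q m * entry_monomial m A)"
    by (simp add: lookup_add algebra_simps sum.distrib)
  also have "\<dots> = eval_poly p A + eval_poly q A"
    by (simp add: eval_poly_superset[of ?S])
  finally show ?thesis .
qed

lemma eval_poly_single: "eval_poly (Poly_Mapping.single m c) A = c * entry_monomial m A"
  by (subst eval_poly_superset[of "{m}"]) auto

text \<open>Needed because \<open>zariski\<close> is generated by formal polynomials, whereas the
  equations of the zero loci are known only as polynomial functions.\<close>

lemma polyfun_imp_eval_poly:
  fixes f :: "complex^'n^'n \<Rightarrow> complex"
  assumes "f \<in> polyfun entry_funs"
  shows "\<exists>p. f = eval_poly p"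
proof -
  let ?Q = "range eval_poly :: (complex^'n^'n \<Rightarrow> complex) set"
  have mono: "(\<lambda>A. c * entry_monomial m A) \<in> ?Q" for c and m :: "'n \<times> 'n \<Rightarrow>\<^sub>0 nat"
    by (intro image_eqI[where x = "Poly_Mapping.single m c"]) (auto simp: eval_poly_single fun_eq_iff)
  have add: "(\<lambda>A. f A + g A) \<in> ?Q" if fg: "f \<in> ?Q" "g \<in> ?Q" for f g
  proof -
    obtain p q where "f = eval_poly p" "g = eval_poly q" using fg by auto
    then show ?thesis by (intro image_eqI[where x = "p + q"]) (auto simp: eval_poly_add fun_eq_iff)
  qed
  have zero: "(\<lambda>_. 0) \<in> ?Q" using mono[of 0] by simp
  have sum: "(\<lambda>A. \<Sum>i\<in>I. F i A) \<in> ?Q" if "finite I" "\<And>i. i \<in> I \<Longrightarrow> F i \<in> ?Q"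
    for F and I :: "(('n \<times> 'n \<Rightarrow>\<^sub>0 nat) \<times> ('n \<times> 'n \<Rightarrow>\<^sub>0 nat)) set"
    using that by (induction I rule: finite_induct) (auto intro: zero add simp del: image_iff)
  have "f \<in> ?Q" using assms
  proof induction
    case (polyfun_const c)
    have "entry_monomial 0 A = 1" for A :: "complex^'n^'n" by (simp add: entry_monomial_def)
    then show ?case using mono[of c 0] by simp
  next
    case (polyfun_gen f)
    then obtain i j where f: "f = (\<lambda>A. A $ i $ j)" by auto
    have "entry_monomial (Poly_Mapping.single (i, j) 1) A = A $ i $ j" for A :: "complex^'n^'n"
    proof -
      have "entry_monomial (Poly_Mapping.single (i, j) 1) A =
          (\<Prod>k\<in>UNIV. \<Prod>l\<in>UNIV. if k = i \<and> l = j then A $ i $ j else 1)"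
        unfolding entry_monomial_def
        by (intro prod.cong refl) (auto simp: lookup_single when_def)
      also have "\<dots> = (\<Prod>k\<in>UNIV. if k = i then A $ i $ j else 1)"
        by (intro prod.cong refl) (auto simp: prod.delta)
      also have "\<dots> = A $ i $ j" by (simp add: prod.delta)
      finally show ?thesis .
    qed
    then show ?case using mono[of 1 "Poly_Mapping.single (i, j) 1"] by (simp add: f)
  next
    case (polyfun_add f g) then show ?case by (intro add)
  next
    case (polyfun_mult f g)
    then obtain p q where pq: "f = eval_poly p" "g = eval_poly q" by auto
    have "f A * g A = (\<Sum>mm\<in>Poly_Mapping.keys p \<times> Poly_Mapping.keys q.
        (Poly_Mapping.lookup p (fst mm) * Poly_Mapping.lookup q (snd mm)) * entry_monomial (fst mm + snd mm) A)" for A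
      unfolding pq eval_poly_def entry_monomial_def[symmetric]
      by (simp add: sum_product sum.cartesian_product entry_monomial_add split_def mult_ac)
    then have "(\<lambda>A. f A * g A) = (\<lambda>A. \<Sum>mm\<in>Poly_Mapping.keys p \<times> Poly_Mapping.keys q.
        (Poly_Mapping.lookup p (fst mm) * Poly_Mapping.lookup q (snd mm)) * entry_monomial (fst mm + snd mm) A)"
      by blast
    then show ?case by (simp only:) (intro sum mono, simp)
  qed
  then show ?thesis by auto
qed

lemma topspace_zariski [simp]: "topspace zariski = (UNIV :: (complex^'n^'n) set)"
proof -
  obtain p where "(\<lambda>_. 1) = (eval_poly p :: complex^'n^'n \<Rightarrow> complex)"
    using polyfun_imp_eval_poly[OF polyfun_const[of 1]] by auto
  then have "eval_poly p A \<noteq> 0" for A :: "complex^'n^'n" by (metis zero_neq_one)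
  then show ?thesis unfolding zariski_def by auto
qed

lemma closedin_zariski:
  assumes "F \<subseteq> polyfun entry_funs"
  shows "closedin zariski {A :: complex^'n^'n. \<forall>f\<in>F. f A = 0}"
proof -
  have "openin zariski {A :: complex^'n^'n. f A \<noteq> 0}" if "f \<in> F" for f
    using polyfun_imp_eval_poly[of f] that assms unfolding zariski_def
    by (auto intro!: topology_generated_by_Basis)
  then have "openin zariski (\<Union>f\<in>F. {A :: complex^'n^'n. f A \<noteq> 0})" by auto
  moreover have "UNIV - {A :: complex^'n^'n. \<forall>f\<in>F. f A = 0} = (\<Union>f\<in>F. {A. f A \<noteq> 0})" by auto
  ultimately show ?thesis by (simp add: closedin_def)
qed

section \<open>The degree filtration\<close>

text \<open>The index bounds the degree and need not be attained. Multiplication by a single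
  generator raises it by one; general products are derived.\<close>

inductive is_polydeg :: "('a \<Rightarrow> 'b::comm_ring_1) set \<Rightarrow> nat \<Rightarrow> ('a \<Rightarrow> 'b) \<Rightarrow> bool" for X where
  const: "is_polydeg X d (\<lambda>_. c)"
| add: "is_polydeg X d f \<Longrightarrow> is_polydeg X d g \<Longrightarrow> is_polydeg X d (\<lambda>x. f x + g x)"
| gen_mult: "is_polydeg X d f \<Longrightarrow> g \<in> X \<Longrightarrow> is_polydeg X (Suc d) (\<lambda>x. g x * f x)"

definition polydeg :: "('a \<Rightarrow> 'b::comm_ring_1) set \<Rightarrow> nat \<Rightarrow> ('a \<Rightarrow> 'b) set" where
  "polydeg X d = {f. is_polydeg X d f}"

lemma mem_polydeg: "is_polydeg X d f \<longleftrightarrow> f \<in> polydeg X d"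
  by (simp add: polydeg_def)

lemmas polydeg_intros = is_polydeg.intros[unfolded mem_polydeg]
lemmas polydeg_const = polydeg_intros(1) and polydeg_add = polydeg_intros(2)
  and polydeg_gen_mult = polydeg_intros(3)
lemmas polydeg_induct [consumes 1, case_names const add gen_mult, induct set: polydeg] =
  is_polydeg.induct[unfolded mem_polydeg]

lemma polydeg_imp_polyfun: "f \<in> polydeg X d \<Longrightarrow> f \<in> polyfun X"
  by (induction rule: polydeg_induct) (auto intro: polyfun.intros)

lemma polydeg_scale: "f \<in> polydeg X d \<Longrightarrow> (\<lambda>x. c * f x) \<in> polydeg X d"
proof (induction rule: polydeg_induct)
  case (add d f g)
  then have "(\<lambda>x. c * f x + c * g x) \<in> polydeg X d" by (intro polydeg_add)
  then show ?case by (simp add: algebra_simps)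
next
  case (gen_mult d f g)
  then have "(\<lambda>x. g x * (c * f x)) \<in> polydeg X (Suc d)" by (intro polydeg_gen_mult)
  then show ?case by (simp add: mult.left_commute)
qed (rule polydeg_const)

lemma polydeg_Suc: "f \<in> polydeg X d \<Longrightarrow> f \<in> polydeg X (Suc d)"
  by (induction rule: polydeg_induct) (auto intro: polydeg_intros)

lemma polydeg_mono: "f \<in> polydeg X d \<Longrightarrow> d \<le> d' \<Longrightarrow> f \<in> polydeg X d'"
  using lift_Suc_mono_le[of "polydeg X"] polydeg_Suc by (metis subsetD subsetI)

lemma polydeg_sum: "(\<And>i. i \<in> I \<Longrightarrow> f i \<in> polydeg X d) \<Longrightarrow> (\<lambda>x. \<Sum>i\<in>I. f i x) \<in> polydeg X d"
  by (induction I rule: infinite_finite_induct) (auto intro: polydeg_intros)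

lemma polydeg_mult:
  "f \<in> polydeg X d \<Longrightarrow> g \<in> polydeg X d' \<Longrightarrow> (\<lambda>x. f x * g x) \<in> polydeg X (d + d')"
proof (induction rule: polydeg_induct)
  case (const d c)
  then have "(\<lambda>x. c * g x) \<in> polydeg X d'" by (intro polydeg_scale)
  then show ?case by (rule polydeg_mono) simp
next
  case (add d f h)
  then have "(\<lambda>x. f x * g x + h x * g x) \<in> polydeg X (d + d')" by (intro polydeg_add)
  then show ?case by (simp add: algebra_simps)
next
  case (gen_mult d f h)
  then have "(\<lambda>x. h x * (f x * g x)) \<in> polydeg X (Suc (d + d'))" by (intro polydeg_gen_mult)
  then show ?case by (simp add: mult.assoc)
qed

lemma polyfun_imp_polydeg: "f \<in> polyfun X \<Longrightarrow> \<exists>d. f \<in> polydeg X d"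
proof (induction rule: polyfun.induct)
  case (polyfun_gen f)
  then have "(\<lambda>x. f x * 1) \<in> polydeg X (Suc 0)" by (intro polydeg_gen_mult polydeg_const)
  then show ?case by auto
next
  case (polyfun_add f g)
  then obtain d d' where "f \<in> polydeg X d" "g \<in> polydeg X d'" by auto
  then have "f \<in> polydeg X (max d d')" "g \<in> polydeg X (max d d')" by (auto intro: polydeg_mono)
  then show ?case using polydeg_add by blast
qed (use polydeg_const polydeg_mult in blast)+

text \<open>A substitution that turns each generator into a linear combination of generators keeps
  the degree bound. The case of interest is multiplication by a fixed matrix.\<close>

lemma polydeg_compose:
  assumes "f \<in> polydeg X d"
    and "\<And>g. g \<in> X \<Longrightarrow> \<exists>(I :: 'i set) c G. G ` I \<subseteq> Y \<and> (\<forall>y. g (h y) = (\<Sum>i\<in>I. c i * G i y))"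
  shows "(\<lambda>y. f (h y)) \<in> polydeg Y d"
  using assms(1)
proof induction
  case (gen_mult d f g)
  obtain I :: "'i set" and c G where G: "G ` I \<subseteq> Y" "\<And>y. g (h y) = (\<Sum>i\<in>I. c i * G i y)"
    using assms(2)[OF gen_mult(2)] by blast
  have "(\<lambda>y. \<Sum>i\<in>I. c i * (G i y * f (h y))) \<in> polydeg Y (Suc d)"
    using G(1) gen_mult.IH
    by (intro polydeg_sum polydeg_scale polydeg_gen_mult) auto
  then show ?case by (simp add: G(2) sum_distrib_right mult.assoc)
qed (auto intro: polydeg_intros)

lemma polydeg_translate:
  fixes f :: "'a::comm_ring_1^'n^'n \<Rightarrow> 'a"
  assumes "f \<in> polydeg entry_funs d"
  shows "(\<lambda>A. f (B ** A)) \<in> polydeg entry_funs d" "(\<lambda>A. f (A ** B)) \<in> polydeg entry_funs d"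
proof -
  show "(\<lambda>A. f (B ** A)) \<in> polydeg entry_funs d"
  proof (rule polydeg_compose[OF assms])
    fix g :: "'a^'n^'n \<Rightarrow> 'a" assume "g \<in> entry_funs"
    then obtain i j where g: "g = (\<lambda>A. A $ i $ j)" by auto
    show "\<exists>(I :: 'n set) c G. G ` I \<subseteq> entry_funs \<and> (\<forall>A. g (B ** A) = (\<Sum>k\<in>I. c k * G k A))"
      by (intro exI[of _ UNIV] exI[of _ "\<lambda>k. B $ i $ k"] exI[of _ "\<lambda>k A. A $ k $ j"])
         (auto simp: g matrix_matrix_mult_def)
  qed
  show "(\<lambda>A. f (A ** B)) \<in> polydeg entry_funs d"
  proof (rule polydeg_compose[OF assms])
    fix g :: "'a^'n^'n \<Rightarrow> 'a" assume "g \<in> entry_funs"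
    then obtain i j where g: "g = (\<lambda>A. A $ i $ j)" by auto
    show "\<exists>(I :: 'n set) c G. G ` I \<subseteq> entry_funs \<and> (\<forall>A. g (A ** B) = (\<Sum>k\<in>I. c k * G k A))"
      by (intro exI[of _ UNIV] exI[of _ "\<lambda>k. B $ k $ j"] exI[of _ "\<lambda>k A. A $ i $ k"])
         (auto simp: g matrix_matrix_mult_def mult.commute)
  qed
qed

section \<open>Finite dimension of the functions of bounded degree\<close>

interpretation fs: vector_space "\<lambda>(c::'b::field) (f::'a \<Rightarrow> 'b) x. c * f x"
  by unfold_locales (auto simp: fun_eq_iff algebra_simps)

lemma sum_fun_apply: "(\<Sum>i\<in>I. f i) x = (\<Sum>i\<in>I. f i x)"
  by (induction I rule: infinite_finite_induct) auto

lemma fs_span_finite: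
  assumes "finite S" "f \<in> fs.span S"
  shows "\<exists>u. f = (\<lambda>x. \<Sum>b\<in>S. u b * b x)"
  using assms(2) unfolding fs.span_finite[OF assms(1)] by (auto simp: fun_eq_iff sum_fun_apply)

lemma fs_span_vanish:
  assumes "f \<in> fs.span B" "\<And>b. b \<in> B \<Longrightarrow> b x = 0"
  shows "f x = 0"
  using assms(1) by (induction rule: fs.span_induct_alt) (auto simp: assms(2))

lemma polydeg_finite_dimensional:
  fixes X :: "('a \<Rightarrow> 'b::field) set"
  assumes "finite X"
  shows "\<exists>S. finite S \<and> polydeg X d \<subseteq> fs.span S"
proof -
  \<comment> \<open>The products of at most \<open>d\<close> generators.\<close>
  define S where "S = rec_nat {\<lambda>_. 1 :: 'b}
    (\<lambda>_ T. insert (\<lambda>_. 1) (T \<union> (\<lambda>(g, b) x. g x * b x) ` (X \<times> T)))"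
  have S_Suc: "S (Suc d) = insert (\<lambda>_. 1) (S d \<union> (\<lambda>(g, b) x. g x * b x) ` (X \<times> S d))" for d
    by (simp add: S_def)
  have "finite (S d)" for d
    using assms by (induction d) (simp_all add: S_Suc, simp add: S_def)
  moreover have "f \<in> fs.span (S d)" if "f \<in> polydeg X d" for f
    using that
  proof induction
    case (const d c)
    have "(\<lambda>_. 1) \<in> S d" by (cases d) (simp_all add: S_Suc, simp add: S_def)
    from fs.span_scale[OF fs.span_base[OF this], of c] show ?case by simp
  next
    case (add d f g)
    then show ?case using fs.span_add[of f "S d" g] by (simp add: plus_fun_def)
  next
    case (gen_mult d f g)
    from gen_mult(3) show ?case
    proof (induction rule: fs.span_induct_alt)
      case base
      show ?case using fs.span_zero[of "S (Suc d)"] by (simp add: zero_fun_def)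
    next
      case (step c b h)
      have "(\<lambda>x. g x * b x) \<in> S (Suc d)"
        unfolding S_Suc using step gen_mult(2) by (auto intro!: image_eqI[where x = "(g, b)"])
      then have "(\<lambda>x. c * (g x * b x)) + (\<lambda>x. g x * h x) \<in> fs.span (S (Suc d))"
        by (rule fs.span_add[OF fs.span_scale[OF fs.span_base] step(2)])
      then show ?case by (simp add: plus_fun_def algebra_simps)
    qed
  qed
  ultimately show ?thesis by blast
qed

lemma finite_entry_funs: "finite (entry_funs :: ('a^'n^'m \<Rightarrow> 'a) set)"
  by simp


section \<open>Real points of an algebraic group\<close>

definition cx :: "real^'n^'n \<Rightarrow> complex^'n^'n" where
  "cx A = (\<chi> i j. complex_of_real (A $ i $ j))"

definition smul :: "complex \<Rightarrow> complex^'n^'n \<Rightarrow> complex^'n^'n" where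
  "smul z A = (\<chi> i j. z * A $ i $ j)"

definition mcnj :: "complex^'n^'n \<Rightarrow> complex^'n^'n" where
  "mcnj A = (\<chi> i j. cnj (A $ i $ j))"

lemma cx_simps [simp]: "cx A $ i $ j = complex_of_real (A $ i $ j)"
  and smul_simps [simp]: "smul z B $ i $ j = z * B $ i $ j"
  and mcnj_simps [simp]: "mcnj B $ i $ j = cnj (B $ i $ j)"
  by (simp_all add: cx_def smul_def mcnj_def)

lemma real_points_iff: "A \<in> real_points G \<longleftrightarrow> cx A \<in> G"
  by (simp add: real_points_def cx_def)

lemma linear_cx: "linear cx" and linear_mcnj: "linear mcnj"
  by (auto intro!: linearI simp: vec_eq_iff scaleR_conv_of_real[where 'a = complex])

lemmas bounded_linear_cx = linear_cx[unfolded linear_conv_bounded_linear]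
lemmas bounded_linear_mcnj = linear_mcnj[unfolded linear_conv_bounded_linear]

lemma cx_mult: "cx (A ** B) = cx A ** cx B" and mcnj_mult: "mcnj (C ** D) = mcnj C ** mcnj D"
  by (simp_all add: vec_eq_iff matrix_matrix_mult_def)

lemma cx_1 [simp]: "cx (mat 1) = mat 1" and mcnj_1 [simp]: "mcnj (mat 1) = mat 1"
  by (simp_all add: vec_eq_iff mat_def)

lemma cx_mexp: "cx (mexp A) = mexp (cx A)"
  by (rule mexp_hom[OF bounded_linear_cx cx_mult cx_1])

lemma mcnj_mexp: "mcnj (mexp A) = mexp (mcnj A)"
  by (rule mexp_hom[OF bounded_linear_mcnj mcnj_mult mcnj_1])

lemma cx_scaleR: "cx (t *\<^sub>R A) = t *\<^sub>R cx A" and mcnj_scaleR: "mcnj (t *\<^sub>R B) = t *\<^sub>R mcnj B"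
  by (simp_all add: linear_cmul linear_cx linear_mcnj)

lemma smul_of_real: "smul (complex_of_real t) A = t *\<^sub>R A"
  by (simp add: vec_eq_iff scaleR_conv_of_real[where 'a = complex])

lemma invertible_cx: "invertible A \<longleftrightarrow> invertible (cx A)"
proof -
  have "det (cx A) = complex_of_real (det A)" by (simp add: det_def)
  then show ?thesis by (simp add: invertible_det_nz)
qed

text \<open>The zeros on the real interval accumulate at 0.\<close>

lemma entire_eq_0:
  assumes F: "F holomorphic_on UNIV" and "d > 0"
    and vanish: "\<And>t. \<bar>t\<bar> < d \<Longrightarrow> F (complex_of_real t) = 0"
  shows "F z = 0"
proof (rule analytic_continuation[OF F open_UNIV connected_UNIV subset_UNIV UNIV_I])
  show "(0 :: complex) islimpt complex_of_real ` {-d<..<d}"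
    unfolding islimpt_approachable
  proof (intro allI impI)
    fix e :: real assume "e > 0"
    then show "\<exists>x'\<in>complex_of_real ` {-d<..<d}. x' \<noteq> 0 \<and> dist x' 0 < e"
      using \<open>d > 0\<close>
      by (intro bexI[of _ "complex_of_real (min d e / 2)"] imageI) (auto simp: min_def norm_divide)
  qed
qed (use vanish in auto)

section \<open>The zero locus of the functions that vanish near the identity\<close>

definition vanishing_near_1 :: "(complex^'n^'n) set \<Rightarrow> nat \<Rightarrow> (complex^'n^'n \<Rightarrow> complex) set" where
  "vanishing_near_1 G d = {f \<in> polydeg entry_funs d.
     \<exists>e>0. \<forall>A\<in>real_points G. dist A (mat 1) < e \<longrightarrow> f (cx A) = 0}"

definition zero_locus :: "(complex^'n^'n) set \<Rightarrow> nat \<Rightarrow> (complex^'n^'n) set" where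
  "zero_locus G d = {A \<in> G. \<forall>f\<in>vanishing_near_1 G d. f A = 0}"

locale real_alg_group =
  fixes G :: "(complex^'n^'n) set"
  assumes real_algebraic_group: "real_algebraic_group G"
begin

lemma subgroup_G: "subgroup G GL"
  using real_algebraic_group by (simp add: real_algebraic_group_def)

lemma equations:
  obtains F where "F \<subseteq> polyfun entry_funs" "\<And>A. A \<in> G \<longleftrightarrow> invertible A \<and> (\<forall>f\<in>F. f A = 0)"
proof -
  obtain P where "G = {A \<in> carrier GL. \<forall>p\<in>P. eval_poly p A = 0}"
    using real_algebraic_group by (auto simp: real_algebraic_group_def)
  then have "A \<in> G \<longleftrightarrow> invertible A \<and> (\<forall>f\<in>eval_poly ` P. f A = 0)" for A by (auto simp: GL_def)
  then show thesis using that[of "eval_poly ` P"] eval_poly_in_polyfun by blast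
qed

text \<open>Here definition over the reals enters: real coefficients make the equations commute with
  conjugation.\<close>

lemma mcnj_mem:
  assumes "A \<in> G" shows "mcnj A \<in> G"
proof -
  obtain P where P: "\<forall>p\<in>P. range (Poly_Mapping.lookup p) \<subseteq> \<real>"
    and G: "G = {A \<in> carrier GL. \<forall>p\<in>P. eval_poly p A = 0}"
    using real_algebraic_group by (auto simp: real_algebraic_group_def)
  have "eval_poly p (mcnj A) = cnj (eval_poly p A)" if "p \<in> P" for p
  proof -
    have "cnj (Poly_Mapping.lookup p m) = Poly_Mapping.lookup p m" for m
      using P that Reals_cnj_iff by blast
    then show ?thesis by (simp add: eval_poly_def)
  qed
  moreover have "invertible (mcnj A)"
  proof -
    have "det (mcnj A) = cnj (det A)" by (simp add: det_def)
    then show ?thesis using assms G by (simp add: GL_def invertible_det_nz)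
  qed
  ultimately show ?thesis using assms by (simp add: G GL_def)
qed

lemma closed_group: "closed_matrix_group G"
  unfolding closed_matrix_group_def
proof (intro conjI allI impI subgroup_G)
  fix y L assume y: "range y \<subseteq> G" "y \<longlonglongrightarrow> L" "invertible L"
  obtain F where F: "F \<subseteq> polyfun entry_funs" "\<And>A. A \<in> G \<longleftrightarrow> invertible A \<and> (\<forall>f\<in>F. f A = 0)"
    using equations by blast
  have "f L = 0" if "f \<in> F" for f
  proof -
    have "(\<lambda>k. f (y k)) \<longlonglongrightarrow> f L" using F(1) that y(2) by (intro polyfun_tendsto) auto
    moreover have "f (y k) = 0" for k using y(1) F(2) that by blast
    ultimately show ?thesis by (simp add: LIMSEQ_const_iff)
  qed
  then show "L \<in> G" using F(2) y(3) by blast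
qed

lemmas G_rules = closed_matrix_groupD[OF closed_group]

lemma closed_real_points: "closed_matrix_group (real_points G)"
  unfolding closed_matrix_group_def subgroup_GL_iff
proof (intro conjI allI impI ballI)
  show inv: "invertible A" if "A \<in> real_points G" for A
    using that G_rules(1) by (simp add: real_points_iff invertible_cx)
  show "mat 1 \<in> real_points G" using G_rules(2) by (simp add: real_points_iff)
  show "A ** B \<in> real_points G" if "A \<in> real_points G" "B \<in> real_points G" for A B
    using that G_rules(3) by (simp add: real_points_iff cx_mult)
  show "matrix_inv A \<in> real_points G" if "A \<in> real_points G" for A
  proof -
    have "matrix_inv (cx A) = cx (matrix_inv A)"
      using inv[OF that] by (intro matrix_inv_eqI) (simp_all flip: cx_mult)
    moreover have "matrix_inv (cx A) \<in> G" using that by (intro G_rules(4)) (simp add: real_points_iff)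
    ultimately show ?thesis by (simp add: real_points_iff)
  qed
  fix y L assume y: "range y \<subseteq> real_points G" "y \<longlonglongrightarrow> L" "invertible L"
  have "cx L \<in> G"
  proof (rule G_rules(5)[OF _ bounded_linear.tendsto[OF bounded_linear_cx y(2)]])
    show "cx (y k) \<in> G" for k using y(1) by (auto simp flip: real_points_iff)
    show "invertible (cx L)" using y(3) by (simp add: invertible_cx)
  qed
  then show "L \<in> real_points G" by (simp add: real_points_iff)
qed

lemmas R_rules = closed_matrix_groupD[OF closed_real_points]

text \<open>Every equation of \<open>G\<close>, evaluated at exp (z X), is entire in z and vanishes
  for real z. Hence the Lie algebra of \<open>G\<close> is a complex vector space.\<close>

lemma mexp_smul_mem:
  assumes "X \<in> lie_exp G"
  shows "mexp (smul z X) \<in> G"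
proof -
  obtain F where F: "F \<subseteq> polyfun entry_funs" "\<And>A. A \<in> G \<longleftrightarrow> invertible A \<and> (\<forall>f\<in>F. f A = 0)"
    using equations by blast
  have "f (mexp (smul z X)) = 0" if "f \<in> F" for f
  proof (rule entire_eq_0[of "\<lambda>z. f (mexp (smul z X))" 1])
    show "(\<lambda>z. f (mexp (smul z X))) holomorphic_on UNIV"
      using F(1) that
      by (intro polyfun_holomorphic[where f = f] holomorphic_on_mexp) (auto intro!: holomorphic_intros)
    show "f (mexp (smul (complex_of_real t) X)) = 0" for t
    proof -
      have "mexp (t *\<^sub>R X) \<in> G" using assms by (simp add: lie_exp_def)
      with F(2)[of "mexp (t *\<^sub>R X)"] have "f (mexp (t *\<^sub>R X)) = 0" using that by blast
      then show ?thesis by (simp only: smul_of_real)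
    qed
  qed auto
  then show ?thesis using F(2) invertible_mexp by blast
qed

text \<open>The real part is the mean of \<open>X\<close> and its conjugate, the imaginary part is
  the real part of - i X; the Lie algebra of \<open>G\<close> is closed under both
  operations.\<close>

lemma lie_exp_complexification:
  assumes X: "X \<in> lie_exp G"
  shows "\<exists>A\<in>lie_exp (real_points G). \<exists>B\<in>lie_exp (real_points G). X = cx A + smul \<i> (cx B)"
proof -
  define A B :: "real^'n^'n" where "A = (\<chi> i j. Re (X $ i $ j))" and "B = (\<chi> i j. Im (X $ i $ j))"
  have sub: "Real_Vector_Spaces.subspace (lie_exp G)" by (rule subspace_lie_exp[OF closed_group])
  have cnj: "mcnj Y \<in> lie_exp G" if "Y \<in> lie_exp G" for Y
  proof -
    have "mexp (t *\<^sub>R mcnj Y) = mcnj (mexp (t *\<^sub>R Y))" for t by (simp add: mcnj_mexp mcnj_scaleR)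
    then show ?thesis using that mcnj_mem by (simp add: lie_exp_def)
  qed
  have im: "smul z Y \<in> lie_exp G" if "Y \<in> lie_exp G" for z Y
  proof -
    have "t *\<^sub>R smul z Y = smul (complex_of_real t * z) Y" for t
      by (simp add: vec_eq_iff scaleR_conv_of_real[where 'a = complex])
    then show ?thesis using mexp_smul_mem[OF that] by (simp add: lie_exp_def)
  qed
  have half: "(1 / 2) *\<^sub>R (Y + mcnj Y) \<in> lie_exp G" if "Y \<in> lie_exp G" for Y
    using that cnj by (intro real_vector.subspace_scale[OF sub] real_vector.subspace_add[OF sub])
  have "cx A = (1 / 2) *\<^sub>R (X + mcnj X)" by (simp add: A_def vec_eq_iff complex_eq_iff)
  then have "cx A \<in> lie_exp G" using half[OF X] by simp
  moreover have "cx B = (1 / 2) *\<^sub>R (smul (- \<i>) X + mcnj (smul (- \<i>) X))"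
    by (simp add: B_def vec_eq_iff complex_eq_iff)
  then have "cx B \<in> lie_exp G" using half[OF im[OF X, of "- \<i>"]] by simp
  moreover have "Y \<in> lie_exp (real_points G)" if "cx Y \<in> lie_exp G" for Y
    using that by (simp add: lie_exp_def real_points_iff cx_mexp cx_scaleR)
  moreover have "X = cx A + smul \<i> (cx B)" by (simp add: A_def B_def vec_eq_iff complex_eq_iff)
  ultimately show ?thesis by blast
qed

lemma vanishing_near_1_translate_real:
  assumes f: "f \<in> polydeg entry_funs d" and h: "h \<in> real_points G" "dist h (mat 1) < e"
    and van: "\<forall>A\<in>real_points G. dist A (mat 1) < e \<longrightarrow> f (cx A) = 0"
  shows "(\<lambda>A. f (cx h ** A)) \<in> vanishing_near_1 G d"
proof -
  have "((\<lambda>A. h ** A) \<longlongrightarrow> h ** mat 1) (at (mat 1))"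
    by (intro tendsto_matrix_mult tendsto_const tendsto_ident_at)
  then have "((\<lambda>A. dist (h ** A) (mat 1)) \<longlongrightarrow> dist h (mat 1)) (at (mat 1))"
    by (intro tendsto_dist) auto
  from order_tendstoD(2)[OF this h(2)] obtain r where r: "r > 0"
    "\<And>A. A \<noteq> mat 1 \<Longrightarrow> dist A (mat 1) < r \<Longrightarrow> dist (h ** A) (mat 1) < e"
    by (auto simp: eventually_at)
  have "f (cx h ** cx A) = 0" if "A \<in> real_points G" "dist A (mat 1) < r" for A
  proof -
    have "dist (h ** A) (mat 1) < e" using r(2)[of A] that h(2) by (cases "A = mat 1") auto
    then show ?thesis using van R_rules(3)[OF h(1) that(1)] by (simp flip: cx_mult)
  qed
  then show ?thesis
    using r(1) polydeg_translate(1)[OF f] by (auto simp: vanishing_near_1_def)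
qed

text \<open>Translation is used on both sides. For a real h near the identity, f (h _) again
  vanishes near the identity, so it is zero at the point \<open>A\<close> of the locus. Read as a
  function of h, this says that f (_ A) vanishes near the identity.\<close>

lemma vanishing_near_1_translate:
  assumes f: "f \<in> vanishing_near_1 G d" and A: "A \<in> zero_locus G d"
  shows "(\<lambda>B. f (B ** A)) \<in> vanishing_near_1 G d"
proof -
  from f obtain e where e: "e > 0" and van: "\<forall>A\<in>real_points G. dist A (mat 1) < e \<longrightarrow> f (cx A) = 0"
    and deg: "f \<in> polydeg entry_funs d" by (auto simp: vanishing_near_1_def)
  have "f (cx h ** A) = 0" if "h \<in> real_points G" "dist h (mat 1) < e" for h
    using vanishing_near_1_translate_real[OF deg that van] A by (auto simp: zero_locus_def)
  then show ?thesis using e polydeg_translate(2)[OF deg] by (auto simp: vanishing_near_1_def)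
qed

lemma zero_locus_one: "mat 1 \<in> zero_locus G d"
  using G_rules(2) R_rules(2) by (auto simp: zero_locus_def vanishing_near_1_def simp flip: cx_1)

lemma zero_locus_mult:
  assumes "A \<in> zero_locus G d" "B \<in> zero_locus G d"
  shows "A ** B \<in> zero_locus G d"
  using vanishing_near_1_translate[OF _ assms(2)] assms G_rules(3) by (auto simp: zero_locus_def)

lemma zero_locus_power:
  assumes "A \<in> zero_locus G d"
  shows "mat_of (Sqm A ^ k) \<in> zero_locus G d"
  using zero_locus_mult[OF assms] zero_locus_one by (induction k) auto

text \<open>The translates of \<open>f\<close> by the powers of \<open>A\<close> are linearly dependent; evaluating a relation at a
  suitable negative power of \<open>A\<close> leaves only a multiple of \<open>f (A\<^sup>-\<^sup>1)\<close>.\<close>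

lemma zero_locus_inv:
  assumes A: "A \<in> zero_locus G d"
  shows "matrix_inv A \<in> zero_locus G d"
proof -
  have AG: "A \<in> G" using A by (simp add: zero_locus_def)
  define a b where "a = Sqm A" and "b = Sqm (matrix_inv A)"
  have ba: "b * a = 1" using G_rules(1)[OF AG] by (simp add: a_def b_def sqm_eq_iff)
  have cancel: "b ^ m * a ^ (m + k) = a ^ k" for m k
  proof (induction m)
    case (Suc m)
    have "b ^ Suc m = b ^ m * b" by (rule power_Suc2)
    moreover have "a ^ (Suc m + k) = a * a ^ (m + k)" by simp
    ultimately have "b ^ Suc m * a ^ (Suc m + k) = b ^ m * (b * a) * a ^ (m + k)"
      by (simp only: mult.assoc)
    then show ?case using Suc ba by simp
  qed simp
  have "f (matrix_inv A) = 0" if f: "f \<in> vanishing_near_1 G d" for f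
  proof -
    obtain S :: "(complex^'n^'n \<Rightarrow> complex) set" where S: "finite S" "polydeg entry_funs d \<subseteq> fs.span S"
      using polydeg_finite_dimensional[OF finite_entry_funs] by blast
    define F where "F i B = f (B ** mat_of (a ^ i))" for i :: nat and B
    have "F i \<in> fs.span S" for i
      using f S(2) polydeg_translate(2)[of f d "mat_of (a ^ i)"]
      by (auto simp: F_def[abs_def] vanishing_near_1_def)
    then have "\<forall>i. \<exists>u. F i = (\<lambda>x. \<Sum>s\<in>S. u s * s x)" using fs_span_finite[OF S(1)] by blast
    from choice[OF this] obtain u where "\<forall>i. F i = (\<lambda>x. \<Sum>s\<in>S. u i s * s x)" by blast
    then have u: "F i x = (\<Sum>s\<in>S. u i s * s x)" for i x by simp
    obtain c where c: "\<exists>i\<in>{..card S}. c i \<noteq> 0" "\<forall>s\<in>S. (\<Sum>i\<le>card S. c i * u i s) = 0"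
      using exists_linear_dependence[OF S(1), of "{..card S}" u] by auto
    have dep: "(\<Sum>i\<le>card S. c i * F i x) = 0" for x
    proof -
      have "(\<Sum>i\<le>card S. c i * F i x) = (\<Sum>s\<in>S. (\<Sum>i\<le>card S. c i * u i s) * s x)"
        unfolding u sum_distrib_left sum_distrib_right by (subst sum.swap) (simp add: mult.assoc)
      then show ?thesis using c(2) by simp
    qed
    \<comment> \<open>With \<open>r\<close> the lowest index in the relation, evaluation at A^-(r+1)
      turns every higher term into \<open>f\<close> at a nonnegative power of \<open>A\<close>,
      where it is zero.\<close>
    define r where "r = (LEAST i. i \<le> card S \<and> c i \<noteq> 0)"
    have "r \<le> card S \<and> c r \<noteq> 0" unfolding r_def by (rule LeastI_ex) (use c(1) in auto)
    moreover have "c i = 0" if "i < r" "i \<le> card S" for i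
      using not_less_Least[OF that(1)[unfolded r_def]] that(2) by simp
    ultimately have r: "r \<le> card S" "c r \<noteq> 0" "\<And>i. i < r \<Longrightarrow> i \<le> card S \<Longrightarrow> c i = 0"
      by auto
    have "F i (mat_of (b ^ Suc r)) = (if i = r then f (matrix_inv A) else 0)" if "r \<le> i" for i
    proof (cases "i = r")
      case True
      have "b ^ Suc r * a ^ r = b" using cancel[of r 0] by (simp add: mult.assoc)
      then have "mat_of (b ^ Suc r) ** mat_of (a ^ r) = mat_of b"
        by (simp only: mat_of_simps(6)[symmetric])
      then show ?thesis using True by (simp add: F_def b_def del: power_Suc)
    next
      case False
      then have "Suc r \<le> i" using that by simp
      from le_Suc_ex[OF this] obtain k where "i = Suc r + k" ..
      then have "b ^ Suc r * a ^ i = a ^ k" using cancel[of "Suc r" k] by (simp del: power_Suc)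
      then have "mat_of (b ^ Suc r) ** mat_of (a ^ i) = mat_of (a ^ k)"
        by (simp only: mat_of_simps(6)[symmetric])
      then have "F i (mat_of (b ^ Suc r)) = f (mat_of (a ^ k))"
        by (simp add: F_def del: power_Suc)
      also have "\<dots> = 0" using zero_locus_power[OF A] f by (auto simp: zero_locus_def a_def)
      finally show ?thesis using False by simp
    qed
    then have "c i * F i (mat_of (b ^ Suc r)) = (if i = r then c r * f (matrix_inv A) else 0)"
      if "i \<le> card S" for i using r(3)[of i] that by (cases "i < r") auto
    then have "c r * f (matrix_inv A) = 0"
      using dep[of "mat_of (b ^ Suc r)"] r(1) by (simp add: sum.delta)
    then show ?thesis using r(2) by simp
  qed
  then show ?thesis using G_rules(4)[OF AG] by (simp add: zero_locus_def)
qed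

lemma closed_zero_locus: "closed_matrix_group (zero_locus G d)"
  unfolding closed_matrix_group_def subgroup_GL_iff
proof (intro conjI ballI allI impI)
  show "invertible A" if "A \<in> zero_locus G d" for A using that G_rules(1) by (auto simp: zero_locus_def)
  fix y L assume y: "range y \<subseteq> zero_locus G d" "y \<longlonglongrightarrow> L" "invertible L"
  then have yG: "y k \<in> zero_locus G d" for k by auto
  then have "y k \<in> G" for k by (simp add: zero_locus_def)
  then have "L \<in> G" by (rule G_rules(5)[OF _ y(2,3)])
  moreover have "f L = 0" if f: "f \<in> vanishing_near_1 G d" for f
  proof -
    have "(\<lambda>k. f (y k)) \<longlonglongrightarrow> f L"
      using f y(2) polydeg_imp_polyfun by (intro polyfun_tendsto) (auto simp: vanishing_near_1_def)
    moreover have "f (y k) = 0" for k using yG f by (simp add: zero_locus_def)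
    ultimately show ?thesis by (simp add: LIMSEQ_const_iff)
  qed
  ultimately show "L \<in> zero_locus G d" by (simp add: zero_locus_def)
qed (rule zero_locus_one zero_locus_mult zero_locus_inv; assumption?)+

text \<open>Two analytic continuations. With X = A + i B and small real s, f (exp (s (A + u B)))
  vanishes for small real u, hence at u = i. Then f (exp (z X)) vanishes for small real z, hence for
  all z.\<close>

lemma lie_exp_zero_locus: "lie_exp G \<subseteq> lie_exp (zero_locus G d)"
proof
  fix X assume X: "X \<in> lie_exp G"
  obtain A B where A: "A \<in> lie_exp (real_points G)" and B: "B \<in> lie_exp (real_points G)"
    and XAB: "X = cx A + smul \<i> (cx B)" using lie_exp_complexification[OF X] by blast
  have "f (mexp (t *\<^sub>R X)) = 0" if f: "f \<in> vanishing_near_1 G d" for f t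
  proof -
    from f obtain e where e: "e > 0" and van: "\<forall>A\<in>real_points G. dist A (mat 1) < e \<longrightarrow> f (cx A) = 0"
      and deg: "f \<in> polydeg entry_funs d" by (auto simp: vanishing_near_1_def)
    have pf: "f \<in> polyfun entry_funs" using deg by (rule polydeg_imp_polyfun)
    have mexp_cont: "continuous (at 0) (\<lambda>s. mexp (s *\<^sub>R A))"
      by (rule has_vector_derivative_continuous[OF mexp_has_vector_derivative])
    then have "((\<lambda>s. mexp (s *\<^sub>R A)) \<longlongrightarrow> mat 1) (at 0)" by (simp add: continuous_within)
    from tendstoD[OF this e] obtain r
      where r: "r > 0" "\<And>s. s \<noteq> 0 \<Longrightarrow> dist s 0 < r \<Longrightarrow> dist (mexp (s *\<^sub>R A)) (mat 1) < e"
      unfolding eventually_at by auto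
    have step: "f (mexp (smul (complex_of_real s) X)) = 0" if s: "\<bar>s\<bar> < r" for s
    proof -
      have small: "dist (mexp (s *\<^sub>R A)) (mat 1) < e" using r(2)[of s] s e by (cases "s = 0") auto
      define F where "F z = smul (complex_of_real s) (cx A + smul z (cx B))" for z
      have holF: "(\<lambda>z. F z $ i $ j) holomorphic_on UNIV" for i j
        by (auto simp: F_def intro!: holomorphic_intros)
      have F_real: "F (complex_of_real u) = cx (s *\<^sub>R (A + u *\<^sub>R B))" for u
        by (simp add: F_def vec_eq_iff)
      have mem: "mexp (s *\<^sub>R (A + u *\<^sub>R B)) \<in> real_points G" for u
      proof -
        have "A + u *\<^sub>R B \<in> lie_exp (real_points G)"
          using A B subspace_lie_exp[OF closed_real_points]
          by (simp add: real_vector.subspace_add real_vector.subspace_scale)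
        then show ?thesis by (simp add: lie_exp_def)
      qed
      have "continuous_on UNIV (\<lambda>z. mexp (F z) $ i $ j)" for i j
        by (intro holomorphic_on_imp_continuous_on holomorphic_on_mexp holF)
      then have "((\<lambda>u. mexp (F (complex_of_real u)) $ i $ j) \<longlongrightarrow> mexp (F (complex_of_real 0)) $ i $ j) (at 0)" for i j
        by (intro continuous_on_tendsto_compose[of UNIV "\<lambda>z. mexp (F z) $ i $ j"] tendsto_of_real)
           (auto intro: tendsto_ident_at)
      then have "((\<lambda>u. Re (mexp (F (complex_of_real u)) $ i $ j)) \<longlongrightarrow> Re (mexp (F (complex_of_real 0)) $ i $ j)) (at 0)" for i j
        by (rule tendsto_Re)
      then have "((\<lambda>u. mexp (s *\<^sub>R (A + u *\<^sub>R B)) $ i $ j) \<longlongrightarrow> mexp (s *\<^sub>R (A + 0 *\<^sub>R B)) $ i $ j) (at 0)" for i j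
        unfolding F_real cx_mexp[symmetric] by simp
      then have "((\<lambda>u. mexp (s *\<^sub>R (A + u *\<^sub>R B))) \<longlongrightarrow> mexp (s *\<^sub>R (A + 0 *\<^sub>R B))) (at 0)"
        by (intro vec_tendstoI)
      then have "((\<lambda>u. dist (mexp (s *\<^sub>R (A + u *\<^sub>R B))) (mat 1)) \<longlongrightarrow> dist (mexp (s *\<^sub>R A)) (mat 1)) (at 0)"
        by (intro tendsto_dist) auto
      \<comment> \<open>The range of admissible u may shrink with s; this is enough, as the
        continuation in u is made for each s separately.\<close>
      from order_tendstoD(2)[OF this small] obtain q where q: "q > 0"
        "\<And>u. u \<noteq> 0 \<Longrightarrow> dist u 0 < q \<Longrightarrow> dist (mexp (s *\<^sub>R (A + u *\<^sub>R B))) (mat 1) < e"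
        unfolding eventually_at by auto
      have "f (mexp (F z)) = 0" for z
      proof (rule entire_eq_0[of "\<lambda>z. f (mexp (F z))" q])
        show "0 < q" by (rule q(1))
        show "(\<lambda>z. f (mexp (F z))) holomorphic_on UNIV"
          by (intro polyfun_holomorphic[OF pf] holomorphic_on_mexp holF)
        fix u assume u: "\<bar>u\<bar> < q"
        have "dist (mexp (s *\<^sub>R (A + u *\<^sub>R B))) (mat 1) < e"
          using q(2)[of u] u small by (cases "u = 0") auto
        then show "f (mexp (F (complex_of_real u))) = 0"
          using van mem[of u] by (simp add: F_real flip: cx_mexp)
      qed
      from this[of \<i>] show ?thesis by (simp add: F_def XAB)
    qed
    have "f (mexp (smul z X)) = 0" for z
    proof (rule entire_eq_0[of "\<lambda>z. f (mexp (smul z X))" r])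
      show "(\<lambda>z. f (mexp (smul z X))) holomorphic_on UNIV"
        by (intro polyfun_holomorphic[OF pf] holomorphic_on_mexp) (auto intro!: holomorphic_intros)
    qed (use r(1) step in auto)
    from this[of "complex_of_real t"] show ?thesis by (simp add: smul_of_real)
  qed
  then show "X \<in> lie_exp (zero_locus G d)" using X by (simp add: lie_exp_def zero_locus_def)
qed

text \<open>The locus contains a neighbourhood of the identity in \<open>G\<close>, so every element
  of \<open>G\<close> lies in the coset of a nearby point of a countable dense subset.\<close>

lemma zero_locus_countable_cosets:
  "\<exists>t :: nat \<Rightarrow> complex^'n^'n. range t \<subseteq> G \<and> (\<forall>A\<in>G. \<exists>k. matrix_inv (t k) ** A \<in> zero_locus G d)"
proof -
  obtain e where e: "e > 0" "\<And>A. A \<in> G \<Longrightarrow> dist A (mat 1) < e \<Longrightarrow> A \<in> zero_locus G d"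
    using closed_matrix_group_open_subgroup[OF closed_group closed_zero_locus _ lie_exp_zero_locus, of d]
    by (auto simp: zero_locus_def)
  obtain T where T: "countable T" "T \<subseteq> G" "G \<subseteq> closure T" using separable by blast
  have "T \<noteq> {}" using T(3) G_rules(2) by auto
  have "\<exists>k. matrix_inv (from_nat_into T k) ** A \<in> zero_locus G d" if A: "A \<in> G" for A
  proof -
    have "((\<lambda>B. matrix_inv A ** B) \<longlongrightarrow> matrix_inv A ** A) (at A)"
      by (intro tendsto_matrix_mult tendsto_const tendsto_ident_at)
    from tendstoD[OF this e(1)] obtain r
      where r: "r > 0" "\<And>B. B \<noteq> A \<Longrightarrow> dist B A < r \<Longrightarrow> dist (matrix_inv A ** B) (mat 1) < e"
      using G_rules(1)[OF A] unfolding eventually_at by auto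
    obtain B where B: "B \<in> T" "dist B A < r" using T(3) A r(1) by (meson closure_approachable subsetD)
    then have BG: "B \<in> G" using T(2) by auto
    have "dist (matrix_inv A ** B) (mat 1) < e"
      using r(2)[of B] B e(1) G_rules(1)[OF A] by (cases "B = A") auto
    then have "matrix_inv A ** B \<in> zero_locus G d" using e(2) G_rules(3,4) A BG by blast
    then have "matrix_inv (matrix_inv A ** B) \<in> zero_locus G d" by (rule zero_locus_inv)
    moreover have "matrix_inv (matrix_inv A ** B) = matrix_inv B ** A"
    proof (rule matrix_inv_eqI)
      show "matrix_inv A ** B ** (matrix_inv B ** A) = mat 1"
        using G_rules(1)[OF A] G_rules(1)[OF BG]
        by (metis matrix_inv_mult matrix_mul_assoc matrix_mul_rid)
      show "matrix_inv B ** A ** (matrix_inv A ** B) = mat 1"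
        using G_rules(1)[OF A] G_rules(1)[OF BG]
        by (metis matrix_inv_mult matrix_mul_assoc matrix_mul_rid)
    qed
    moreover obtain k where "from_nat_into T k = B" using B(1) T(1) by (metis from_nat_into_surj)
    ultimately show ?thesis by auto
  qed
  then show ?thesis using T(2) from_nat_into[OF \<open>T \<noteq> {}\<close>] by (intro exI[of _ "from_nat_into T"]) auto
qed

end


section \<open>Finite index of the zero locus and the identity theorem on the real points\<close>

context real_alg_group
begin

text \<open>A basis of the vanishing functions is finite, as they lie in a space of finite
  dimension. A list is returned because its positions serve as exponents of a generic
  parameter.\<close>

lemma zero_locus_basis:
  obtains bs where "set bs \<subseteq> polydeg entry_funs d"
    "\<And>A. A \<in> zero_locus G d \<longleftrightarrow> A \<in> G \<and> (\<forall>b\<in>set bs. b A = 0)"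
proof -
  obtain S :: "(complex^'n^'n \<Rightarrow> complex) set" where S: "finite S" "polydeg entry_funs d \<subseteq> fs.span S"
    using polydeg_finite_dimensional[OF finite_entry_funs] by blast
  have V: "vanishing_near_1 G d \<subseteq> polydeg entry_funs d" by (auto simp: vanishing_near_1_def)
  obtain B where B: "B \<subseteq> vanishing_near_1 G d" "fs.independent B" "vanishing_near_1 G d \<subseteq> fs.span B"
    by (rule fs.maximal_independent_subset)
  have "B \<subseteq> fs.span S" using B(1) V S(2) by blast
  then have "finite B" using fs.independent_span_bound[OF S(1) B(2)] by simp
  then obtain bs where bs: "set bs = B" using finite_list by blast
  have "A \<in> zero_locus G d \<longleftrightarrow> A \<in> G \<and> (\<forall>b\<in>B. b A = 0)" for A
    using B(1,3) fs_span_vanish[of _ B A] by (auto simp: zero_locus_def)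
  then show thesis using that[of bs] bs B(1) V by blast
qed

text \<open>If infinitely many translates \<open>t\<^sub>i Z\<close> of the zero locus were needed to cover \<open>G\<close>, choose a generic
  equation \<open>f\<^sub>i\<close> of each of them, one that does not vanish at the \<open>t\<^sub>k\<close> outside \<open>t\<^sub>i Z\<close>. By the Nullstellensatz
  all the \<open>f\<^sub>i\<close> are nonzero at some common point of \<open>G\<close>, which then lies in no translate.\<close>

lemma zero_locus_finite_index:
  "\<exists>t m. (\<forall>i<m. t i \<in> G) \<and> (\<forall>A\<in>G. \<exists>i<m::nat. matrix_inv (t i) ** A \<in> zero_locus G d)"
proof (rule ccontr)
  assume infinite_index: "\<not> ?thesis"
  define Z where "Z = zero_locus G d"
  obtain t :: "nat \<Rightarrow> complex^'n^'n" where t: "range t \<subseteq> G"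
    and cover: "\<forall>A\<in>G. \<exists>k. matrix_inv (t k) ** A \<in> Z"
    using zero_locus_countable_cosets[of d] unfolding Z_def by blast
  have tG: "t k \<in> G" for k using t by blast
  have Zgroup: "closed_matrix_group Z" unfolding Z_def by (rule closed_zero_locus)
  \<comment> \<open>If the first \<open>m\<close> translates contained all the \<open>t k\<close>,
    they would cover \<open>G\<close>, since each coset has some \<open>t k\<close> as
    representative.\<close>
  have far: "\<exists>k. \<forall>i<m. matrix_inv (t i) ** t k \<notin> Z" for m
  proof (rule ccontr)
    assume near: "\<not> ?thesis"
    have "\<exists>i<m. matrix_inv (t i) ** A \<in> Z" if A: "A \<in> G" for A
    proof -
      obtain k where k: "matrix_inv (t k) ** A \<in> Z" using cover A by blast
      obtain i where i: "i < m" "matrix_inv (t i) ** t k \<in> Z" using near by blast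
      have "matrix_inv (t i) ** A = matrix_inv (t i) ** (t k ** matrix_inv (t k)) ** A"
        using G_rules(1)[OF tG[of k]] by simp
      also have "\<dots> = (matrix_inv (t i) ** t k) ** (matrix_inv (t k) ** A)"
        by (simp only: matrix_mul_assoc)
      finally show ?thesis using i k closed_matrix_groupD(3)[OF Zgroup] by metis
    qed
    then show False using infinite_index tG unfolding Z_def by blast
  qed
  obtain bs where bs: "set bs \<subseteq> polydeg entry_funs d"
    and Z: "\<And>A. A \<in> Z \<longleftrightarrow> A \<in> G \<and> (\<forall>b\<in>set bs. b A = 0)"
    using zero_locus_basis[of d] unfolding Z_def by blast
  \<comment> \<open>The equations of the i-th translate at \<open>t k\<close> become the
    coefficients of a polynomial. Countably many nonzero polynomials have countably many roots, so
    one parameter \<open>c\<close> avoids them all.\<close>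
  define q where "q i k = (\<Sum>j<length bs. monom ((bs ! j) (matrix_inv (t i) ** t k)) j)" for i k
  define bad where "bad = (\<Union>i. \<Union>k. if q i k = 0 then {} else {x. poly (q i k) x = 0})"
  have "countable bad"
    unfolding bad_def by (intro countable_UN) (auto intro: countable_finite poly_roots_finite)
  then obtain c where c: "c \<notin> bad" using uncountable_UNIV_complex by (metis UNIV_eq_I)
  define f where "f i A = (\<Sum>j<length bs. (bs ! j) (matrix_inv (t i) ** A) * c ^ j)" for i A
  have f_pf: "f i \<in> polyfun entry_funs" for i
    unfolding f_def[abs_def] using bs
    by (intro polyfun_sum polyfun_mult polyfun_const polydeg_imp_polyfun[of _ _ d] polydeg_translate) auto
  have f_zero: "f i A = 0" if "matrix_inv (t i) ** A \<in> Z" for i A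
    using that unfolding Z f_def by (intro sum.neutral) auto
  have f_nz: "f i (t k) \<noteq> 0" if "matrix_inv (t i) ** t k \<notin> Z" for i k
  proof -
    have "matrix_inv (t i) ** t k \<in> G" using G_rules(3,4) tG by blast
    then have "\<not> (\<forall>b\<in>set bs. b (matrix_inv (t i) ** t k) = 0)"
      using that Z[of "matrix_inv (t i) ** t k"] by simp
    then obtain b where b: "b \<in> set bs" "b (matrix_inv (t i) ** t k) \<noteq> 0" by blast
    then obtain j where j: "j < length bs" "bs ! j = b" by (auto simp: in_set_conv_nth)
    have "coeff (q i k) j = b (matrix_inv (t i) ** t k)"
      using j by (simp add: q_def coeff_sum sum.delta)
    then have "q i k \<noteq> 0" using b by auto
    then have "poly (q i k) c \<noteq> 0" using c unfolding bad_def by auto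
    moreover have "poly (q i k) c = f i (t k)" by (simp add: q_def f_def poly_sum poly_monom)
    ultimately show ?thesis by simp
  qed
  obtain F where F: "F \<subseteq> polyfun entry_funs" "\<And>A. A \<in> G \<longleftrightarrow> invertible A \<and> (\<forall>f\<in>F. f A = 0)"
    using equations by blast
  define mk :: "(('n \<times> 'n) + nat \<Rightarrow> complex) \<Rightarrow> complex^'n^'n" where "mk x = (\<chi> i j. x (Inl (i, j)))" for x
  \<comment> \<open>Rabinowitsch's trick: an extra variable forces f l to be nonzero. The variable
    \<open>Inr 0\<close> plays the same part for the determinant.\<close>
  define s where "s l x = f l (mk x) * x (Inr (Suc l)) - 1" for l x
  define s0 where "s0 x = det (mk x) * x (Inr 0) - 1" for x
  define S where "S = (\<lambda>g x. g (mk x)) ` F \<union> insert s0 (range s)"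
  have coord: "(\<lambda>x. x k) \<in> polyfun (coordinate_funs :: ((('n \<times> 'n) + nat \<Rightarrow> complex) \<Rightarrow> complex) set)" for k
    by (intro polyfun_gen) auto
  have comp: "(\<lambda>x. g (mk x)) \<in> polyfun coordinate_funs" if "g \<in> polyfun entry_funs" for g
    by (intro polyfun_compose_entries[OF that]) (simp add: mk_def coord)
  have "\<exists>x. \<forall>s\<in>S. s x = 0"
  proof (rule countable_nullstellensatz)
    show "S \<subseteq> polyfun coordinate_funs"
      using F(1) comp[OF f_pf] comp[OF polyfun_det]
      by (auto simp: S_def s_def[abs_def] s0_def[abs_def]
          intro!: polyfun_diff polyfun_mult polyfun_const coord comp f_pf)
  next
    fix T assume T: "finite T" "T \<subseteq> S"
    have "finite (T \<inter> range s)" using T(1) by simp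
    from finite_subset_image[OF this, of s UNIV] obtain L where L: "finite L" "T \<inter> range s = s ` L" by auto
    obtain m where m: "\<And>l. l \<in> L \<Longrightarrow> l < m" using finite_nat_bounded[OF L(1)] by auto
    \<comment> \<open>Only finitely many equations \<open>s l\<close> occur in \<open>T\<close>, and
      a point outside the first \<open>m\<close> translates solves them. Where f l (t k) is 0 the
      division below yields the default 0, which affects no equation of \<open>T\<close>.\<close>
    obtain k where k: "\<And>i. i < m \<Longrightarrow> matrix_inv (t i) ** t k \<notin> Z" using far by blast
    define x where "x v = (case v of Inl (i, j) \<Rightarrow> t k $ i $ j
      | Inr 0 \<Rightarrow> 1 / det (t k) | Inr (Suc l) \<Rightarrow> 1 / f l (t k))" for v :: "('n \<times> 'n) + nat"
    have mkx: "mk x = t k" by (simp add: mk_def x_def vec_eq_iff)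
    have "r x = 0" if rT: "r \<in> T" for r
    proof -
      have "r \<in> S" using rT T(2) by blast
      then consider "r \<in> (\<lambda>g x. g (mk x)) ` F" | "r = s0" | "r \<in> s ` L"
        using rT unfolding L(2)[symmetric] S_def by blast
      then show ?thesis
      proof cases
        case 1
        then obtain g where "g \<in> F" "r = (\<lambda>x. g (mk x))" by blast
        then show ?thesis using F(2)[of "t k"] tG[of k] by (simp add: mkx)
      next
        case 2
        have "det (t k) \<noteq> 0" using G_rules(1)[OF tG[of k]] by (simp add: invertible_det_nz)
        then show ?thesis using 2 by (simp add: s0_def mkx) (simp add: x_def)
      next
        case 3
        then obtain l where l: "l \<in> L" "r = s l" by blast
        have "f l (t k) \<noteq> 0" by (rule f_nz[OF k[OF m[OF l(1)]]])
        then show ?thesis using l by (simp add: s_def mkx) (simp add: x_def)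
      qed
    qed
    then show "\<exists>x. \<forall>r\<in>T. r x = 0" by blast
  qed
  then obtain x where x: "\<And>r. r \<in> S \<Longrightarrow> r x = 0" by blast
  have "s0 x = 0" using x by (simp add: S_def)
  then have "det (mk x) \<noteq> 0" by (auto simp: s0_def)
  moreover have "g (mk x) = 0" if "g \<in> F" for g using x[of "\<lambda>x. g (mk x)"] that by (auto simp: S_def)
  ultimately have "mk x \<in> G" using F(2) by (simp add: invertible_det_nz)
  then obtain k where "matrix_inv (t k) ** mk x \<in> Z" using cover by blast
  then have "f k (mk x) = 0" by (rule f_zero)
  moreover have "s k x = 0" using x by (simp add: S_def)
  ultimately show False by (simp add: s_def)
qed

text \<open>Finitely many cosets make both the locus and the union of its other cosets Zariski
  closed in \<open>G\<close>; they are disjoint and cover \<open>G\<close>, and the first contains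
  the identity.\<close>

lemma zero_locus_eq:
  assumes "connectedin zariski G"
  shows "zero_locus G d = G"
proof -
  define Z where "Z = zero_locus G d"
  have Zgroup: "closed_matrix_group Z" unfolding Z_def by (rule closed_zero_locus)
  obtain t and m :: nat where t: "\<And>i. i < m \<Longrightarrow> t i \<in> G"
    and cover: "\<And>A. A \<in> G \<Longrightarrow> \<exists>i<m. matrix_inv (t i) ** A \<in> Z"
    using zero_locus_finite_index[of d] unfolding Z_def by blast
  let ?V = "vanishing_near_1 G d"
  define E1 where "E1 = {A. \<forall>f\<in>?V. f A = 0}"
  \<comment> \<open>The condition on \<open>t i\<close> drops exactly those translates that coincide
    with \<open>Z\<close>.\<close>
  define E2 where "E2 = (\<Union>i\<in>{i. i < m \<and> t i \<notin> Z}. {A. \<forall>f\<in>(\<lambda>f A. f (matrix_inv (t i) ** A)) ` ?V. f A = 0})"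
  have V: "?V \<subseteq> polydeg entry_funs d" by (auto simp: vanishing_near_1_def)
  have "closedin zariski E1" unfolding E1_def using V polydeg_imp_polyfun by (intro closedin_zariski) blast
  moreover have "closedin zariski E2"
    unfolding E2_def
  proof (rule closedin_Union; clarsimp)
    fix i
    have "(\<lambda>f A. f (matrix_inv (t i) ** A)) ` ?V \<subseteq> polyfun entry_funs"
      using V polydeg_translate(1) polydeg_imp_polyfun by blast
    from closedin_zariski[OF this]
    show "closedin zariski {A. \<forall>f\<in>?V. f (matrix_inv (t i) ** A) = 0}" by simp
  qed
  moreover have "G \<subseteq> E1 \<union> E2"
  proof
    fix A assume A: "A \<in> G"
    obtain i where i: "i < m" "matrix_inv (t i) ** A \<in> Z" using cover[OF A] by blast
    show "A \<in> E1 \<union> E2"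
    proof (cases "t i \<in> Z")
      case True
      have "t i ** (matrix_inv (t i) ** A) \<in> Z" using closed_matrix_groupD(3)[OF Zgroup True i(2)] .
      then have "A \<in> Z" using G_rules(1)[OF t[OF i(1)]] by (simp add: matrix_mul_assoc)
      then show ?thesis by (auto simp: E1_def Z_def zero_locus_def)
    next
      case False
      then show ?thesis using i by (auto simp: E2_def Z_def zero_locus_def)
    qed
  qed
  moreover have "E1 \<inter> E2 \<inter> G = {}"
  proof (rule ccontr)
    assume "E1 \<inter> E2 \<inter> G \<noteq> {}"
    then obtain A i where A: "A \<in> G" "A \<in> E1" and i: "i < m" "t i \<notin> Z" "\<forall>f\<in>?V. f (matrix_inv (t i) ** A) = 0"
      by (auto simp: E2_def)
    have AZ: "A \<in> Z" using A by (simp add: E1_def Z_def zero_locus_def)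
    have "matrix_inv (t i) ** A \<in> Z"
      using i A t G_rules(3,4) by (simp add: Z_def zero_locus_def)
    then have "matrix_inv (t i) ** A ** matrix_inv A \<in> Z"
      using closed_matrix_groupD(3,4)[OF Zgroup] AZ by blast
    moreover have "matrix_inv (t i) ** A ** matrix_inv A = matrix_inv (t i)"
      using G_rules(1)[OF A(1)] by (simp flip: matrix_mul_assoc)
    ultimately have "matrix_inv (matrix_inv (t i)) \<in> Z" using closed_matrix_groupD(4)[OF Zgroup] by simp
    moreover have "matrix_inv (matrix_inv (t i)) = t i"
      using G_rules(1)[OF t[OF i(1)]] by (intro matrix_inv_eqI) auto
    ultimately show False using i by simp
  qed
  moreover have "E1 \<inter> G \<noteq> {}" using zero_locus_one[of d] by (auto simp: E1_def zero_locus_def)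
  ultimately have "E2 \<inter> G = {}" using assms unfolding connectedin_closedin by blast
  then have "G \<subseteq> E1" using \<open>G \<subseteq> E1 \<union> E2\<close> by blast
  then show ?thesis by (auto simp: E1_def zero_locus_def)
qed

theorem polyfun_vanishing_near_1:
  assumes conn: "connectedin zariski G" and f: "f \<in> polyfun entry_funs" and "e > 0"
    and van: "\<And>A. A \<in> real_points G \<Longrightarrow> dist A (mat 1) < e \<Longrightarrow> f (cx A) = 0"
    and "A \<in> G"
  shows "f A = 0"
proof -
  obtain d where "f \<in> polydeg entry_funs d" using polyfun_imp_polydeg[OF f] by blast
  then have "f \<in> vanishing_near_1 G d" using \<open>e > 0\<close> van by (auto simp: vanishing_near_1_def)
  then show ?thesis using zero_locus_eq[OF conn, of d] \<open>A \<in> G\<close> by (auto simp: zero_locus_def)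
qed

lemma polyfun_complexify:
  assumes "f \<in> polyfun entry_funs"
  shows "\<exists>g\<in>polyfun entry_funs. \<forall>A :: real^'n^'n. g (cx A) = complex_of_real (f A)"
  using assms
proof induction
  case (polyfun_const c)
  show ?case by (intro bexI[of _ "\<lambda>_. complex_of_real c"] polyfun.polyfun_const) auto
next
  case (polyfun_gen f)
  then obtain i j where "f = (\<lambda>A. A $ i $ j)" by auto
  then show ?case by (intro bexI[of _ "\<lambda>A. A $ i $ j"] polyfun_entry) auto
next
  case (polyfun_add f1 f2)
  then obtain g1 g2 where "g1 \<in> polyfun entry_funs" "\<forall>A. g1 (cx A) = complex_of_real (f1 A)"
    "g2 \<in> polyfun entry_funs" "\<forall>A. g2 (cx A) = complex_of_real (f2 A)" by blast
  then show ?case by (intro bexI[of _ "\<lambda>A. g1 A + g2 A"] polyfun.polyfun_add) auto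
next
  case (polyfun_mult f1 f2)
  then obtain g1 g2 where "g1 \<in> polyfun entry_funs" "\<forall>A. g1 (cx A) = complex_of_real (f1 A)"
    "g2 \<in> polyfun entry_funs" "\<forall>A. g2 (cx A) = complex_of_real (f2 A)" by blast
  then show ?case by (intro bexI[of _ "\<lambda>A. g1 A * g2 A"] polyfun.polyfun_mult) auto
qed

text \<open>Left translation by a point \<open>B\<close> of \<open>U\<close> moves the open set to
  the identity, and \<open>A\<close> is reached as B (B^-1 A). The conclusion passes through the
  complex group, so a point in another Euclidean component is reached as well.\<close>

theorem polyfun_identity_real_points:
  assumes conn: "connectedin zariski G" and f: "f \<in> polyfun entry_funs"
    and U: "openin (top_of_set (real_points G)) U" "U \<noteq> {}" "\<And>A. A \<in> U \<Longrightarrow> f A = 0"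
    and A: "A \<in> real_points G"
  shows "f A = 0"
proof -
  obtain B where B: "B \<in> U" using U(2) by blast
  obtain T where T: "open T" "U = real_points G \<inter> T" using U(1) by (auto simp: openin_open)
  have BG: "B \<in> real_points G" using B T by auto
  have "((\<lambda>A. B ** A) \<longlongrightarrow> B ** mat 1) (at (mat 1))"
    by (intro tendsto_matrix_mult tendsto_const tendsto_ident_at)
  from topological_tendstoD[OF this T(1)] obtain e where e: "e > 0"
    "\<And>A. A \<noteq> mat 1 \<Longrightarrow> dist A (mat 1) < e \<Longrightarrow> B ** A \<in> T"
    using B T by (auto simp: eventually_at)
  obtain g where g: "g \<in> polyfun entry_funs" "\<And>A. g (cx A) = complex_of_real (f A)"
    using polyfun_complexify[OF f] by blast
  have "g (cx B ** cx C) = 0" if "C \<in> real_points G" "dist C (mat 1) < e" for C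
  proof -
    have "B ** C \<in> T" using e(2)[of C] that B T(2) by (cases "C = mat 1") auto
    then have "B ** C \<in> U" using T(2) R_rules(3)[OF BG that(1)] by simp
    then show ?thesis using U(3) g(2) by (simp flip: cx_mult)
  qed
  moreover obtain d where "g \<in> polydeg entry_funs d" using polyfun_imp_polydeg[OF g(1)] by blast
  then have "(\<lambda>A. g (cx B ** A)) \<in> polyfun entry_funs"
    using polydeg_translate(1) polydeg_imp_polyfun by blast
  moreover have BAG: "matrix_inv B ** A \<in> real_points G" using R_rules(3,4) BG A by blast
  ultimately have "g (cx B ** cx (matrix_inv B ** A)) = 0"
    using polyfun_vanishing_near_1[OF conn _ e(1), of "\<lambda>A. g (cx B ** A)" "cx (matrix_inv B ** A)"]
    by (simp add: real_points_iff)
  moreover have "B ** (matrix_inv B ** A) = A" using R_rules(1)[OF BG] by (simp add: matrix_mul_assoc)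
  ultimately show ?thesis using g(2) by (simp flip: cx_mult)
qed

end

text \<open>Only the entries at indices in \<open>V\<close> are generators, so a polynomial function
  ignores the values of a family outside \<open>V\<close>.\<close>

abbreviation family_entry_funs :: "'v set \<Rightarrow> (('v \<Rightarrow> 'a^'n^'n) \<Rightarrow> 'a) set" where
  "family_entry_funs V \<equiv> (\<lambda>(v, i, j) g. g v $ i $ j) ` (V \<times> UNIV \<times> UNIV)"

text \<open>One component at a time: inside an open box on which \<open>f\<close> vanishes, the
  identity theorem for a single matrix frees the component \<open>w\<close> from its open set to all
  real points. \<open>W\<close> is the set of components already freed.\<close>

theorem (in real_alg_group) polyfun_identity_families:
  assumes conn: "connectedin zariski G" and "finite V" and f: "f \<in> polyfun (family_entry_funs V)"
    and U: "openin (product_topology (\<lambda>_. top_of_set (real_points G)) V) U" "U \<noteq> {}"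
    and van: "\<And>g. g \<in> U \<Longrightarrow> f g = 0"
    and g: "\<And>v. v \<in> V \<Longrightarrow> g v \<in> real_points G"
  shows "f g = 0"
proof -
  obtain g0 where "g0 \<in> U" using U(2) by blast
  then obtain O' where O': "\<And>v. v \<in> V \<Longrightarrow> openin (top_of_set (real_points G)) (O' v)"
    and box: "g0 \<in> Pi\<^sub>E V O'" "Pi\<^sub>E V O' \<subseteq> U"
    using U(1)[unfolded openin_product_topology_alt] by (metis (no_types, lifting))
  have dep: "f g = f h" if "\<And>v. v \<in> V \<Longrightarrow> g v = h v" for g h
    using f by induction (use that in auto)
  have "f g = 0" if "finite W" "W \<subseteq> V" "\<And>v. v \<in> W \<Longrightarrow> g v \<in> real_points G"
      "\<And>v. v \<in> V - W \<Longrightarrow> g v \<in> O' v" for W g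
    using that
  proof (induction W arbitrary: g rule: finite_induct)
    case empty
    then have "restrict g V \<in> Pi\<^sub>E V O'" by auto
    then have "f (restrict g V) = 0" using box van by blast
    then show ?case using dep[of g "restrict g V"] by simp
  next
    case (insert w W)
    have pf: "(\<lambda>A. f (g(w := A))) \<in> polyfun entry_funs"
    proof (rule polyfun_compose[OF f])
      fix h :: "('a \<Rightarrow> real^'n^'n) \<Rightarrow> real" assume "h \<in> family_entry_funs V"
      then obtain v i j where h: "h = (\<lambda>g. g v $ i $ j)" by auto
      show "(\<lambda>A. h (g(w := A))) \<in> polyfun entry_funs"
        by (cases "v = w") (simp_all add: h polyfun_entry polyfun_const)
    qed
    have "f (g(w := A)) = 0" if "A \<in> O' w" for A
      using insert.prems insert.hyps that by (intro insert.IH) auto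
    moreover have "w \<in> V" using insert.prems(1) by simp
    then have "O' w \<noteq> {}" using PiE_mem[OF box(1)] by blast
    moreover have "openin (top_of_set (real_points G)) (O' w)" by (rule O'[OF \<open>w \<in> V\<close>])
    moreover have "g w \<in> real_points G" by (rule insert.prems(2)) simp
    ultimately have "f (g(w := g w)) = 0"
      using polyfun_identity_real_points[OF conn pf, of "O' w" "g w"] by blast
    then show ?case by simp
  qed
  from this[of V g] show ?thesis using \<open>finite V\<close> g by simp
qed


section \<open>Dimensions of modules presented by spaces of real functions\<close>

definition lin_subspace :: "(real \<Rightarrow> 'c \<Rightarrow> 'c) \<Rightarrow> 'c::ab_group_add set \<Rightarrow> bool" where
  "lin_subspace sc D \<longleftrightarrow> 0 \<in> D \<and> (\<forall>x\<in>D. \<forall>y\<in>D. x + y \<in> D) \<and> (\<forall>c. \<forall>x\<in>D. sc c x \<in> D)"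

lemma lin_subspaceI:
  "0 \<in> D \<Longrightarrow> (\<And>x y. x \<in> D \<Longrightarrow> y \<in> D \<Longrightarrow> x + y \<in> D) \<Longrightarrow> (\<And>c x. x \<in> D \<Longrightarrow> sc c x \<in> D) \<Longrightarrow> lin_subspace sc D"
  by (simp add: lin_subspace_def)

lemma lin_subspaceD:
  assumes "lin_subspace sc D"
  shows "0 \<in> D" "x \<in> D \<Longrightarrow> y \<in> D \<Longrightarrow> x + y \<in> D" "x \<in> D \<Longrightarrow> sc c x \<in> D"
  using assms by (simp_all add: lin_subspace_def)

text \<open>\<open>lin_onto sc D \<pi> M\<close>: the map \<open>\<pi>\<close> presents \<open>M\<close> as a quotient of the subspace \<open>D\<close>.\<close>

definition lin_onto :: "(real \<Rightarrow> 'c \<Rightarrow> 'c) \<Rightarrow> 'c::ab_group_add set \<Rightarrow> ('c \<Rightarrow> 'b) \<Rightarrow> (real, 'b) module \<Rightarrow> bool" where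
  "lin_onto sc D \<pi> M \<longleftrightarrow> vector_space sc \<and> lin_subspace sc D \<and> carrier M = \<pi> ` D \<and>
     (\<forall>x\<in>D. \<forall>y\<in>D. \<pi> (x + y) = \<pi> x \<oplus>\<^bsub>M\<^esub> \<pi> y) \<and> (\<forall>c. \<forall>x\<in>D. \<pi> (sc c x) = c \<odot>\<^bsub>M\<^esub> \<pi> x) \<and>
     \<zero>\<^bsub>M\<^esub> = \<pi> 0"

lemma lin_ontoD:
  assumes "lin_onto sc D \<pi> M"
  shows "vector_space sc" "lin_subspace sc D" "carrier M = \<pi> ` D"
    "x \<in> D \<Longrightarrow> y \<in> D \<Longrightarrow> \<pi> (x + y) = \<pi> x \<oplus>\<^bsub>M\<^esub> \<pi> y" "x \<in> D \<Longrightarrow> \<pi> (sc c x) = c \<odot>\<^bsub>M\<^esub> \<pi> x"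
    "\<zero>\<^bsub>M\<^esub> = \<pi> 0"
  using assms by (simp_all add: lin_onto_def)

lemma field_real_scalars: "field real_scalars"
proof -
  have "\<exists>y. x * y = 1" if "x \<noteq> 0" for x :: real using that by (intro exI[of _ "1 / x"]) simp
  then show ?thesis
    by unfold_locales
       (auto simp: real_scalars_def algebra_simps Units_def intro: exI[of _ "- _"])
qed

text \<open>The axioms are inherited along the surjection \<pi>; in particular the image of
  \<open>sc (- 1) x\<close> is an additive inverse of the image of x.\<close>

lemma lin_onto_vectorspace:
  assumes M: "lin_onto sc D \<pi> M"
  shows "vectorspace real_scalars M"
proof (rule vs_criteria[OF field_real_scalars])
  interpret vector_space sc by (rule lin_ontoD(1)[OF M])
  note D = lin_subspaceD[OF lin_ontoD(2)[OF M]]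
  have C: "carrier M = \<pi> ` D" by (rule lin_ontoD(3)[OF M])
  note add = lin_ontoD(4)[OF M, symmetric] and sc = lin_ontoD(5)[OF M, symmetric]
    and zero = lin_ontoD(6)[OF M]
  show "\<zero>\<^bsub>M\<^esub> \<in> carrier M" unfolding C zero using D(1) by blast
  show "\<forall>v w. v \<in> carrier M \<and> w \<in> carrier M \<longrightarrow> v \<oplus>\<^bsub>M\<^esub> w \<in> carrier M"
    unfolding C using D(2) add by fastforce
  show "\<forall>v\<in>carrier M. \<exists>w\<in>carrier M. v \<oplus>\<^bsub>M\<^esub> w = \<zero>\<^bsub>M\<^esub>"
    unfolding C zero
  proof clarify
    fix x assume x: "x \<in> D"
    then have "sc (- 1) x \<in> D" by (rule D(3))
    moreover have "x + sc (- 1) x = 0" by simp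
    ultimately show "\<exists>w\<in>\<pi> ` D. \<pi> x \<oplus>\<^bsub>M\<^esub> w = \<pi> 0" using add[OF x] by fastforce
  qed
  show "\<forall>c v. c \<in> carrier real_scalars \<and> v \<in> carrier M \<longrightarrow> c \<odot>\<^bsub>M\<^esub> v \<in> carrier M"
    unfolding C using D(3) sc by fastforce
  show "\<forall>v w. v \<in> carrier M \<and> w \<in> carrier M \<longrightarrow> v \<oplus>\<^bsub>M\<^esub> w = w \<oplus>\<^bsub>M\<^esub> v"
    unfolding C by (auto simp: add ac_simps)
  show "\<forall>v w x. v \<in> carrier M \<and> w \<in> carrier M \<and> x \<in> carrier M \<longrightarrow>
      v \<oplus>\<^bsub>M\<^esub> w \<oplus>\<^bsub>M\<^esub> x = v \<oplus>\<^bsub>M\<^esub> (w \<oplus>\<^bsub>M\<^esub> x)"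
    unfolding C by (auto simp: add D ac_simps)
  show "\<forall>v\<in>carrier M. v \<oplus>\<^bsub>M\<^esub> \<zero>\<^bsub>M\<^esub> = v" unfolding C zero by (auto simp: add D)
  show "\<forall>a b v. a \<in> carrier real_scalars \<and> b \<in> carrier real_scalars \<and> v \<in> carrier M \<longrightarrow>
      a \<otimes>\<^bsub>real_scalars\<^esub> b \<odot>\<^bsub>M\<^esub> v = a \<odot>\<^bsub>M\<^esub> (b \<odot>\<^bsub>M\<^esub> v)"
    unfolding C by (auto simp: sc D real_scalars_def)
  show "\<forall>v\<in>carrier M. \<one>\<^bsub>real_scalars\<^esub> \<odot>\<^bsub>M\<^esub> v = v" unfolding C by (auto simp: sc D real_scalars_def)
  show "\<forall>a b v. a \<in> carrier real_scalars \<and> b \<in> carrier real_scalars \<and> v \<in> carrier M \<longrightarrow>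
      (a \<oplus>\<^bsub>real_scalars\<^esub> b) \<odot>\<^bsub>M\<^esub> v = a \<odot>\<^bsub>M\<^esub> v \<oplus>\<^bsub>M\<^esub> b \<odot>\<^bsub>M\<^esub> v"
    unfolding C by (auto simp: add sc D real_scalars_def scale_left_distrib)
  show "\<forall>a v w. a \<in> carrier real_scalars \<and> v \<in> carrier M \<and> w \<in> carrier M \<longrightarrow>
      a \<odot>\<^bsub>M\<^esub> (v \<oplus>\<^bsub>M\<^esub> w) = a \<odot>\<^bsub>M\<^esub> v \<oplus>\<^bsub>M\<^esub> a \<odot>\<^bsub>M\<^esub> w"
    unfolding C by (auto simp: add sc D real_scalars_def scale_right_distrib)
qed

abbreviation fscale :: "real \<Rightarrow> ('j \<Rightarrow> real) \<Rightarrow> 'j \<Rightarrow> real" where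
  "fscale \<equiv> \<lambda>c f j. c * f j"

definition fun_module :: "('j \<Rightarrow> real) set \<Rightarrow> (real, 'j \<Rightarrow> real) module" where
  "fun_module D = \<lparr>carrier = D, monoid.mult = undefined, one = undefined,
     zero = 0, add = (+), smult = fscale\<rparr>"

definition fdim :: "('j \<Rightarrow> real) set \<Rightarrow> nat" where
  "fdim D = vectorspace.dim real_scalars (fun_module D)"

text \<open>Coordinate spaces for different index sets live on one function type; the value 0 off
  \<open>J\<close> keeps them finite-dimensional for finite \<open>J\<close>.\<close>

definition supported_on :: "'j set \<Rightarrow> ('j \<Rightarrow> real) set" where
  "supported_on J = {f. \<forall>j. j \<notin> J \<longrightarrow> f j = 0}"

lemma vector_space_fscale: "vector_space (fscale :: real \<Rightarrow> ('j \<Rightarrow> real) \<Rightarrow> _)"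
  by (rule fs.vector_space_axioms)

lemma lin_onto_fun_module: "lin_subspace fscale D \<Longrightarrow> lin_onto fscale D (\<lambda>x. x) (fun_module D)"
  by (simp add: lin_onto_def fun_module_def vector_space_fscale)

lemma lin_onto_image:
  assumes "lin_subspace fscale D" "\<And>x y. x \<in> D \<Longrightarrow> y \<in> D \<Longrightarrow> L (x + y) = L x + L y"
    "\<And>c x. x \<in> D \<Longrightarrow> L (fscale c x) = fscale c (L x)" "L 0 = 0"
  shows "lin_onto fscale D L (fun_module (L ` D))"
  using assms by (simp add: lin_onto_def fun_module_def vector_space_fscale)

lemma lin_subspace_supported_on: "lin_subspace fscale (supported_on J)"
  by (intro lin_subspaceI) (auto simp: supported_on_def)

lemma fun_module_fin_dim:
  assumes D: "lin_subspace fscale D" and "finite J" and sub: "D \<subseteq> supported_on J"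
  shows "vectorspace.fin_dim real_scalars (fun_module D)"
proof -
  interpret V: vectorspace real_scalars "fun_module D"
    by (rule lin_onto_vectorspace[OF lin_onto_fun_module[OF D]])
  obtain B where B: "B \<subseteq> D" "fs.independent B" "D \<subseteq> fs.span B"
    by (rule fs.maximal_independent_subset)
  have "supported_on J \<subseteq> fs.span ((\<lambda>j k. if k = j then 1 else 0) ` J)"
  proof
    fix f assume f: "f \<in> supported_on J"
    have "(\<Sum>j\<in>J. (\<lambda>k. f j * (if k = j then 1 else 0))) \<in> fs.span ((\<lambda>j k. if k = j then 1 else 0) ` J)"
      by (intro fs.span_sum fs.span_scale fs.span_base) auto
    also have "(\<Sum>j\<in>J. (\<lambda>k. f j * (if k = j then 1 else 0))) = f"
    proof
      fix k
      have "(\<Sum>j\<in>J. (\<lambda>k. f j * (if k = j then 1 else 0))) k = (\<Sum>j\<in>J. if k = j then f j else 0)"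
        unfolding sum_fun_apply by (intro sum.cong) auto
      also have "\<dots> = f k" using f \<open>finite J\<close> by (auto simp: sum.delta supported_on_def)
      finally show "(\<Sum>j\<in>J. (\<lambda>k. f j * (if k = j then 1 else 0))) k = f k" .
    qed
    finally show "f \<in> fs.span ((\<lambda>j k. if k = j then 1 else 0) ` J)" .
  qed
  then have "B \<subseteq> fs.span ((\<lambda>j k. if k = j then 1 else 0) ` J)" using B(1) sub by blast
  then have finB: "finite B" using fs.independent_span_bound[OF _ B(2)] \<open>finite J\<close> by blast
  have lincomb: "V.lincomb u A = (\<lambda>k. \<Sum>b\<in>A. u b * b k)" if "finite A" "A \<subseteq> D" for u A
    using that
  proof (induction A rule: finite_induct)
    case empty
    show ?case unfolding V.lincomb_def V.finsum_empty by (simp add: fun_module_def zero_fun_def)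
  next
    case (insert b A)
    have b: "u c \<odot>\<^bsub>fun_module D\<^esub> c \<in> carrier (fun_module D)" if "c \<in> D" for c
      using lin_subspaceD(3)[OF D that] by (simp add: fun_module_def)
    have "V.lincomb u (insert b A) = u b \<odot>\<^bsub>fun_module D\<^esub> b \<oplus>\<^bsub>fun_module D\<^esub> V.lincomb u A"
      unfolding V.lincomb_def using insert b by (intro V.finsum_insert) auto
    also have "\<dots> = (\<lambda>k. \<Sum>c\<in>insert b A. u c * c k)"
      using insert by (auto simp: fun_module_def fun_eq_iff)
    finally show ?case .
  qed
  have "V.span B = D"
  proof
    show "V.span B \<subseteq> D" using V.span_is_subset2[of B] B(1) by (simp add: fun_module_def)
    show "D \<subseteq> V.span B"
    proof
      fix f assume "f \<in> D"
      then obtain u where "f = (\<lambda>k. \<Sum>b\<in>B. u b * b k)" using fs_span_finite[OF finB] B(3) by blast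
      then have "f = V.lincomb u B" using lincomb[OF finB B(1)] by simp
      then show "f \<in> V.span B" unfolding V.span_def using finB by (auto simp: real_scalars_def)
    qed
  qed
  then show ?thesis
    unfolding V.fin_dim_def using finB B(1) by (intro exI[of _ B]) (simp add: fun_module_def)
qed

text \<open>Rank-nullity for the presentation. It expresses the dimension of a module of cosets
  through dimensions of spaces of real functions.\<close>

theorem lin_onto_dim:
  assumes M: "lin_onto fscale D \<pi> M" and J: "finite J" "D \<subseteq> supported_on J"
  shows "fdim D = vectorspace.dim real_scalars M + fdim {x \<in> D. \<pi> x = \<zero>\<^bsub>M\<^esub>}"
proof -
  note D = lin_ontoD(2)[OF M]
  interpret L: linear_map real_scalars "fun_module D" M \<pi>
  proof -
    have "module_hom real_scalars (fun_module D) M = module_hom real_scalars (fun_module D) M" ..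
    moreover have "\<pi> \<in> module_hom real_scalars (fun_module D) M"
      using lin_ontoD(3-5)[OF M] by (auto simp: module_hom_def fun_module_def)
    moreover have "vectorspace real_scalars (fun_module D)"
      by (rule lin_onto_vectorspace[OF lin_onto_fun_module[OF D]])
    moreover have "vectorspace real_scalars M" by (rule lin_onto_vectorspace[OF M])
    ultimately show "linear_map real_scalars (fun_module D) M \<pi>"
      by (simp add: linear_map_def mod_hom_def mod_hom_axioms_def vectorspace_def)
  qed
  have "L.imT = \<pi> ` carrier (fun_module D)" unfolding L.im_def ..
  also have "\<dots> = carrier M" using lin_ontoD(3)[OF M] by (simp add: fun_module_def)
  finally have "L.imT = carrier M" .
  then have "M\<lparr>carrier := L.imT\<rparr> = M" by simp
  moreover have "L.kerT = {x \<in> D. \<pi> x = \<zero>\<^bsub>M\<^esub>}" unfolding L.ker_def by (simp add: fun_module_def)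
  then have "(fun_module D)\<lparr>carrier := L.kerT\<rparr> = fun_module {x \<in> D. \<pi> x = \<zero>\<^bsub>M\<^esub>}"
    by (simp add: fun_module_def)
  ultimately show ?thesis
    using L.rank_nullity[OF fun_module_fin_dim[OF D J]] by (simp add: fdim_def)
qed

corollary fdim_rank_nullity:
  fixes L :: "('j \<Rightarrow> real) \<Rightarrow> 'k \<Rightarrow> real"
  assumes D: "lin_subspace fscale D" and J: "finite J" "D \<subseteq> supported_on J"
    and L: "\<And>x y. x \<in> D \<Longrightarrow> y \<in> D \<Longrightarrow> L (x + y) = L x + L y"
      "\<And>c x. x \<in> D \<Longrightarrow> L (fscale c x) = fscale c (L x)" "L 0 = 0"
  shows "fdim D = fdim (L ` D) + fdim {x \<in> D. L x = 0}"
proof -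
  have "\<zero>\<^bsub>fun_module (L ` D)\<^esub> = 0" by (simp add: fun_module_def)
  then show ?thesis using lin_onto_dim[OF lin_onto_image[OF D L] J] by (simp add: fdim_def)
qed

lemma fdim_0: "fdim {0 :: 'j \<Rightarrow> real} = 0"
proof -
  have "lin_subspace fscale {0 :: 'j \<Rightarrow> real}" by (intro lin_subspaceI) (auto simp: zero_fun_def)
  then have "fdim {0 :: 'j \<Rightarrow> real} = fdim ((\<lambda>x. x) ` {0 :: 'j \<Rightarrow> real}) + fdim {x \<in> {0 :: 'j \<Rightarrow> real}. x = 0}"
    by (intro fdim_rank_nullity[of _ "{}"]) (auto simp: supported_on_def)
  then show ?thesis by simp
qed

lemma fdim_iso:
  fixes L :: "('j \<Rightarrow> real) \<Rightarrow> 'k \<Rightarrow> real"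
  assumes D: "lin_subspace fscale D" "finite J" "D \<subseteq> supported_on J"
    and L: "\<And>x y. L (x + y) = L x + L y" "\<And>c x. L (fscale c x) = fscale c (L x)"
    and inj: "\<And>x. x \<in> D \<Longrightarrow> L x = 0 \<Longrightarrow> x = 0"
  shows "fdim (L ` D) = fdim D"
proof -
  have L0: "L 0 = 0" using L(1)[of 0 0] by simp
  then have "{x \<in> D. L x = 0} = {0}" using inj lin_subspaceD(1)[OF D(1)] by auto
  then show ?thesis using fdim_rank_nullity[OF D L L0] by (simp add: fdim_0)
qed

section \<open>Generic rank of a system of linear equations\<close>

definition solutions :: "'j set \<Rightarrow> 'i set \<Rightarrow> ('i \<Rightarrow> 'j \<Rightarrow> real) \<Rightarrow> ('j \<Rightarrow> real) set" where
  "solutions J I M = {x \<in> supported_on J. \<forall>i\<in>I. (\<Sum>j\<in>J. M i j * x j) = 0}"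

lemma lin_subspace_solutions: "lin_subspace fscale (solutions J I M)"
proof (rule lin_subspaceI)
  fix c x assume "x \<in> solutions J I M"
  moreover have "(\<Sum>j\<in>J. M i j * (c * x j)) = c * (\<Sum>j\<in>J. M i j * x j)" for i
    by (simp add: sum_distrib_left mult.left_commute)
  ultimately show "fscale c x \<in> solutions J I M" by (auto simp: solutions_def supported_on_def)
qed (auto simp: solutions_def supported_on_def algebra_simps sum.distrib)

lemma fdim_solutions_le:
  fixes M :: "'i \<Rightarrow> 'j \<Rightarrow> real"
  assumes "finite J"
  shows "fdim (solutions J I M) \<le> fdim (supported_on J)"
proof -
  define L where "L x i = (if i \<in> I then \<Sum>j\<in>J. M i j * x j else 0)" for x :: "'j \<Rightarrow> real" and i
  have "fdim (supported_on J) = fdim (L ` supported_on J) + fdim {x \<in> supported_on J. L x = 0}"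
    using assms
    by (intro fdim_rank_nullity[of _ J] lin_subspace_supported_on)
       (auto simp: L_def fun_eq_iff algebra_simps sum.distrib sum_distrib_left)
  moreover have "{x \<in> supported_on J. L x = 0} = solutions J I M"
    by (auto simp: solutions_def L_def fun_eq_iff)
  ultimately show ?thesis by simp
qed

text \<open>The row operation is cross-multiplied, so polynomial entries stay polynomial. Row
  \<open>p\<close> becomes zero and may remain in the system; it serves to recover the coordinate
  \<open>b\<close> of a solution.\<close>

lemma fdim_solutions_eliminate:
  fixes M :: "'i \<Rightarrow> 'j \<Rightarrow> real"
  assumes "finite J" "b \<in> J" "p \<in> I" and nz: "M p b \<noteq> 0"
  shows "fdim (solutions J I M) = fdim (solutions (J - {b}) I (\<lambda>i j. M p b * M i j - M i b * M p j))"
proof -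
  let ?M' = "\<lambda>i j. M p b * M i j - M i b * M p j"
  let ?L = "\<lambda>x :: 'j \<Rightarrow> real. x(b := 0)"
  have split: "(\<Sum>j\<in>J. M i j * x j) = M i b * x b + (\<Sum>j\<in>J - {b}. M i j * x j)" for i x
    using assms by (simp add: sum.remove)
  have red: "(\<Sum>j\<in>J - {b}. ?M' i j * x j) =
      M p b * (\<Sum>j\<in>J - {b}. M i j * x j) - M i b * (\<Sum>j\<in>J - {b}. M p j * x j)" for i x
    by (simp add: sum_distrib_left sum_subtractf algebra_simps)
  have upd: "(\<Sum>j\<in>J - {b}. N j * (x(b := c)) j) = (\<Sum>j\<in>J - {b}. N j * x j)" for N x and c :: real
    by (intro sum.cong) auto
  have "?L ` solutions J I M = solutions (J - {b}) I ?M'"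
  proof (intro equalityI subsetI)
    fix y assume "y \<in> ?L ` solutions J I M"
    then obtain x where x: "x \<in> solutions J I M" and y: "y = ?L x" by blast
    have eq: "(\<Sum>j\<in>J - {b}. M i j * x j) = - M i b * x b" if "i \<in> I" for i
      using x that split[of i x] by (auto simp: solutions_def)
    have "(\<Sum>j\<in>J - {b}. ?M' i j * y j) = 0" if "i \<in> I" for i
      unfolding y upd red eq[OF that] eq[OF assms(3)] by (simp add: algebra_simps)
    moreover have "y \<in> supported_on (J - {b})" using x by (auto simp: y solutions_def supported_on_def)
    ultimately show "y \<in> solutions (J - {b}) I ?M'" by (simp add: solutions_def)
  next
    fix y assume y: "y \<in> solutions (J - {b}) I ?M'"
    \<comment> \<open>The coordinate at \<open>b\<close> is solved from row
      \<open>p\<close>.\<close>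
    define x where "x = y(b := - (\<Sum>j\<in>J - {b}. M p j * y j) / M p b)"
    have "(\<Sum>j\<in>J. M i j * x j) = 0" if "i \<in> I" for i
    proof -
      have "M p b * (\<Sum>j\<in>J - {b}. M i j * y j) - M i b * (\<Sum>j\<in>J - {b}. M p j * y j) = 0"
        using y that unfolding red[symmetric] by (simp add: solutions_def)
      then show ?thesis unfolding split x_def upd using nz by (simp add: field_simps)
    qed
    then have "x \<in> solutions J I M" using y assms(2) by (auto simp: solutions_def supported_on_def x_def)
    moreover have "y = ?L x" using y by (auto simp: x_def solutions_def supported_on_def)
    ultimately show "y \<in> ?L ` solutions J I M" by blast
  qed
  moreover have "fdim (?L ` solutions J I M) = fdim (solutions J I M)"
  proof (rule fdim_iso[OF lin_subspace_solutions assms(1)])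
    show "solutions J I M \<subseteq> supported_on J" by (auto simp: solutions_def)
    show "?L (x + y) = ?L x + ?L y" "?L (fscale c x) = fscale c (?L x)" for c x y
      by (auto simp: fun_eq_iff)
    fix x assume x: "x \<in> solutions J I M" "?L x = 0"
    then have x0: "x j = 0" if "j \<noteq> b" for j using that by (metis fun_upd_apply zero_fun_apply)
    have "M p b * x b + (\<Sum>j\<in>J - {b}. M p j * x j) = 0"
      using x assms(3) unfolding split[symmetric] by (simp add: solutions_def)
    moreover have "(\<Sum>j\<in>J - {b}. M p j * x j) = 0" using x0 by (intro sum.neutral) auto
    ultimately have "x b = 0" using nz by simp
    then have "x k = 0" for k using x0 by (cases "k = b") auto
    then show "x = 0" by (simp add: fun_eq_iff)
  qed
  ultimately show ?thesis by simp
qed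

text \<open>Gaussian elimination with polynomial pivots: \<open>F\<close> is the product of the pivots that are nonzero
  at \<open>g\<^sub>0\<close>.\<close>

theorem generic_fdim_solutions:
  fixes M :: "'i \<Rightarrow> 'j \<Rightarrow> 'g \<Rightarrow> real"
  assumes "finite J" and "\<And>i j. i \<in> I \<Longrightarrow> j \<in> J \<Longrightarrow> M i j \<in> polyfun X"
  shows "\<exists>F\<in>polyfun X. F g0 \<noteq> 0 \<and> (\<forall>g. F g \<noteq> 0 \<longrightarrow>
    fdim (solutions J I (\<lambda>i j. M i j g)) \<le> fdim (solutions J I (\<lambda>i j. M i j g0)))"
  using assms
proof (induction "card J" arbitrary: J M rule: less_induct)
  case less
  show ?case
  proof (cases "\<forall>i\<in>I. \<forall>j\<in>J. M i j g0 = 0")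
    case True
    \<comment> \<open>No pivot at \<open>g0\<close>: the solution space there is already the largest
      possible, so the bound holds everywhere with F = 1.\<close>
    then have "solutions J I (\<lambda>i j. M i j g0) = supported_on J" by (auto simp: solutions_def)
    then show ?thesis
      using fdim_solutions_le[OF less.prems(1)]
      by (intro bexI[of _ "\<lambda>_. 1"]) (auto simp: polyfun_const)
  next
    case False
    then obtain p b where pb: "p \<in> I" "b \<in> J" "M p b g0 \<noteq> 0" by blast
    define M' where "M' i j g = M p b g * M i j g - M i b g * M p j g" for i j g
    have "card (J - {b}) < card J" by (rule card_Diff1_less[OF less.prems(1) pb(2)])
    moreover have "M' i j \<in> polyfun X" if "i \<in> I" "j \<in> J - {b}" for i j
      using less.prems(2) that pb unfolding M'_def[abs_def] by (intro polyfun_diff polyfun_mult) auto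
    ultimately obtain F where F: "F \<in> polyfun X" "F g0 \<noteq> 0"
      "\<And>g. F g \<noteq> 0 \<Longrightarrow> fdim (solutions (J - {b}) I (\<lambda>i j. M' i j g)) \<le>
        fdim (solutions (J - {b}) I (\<lambda>i j. M' i j g0))"
      using less.hyps[of "J - {b}" M'] less.prems(1) by blast
    \<comment> \<open>The same pivot is used at every \<open>g\<close> where it does not vanish, so
      the reduced systems at \<open>g\<close> and at \<open>g0\<close> stay comparable.\<close>
    have elim: "fdim (solutions J I (\<lambda>i j. M i j g)) = fdim (solutions (J - {b}) I (\<lambda>i j. M' i j g))"
      if "M p b g \<noteq> 0" for g
      using fdim_solutions_eliminate[of J b p I "\<lambda>i j. M i j g"] that pb less.prems(1) by (simp add: M'_def)
    show ?thesis
    proof (intro bexI[of _ "\<lambda>g. M p b g * F g"] conjI allI impI)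
      show "(\<lambda>g. M p b g * F g) \<in> polyfun X" using less.prems(2) pb F(1) by (intro polyfun_mult) auto
      show "M p b g0 * F g0 \<noteq> 0" using pb F by simp
      show "fdim (solutions J I (\<lambda>i j. M i j g)) \<le> fdim (solutions J I (\<lambda>i j. M i j g0))"
        if "M p b g * F g \<noteq> 0" for g
        using that F(3)[of g] pb(3) by (simp add: elim)
    qed
  qed
qed


section \<open>Cohomology of the motion sheaf\<close>

lemma restrict_eq_iff: "restrict f A = restrict g A \<longleftrightarrow> (\<forall>a\<in>A. f a = g a)"
  by (metis restrict_apply restrict_ext)

lemma lin_onto_restrict:
  assumes "lin_onto sc D \<pi> M" "lin_subspace sc D'" "D' \<subseteq> D" "C = \<pi> ` D'"
  shows "lin_onto sc D' \<pi> (M\<lparr>carrier := C\<rparr>)"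
proof -
  have "x \<in> D" if "x \<in> D'" for x using that assms(3) by blast
  then show ?thesis using assms(1,2,4) by (simp add: lin_onto_def)
qed

text \<open>A coset of \<open>W\<close> in \<open>M\<close> is the image of a coset of
  \<open>Dw\<close> in \<open>D\<close>, so all operations on cosets are computed in
  \<open>D\<close>, where \<pi> is linear.\<close>

lemma lin_onto_quot:
  assumes M: "lin_onto sc D \<pi> M" and Dw: "lin_subspace sc Dw" "Dw \<subseteq> D" and W: "W = \<pi> ` Dw"
  shows "lin_onto sc D (\<lambda>x. W +>\<^bsub>M\<^esub> \<pi> x) (quot_module M W)"
    and "x \<in> D \<Longrightarrow> W +>\<^bsub>M\<^esub> \<pi> x = \<zero>\<^bsub>quot_module M W\<^esub> \<longleftrightarrow> \<pi> x \<in> W"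
proof -
  interpret vector_space sc by (rule lin_ontoD(1)[OF M])
  note D = lin_subspaceD[OF lin_ontoD(2)[OF M]] and Dw' = lin_subspaceD[OF Dw(1)]
  have in_D: "w \<in> D" if "w \<in> Dw" for w using that Dw(2) by blast
  note add = lin_ontoD(4)[OF M, symmetric] and sc = lin_ontoD(5)[OF M, symmetric]
  define P where "P x = (\<lambda>w. \<pi> (w + x)) ` Dw" for x
  have coset: "W +>\<^bsub>M\<^esub> \<pi> x = P x" if "x \<in> D" for x
    unfolding a_r_coset_def' W P_def using that in_D by (auto simp: add)
  have P_add: "P x <+>\<^bsub>M\<^esub> P y = P (x + y)" if "x \<in> D" "y \<in> D" for x y
  proof -
    have "\<pi> (w + x) \<oplus>\<^bsub>M\<^esub> \<pi> (w' + y) = \<pi> ((w + w') + (x + y))" if "w \<in> Dw" "w' \<in> Dw" for w w'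
      using that \<open>x \<in> D\<close> \<open>y \<in> D\<close> in_D D(2) by (simp add: add algebra_simps)
    then have "P x <+>\<^bsub>M\<^esub> P y = (\<lambda>(w, w'). \<pi> ((w + w') + (x + y))) ` (Dw \<times> Dw)"
      unfolding set_add_def' P_def by force
    also have "\<dots> = (\<lambda>w. \<pi> (w + (x + y))) ` (\<lambda>(w, w'). w + w') ` (Dw \<times> Dw)"
      by (simp add: image_image split_def)
    also have "(\<lambda>(w, w'). w + w') ` (Dw \<times> Dw) = Dw" using Dw'(1,2) by force
    finally show ?thesis by (simp add: P_def)
  qed
  have P_0: "P 0 = W" by (simp add: P_def W)
  have P_scale: "W <+>\<^bsub>M\<^esub> (\<lambda>a. c \<odot>\<^bsub>M\<^esub> a) ` P x = P (sc c x)" if "x \<in> D" for c x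
  proof -
    have "\<pi> w \<oplus>\<^bsub>M\<^esub> c \<odot>\<^bsub>M\<^esub> \<pi> (w' + x) = \<pi> ((w + sc c w') + sc c x)" if "w \<in> Dw" "w' \<in> Dw" for w w'
      using that \<open>x \<in> D\<close> in_D D(2,3) by (simp add: add sc scale_right_distrib add.assoc)
    then have "W <+>\<^bsub>M\<^esub> (\<lambda>a. c \<odot>\<^bsub>M\<^esub> a) ` P x = (\<lambda>(w, w'). \<pi> ((w + sc c w') + sc c x)) ` (Dw \<times> Dw)"
      unfolding set_add_def' P_def W by force
    also have "\<dots> = (\<lambda>w. \<pi> (w + sc c x)) ` (\<lambda>(w, w'). w + sc c w') ` (Dw \<times> Dw)"
      by (simp add: image_image split_def)
    \<comment> \<open>The summand \<open>W\<close> in the scalar multiple supplies w; with w' = 0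
      every element of \<open>Dw\<close> is reached, also for c = 0.\<close>
    also have "(\<lambda>(w, w'). w + sc c w') ` (Dw \<times> Dw) = Dw"
    proof -
      have "w \<in> (\<lambda>(w, w'). w + sc c w') ` (Dw \<times> Dw)" if "w \<in> Dw" for w
        using that Dw'(1) by (intro image_eqI[where x = "(w, 0)"]) auto
      then show ?thesis using Dw'(2,3) by auto
    qed
    finally show ?thesis by (simp add: P_def)
  qed
  show "lin_onto sc D (\<lambda>x. W +>\<^bsub>M\<^esub> \<pi> x) (quot_module M W)"
    unfolding lin_onto_def
  proof (intro conjI ballI allI)
    show "vector_space sc" by (rule lin_ontoD(1)[OF M])
    show "lin_subspace sc D" by (rule lin_ontoD(2)[OF M])
    show "carrier (quot_module M W) = (\<lambda>x. W +>\<^bsub>M\<^esub> \<pi> x) ` D"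
      by (auto simp: quot_module_def A_RCOSETS_def' lin_ontoD(3)[OF M])
    fix x y assume xy: "x \<in> D" "y \<in> D"
    then show "W +>\<^bsub>M\<^esub> \<pi> (x + y) = (W +>\<^bsub>M\<^esub> \<pi> x) \<oplus>\<^bsub>quot_module M W\<^esub> (W +>\<^bsub>M\<^esub> \<pi> y)"
      by (simp add: quot_module_def coset P_add D(2))
  next
    fix c x assume "x \<in> D"
    then show "W +>\<^bsub>M\<^esub> \<pi> (sc c x) = c \<odot>\<^bsub>quot_module M W\<^esub> (W +>\<^bsub>M\<^esub> \<pi> x)"
      by (simp add: quot_module_def coset P_scale D(3))
  next
    show "\<zero>\<^bsub>quot_module M W\<^esub> = W +>\<^bsub>M\<^esub> \<pi> 0" using D(1) by (simp add: quot_module_def coset P_0)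
  qed
  show "W +>\<^bsub>M\<^esub> \<pi> x = \<zero>\<^bsub>quot_module M W\<^esub> \<longleftrightarrow> \<pi> x \<in> W" if x: "x \<in> D"
  proof
    assume "W +>\<^bsub>M\<^esub> \<pi> x = \<zero>\<^bsub>quot_module M W\<^esub>"
    then have "P x = W" using x by (simp add: quot_module_def coset)
    moreover have "\<pi> (0 + x) \<in> P x" unfolding P_def using Dw'(1) by blast
    ultimately show "\<pi> x \<in> W" by simp
  next
    assume "\<pi> x \<in> W"
    then obtain d where d: "d \<in> Dw" "\<pi> x = \<pi> d" by (auto simp: W)
    have "\<pi> (w + x) = \<pi> (w + d)" if "w \<in> Dw" for w
      using that x d in_D by (simp flip: add)
    then have "P x = (\<lambda>w. \<pi> (w + d)) ` Dw" by (simp add: P_def)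
    also have "\<dots> = \<pi> ` (\<lambda>w. w + d) ` Dw" by (simp add: image_image)
    also have "(\<lambda>w. w + d) ` Dw = Dw"
    proof -
      have "w \<in> (\<lambda>w. w + d) ` Dw" if "w \<in> Dw" for w
        using Dw'(2)[OF that Dw'(3)[OF d(1), of "- 1"]]
        by (intro image_eqI[where x = "w + sc (- 1) d"]) auto
      then show ?thesis using Dw'(2) d(1) by auto
    qed
    finally have "P x = W" by (simp add: W)
    then show "W +>\<^bsub>M\<^esub> \<pi> x = \<zero>\<^bsub>quot_module M W\<^esub>" using x by (simp add: quot_module_def coset)
  qed
qed

text \<open>The presenting space is not literally a product: \<open>e i\<close> reads off the i-th
  component, and \<open>surj\<close> says that the components can be prescribed
  independently.\<close>

lemma lin_onto_prod:
  assumes M: "\<And>i. i \<in> I \<Longrightarrow> lin_onto sc (D i) (\<pi> i) (M i)"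
    and D': "lin_subspace sc' D'" "vector_space sc'"
    and e: "\<And>i x. i \<in> I \<Longrightarrow> x \<in> D' \<Longrightarrow> e i x \<in> D i" "\<And>i x y. e i (x + y) = e i x + e i y"
      "\<And>i c x. e i (sc' c x) = sc c (e i x)"
    and surj: "\<And>y. (\<And>i. i \<in> I \<Longrightarrow> y i \<in> D i) \<Longrightarrow> \<exists>x\<in>D'. \<forall>i\<in>I. e i x = y i"
  shows "lin_onto sc' D' (\<lambda>x. \<lambda>i\<in>I. \<pi> i (e i x)) (prod_module I M)"
proof -
  have e0: "e i 0 = 0" for i using e(2)[of i 0 0] by simp
  have "(\<Pi>\<^sub>E i\<in>I. carrier (M i)) = (\<lambda>x. \<lambda>i\<in>I. \<pi> i (e i x)) ` D'"
  proof (intro equalityI subsetI)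
    fix f assume f: "f \<in> (\<Pi>\<^sub>E i\<in>I. carrier (M i))"
    then have "\<forall>i\<in>I. \<exists>y. y \<in> D i \<and> f i = \<pi> i y" using lin_ontoD(3)[OF M] by fastforce
    then obtain y where y: "\<And>i. i \<in> I \<Longrightarrow> y i \<in> D i" "\<And>i. i \<in> I \<Longrightarrow> f i = \<pi> i (y i)" by metis
    obtain x where x: "x \<in> D'" "\<forall>i\<in>I. e i x = y i" using surj[OF y(1)] by blast
    have "f = (\<lambda>i\<in>I. \<pi> i (e i x))"
      using f y(2) x(2) by (intro ext) (auto simp: restrict_def PiE_def extensional_def)
    then show "f \<in> (\<lambda>x. \<lambda>i\<in>I. \<pi> i (e i x)) ` D'" using x(1) by blast
  qed (use lin_ontoD(3)[OF M] e(1) in auto)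
  then show ?thesis
    using D' lin_ontoD(4-6)[OF M] e
    by (auto simp: lin_onto_def prod_module_def e0 fun_eq_iff restrict_def)
qed

lemma lin_onto_lie_quotient:
  assumes "Real_Vector_Spaces.subspace (lie_algebra G)" "Real_Vector_Spaces.subspace (lie_algebra K)"
    "lie_algebra K \<subseteq> lie_algebra G"
  shows "lin_onto scaleR (lie_algebra G) (\<lambda>x. lie_algebra K +>\<^bsub>subspace_module (lie_algebra G)\<^esub> x) (lie_quotient G K)"
    and "x \<in> lie_algebra G \<Longrightarrow>
      lie_algebra K +>\<^bsub>subspace_module (lie_algebra G)\<^esub> x = \<zero>\<^bsub>lie_quotient G K\<^esub> \<longleftrightarrow> x \<in> lie_algebra K"
proof -
  have lin: "lin_subspace scaleR S" if "Real_Vector_Spaces.subspace S" for S :: "(real^'n^'n) set"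
    using that by (auto simp: lin_subspace_def real_vector.subspace_def)
  have "lin_onto scaleR (lie_algebra G) (\<lambda>x. x) (subspace_module (lie_algebra G))"
    using lin[OF assms(1)] real_vector.vector_space_axioms by (simp add: lin_onto_def subspace_module_def)
  from lin_onto_quot[OF this lin[OF assms(2)] assms(3), of "lie_algebra K"]
  show "lin_onto scaleR (lie_algebra G) (\<lambda>x. lie_algebra K +>\<^bsub>subspace_module (lie_algebra G)\<^esub> x) (lie_quotient G K)"
    and "x \<in> lie_algebra G \<Longrightarrow>
      lie_algebra K +>\<^bsub>subspace_module (lie_algebra G)\<^esub> x = \<zero>\<^bsub>lie_quotient G K\<^esub> \<longleftrightarrow> x \<in> lie_algebra K"
    by (simp_all add: lie_quotient_def)
qed

text \<open>A family of vectors in the span of \<open>B\<close> is represented by its coordinates, a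
  real function on pairs of an index and an element of \<open>B\<close>.\<close>

definition hat :: "'b::real_vector set \<Rightarrow> ('i \<times> 'b \<Rightarrow> real) \<Rightarrow> 'i \<Rightarrow> 'b" where
  "hat B z i = (\<Sum>b\<in>B. z (i, b) *\<^sub>R b)"

lemma hat_add: "hat B (x + y) i = hat B x i + hat B y i"
  and hat_scale: "hat B (fscale c x) i = c *\<^sub>R hat B x i"
  by (simp_all add: hat_def scaleR_left_distrib sum.distrib scaleR_right.sum)

lemma hat_diff: "hat B (x - y) i = hat B x i - hat B y i"
  by (simp add: hat_def scaleR_left_diff_distrib sum_subtractf)

lemma hat_in_span: "hat B x i \<in> span B"
  unfolding hat_def by (intro span_sum span_scale span_base)

lemma hat_surj:
  assumes "finite B" "\<And>i. i \<in> K \<Longrightarrow> y i \<in> span B"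
  shows "\<exists>x\<in>supported_on (K \<times> B). \<forall>i\<in>K. hat B x i = y i"
proof -
  have "\<forall>i. \<exists>u. i \<in> K \<longrightarrow> y i = (\<Sum>b\<in>B. u b *\<^sub>R b)"
    using assms(2) unfolding span_finite[OF assms(1)] by blast
  then obtain u where u: "\<And>i. i \<in> K \<Longrightarrow> y i = (\<Sum>b\<in>B. u i b *\<^sub>R b)" by metis
  define x where "x j = (if j \<in> K \<times> B then u (fst j) (snd j) else 0)" for j
  have "hat B x i = y i" if "i \<in> K" for i
    unfolding hat_def u[OF that] using that by (intro sum.cong) (auto simp: x_def)
  then show ?thesis by (intro bexI[of _ x]) (auto simp: x_def supported_on_def)
qed

text \<open>The linear conditions \<open>\<Sum>\<^sub>i l i \<cdot> hat x i \<in> h v\<close> for \<open>(v, l) \<in> C\<close> on a vector \<open>x\<close>, which stands for the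
  family of elements \<open>hat x i\<close> of the span of \<open>B\<close>.\<close>

definition incidence_system ::
  "'i set \<Rightarrow> 'b::real_vector set \<Rightarrow> ('v \<times> ('i \<Rightarrow> real)) set \<Rightarrow> ('v \<Rightarrow> 'b set) \<Rightarrow> ('i \<times> 'b \<Rightarrow> real) set" where
  "incidence_system K B C h =
     {x \<in> supported_on (K \<times> B). \<forall>(v, l)\<in>C. (\<Sum>i\<in>K. l i *\<^sub>R hat B x i) \<in> h v}"

lemma lin_subspace_incidence_system:
  fixes K :: "'i set" and B :: "'b::real_vector set"
  assumes "\<And>v l. (v, l) \<in> C \<Longrightarrow> Real_Vector_Spaces.subspace (h v)"
  shows "lin_subspace fscale (incidence_system K B C h)"
proof (rule lin_subspaceI)
  have "hat B 0 i = 0" for i :: 'i by (simp add: hat_def)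
  moreover have "0 \<in> h v" if "(v, l) \<in> C" for v l by (rule real_vector.subspace_0[OF assms[OF that]])
  ultimately show "0 \<in> incidence_system K B C h"
    by (auto simp: incidence_system_def supported_on_def)
next
  fix x y assume xy: "x \<in> incidence_system K B C h" "y \<in> incidence_system K B C h"
  have "(\<Sum>i\<in>K. l i *\<^sub>R hat B (x + y) i) \<in> h v" if vl: "(v, l) \<in> C" for v l
  proof -
    have "(\<Sum>i\<in>K. l i *\<^sub>R hat B x i) + (\<Sum>i\<in>K. l i *\<^sub>R hat B y i) \<in> h v"
      using xy vl by (intro real_vector.subspace_add[OF assms[OF vl]]) (auto simp: incidence_system_def)
    then show ?thesis by (simp add: hat_add scaleR_right_distrib sum.distrib)
  qed
  then show "x + y \<in> incidence_system K B C h"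
    using xy by (auto simp: incidence_system_def supported_on_def)
next
  fix c x assume x: "x \<in> incidence_system K B C h"
  have "(\<Sum>i\<in>K. l i *\<^sub>R hat B (fscale c x) i) \<in> h v" if vl: "(v, l) \<in> C" for v l
  proof -
    have "c *\<^sub>R (\<Sum>i\<in>K. l i *\<^sub>R hat B x i) \<in> h v"
      using x vl by (intro real_vector.subspace_scale[OF assms[OF vl]]) (auto simp: incidence_system_def)
    then show ?thesis by (simp add: hat_scale scaleR_right.sum mult.commute)
  qed
  then show "fscale c x \<in> incidence_system K B C h"
    using x by (auto simp: incidence_system_def supported_on_def)
qed

section \<open>Index sets and linear conditions for the motion sheaf\<close>

definition arcs :: "'v set \<Rightarrow> 'v set set \<Rightarrow> ('v \<times> 'v set) set" where
  "arcs V E = {(v, e). v \<in> V \<and> e \<in> E \<and> v \<in> e}"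

definition vert_index :: "'v set \<Rightarrow> 'v set set \<Rightarrow> (('v + 'v set) + ('v \<times> 'v set)) set" where
  "vert_index V E = Inl ` (Inl ` V \<union> Inr ` E)"

definition arc_index :: "'v set \<Rightarrow> 'v set set \<Rightarrow> (('v + 'v set) + ('v \<times> 'v set)) set" where
  "arc_index V E = Inr ` arcs V E"

text \<open>The form y_a - (d x)_a, where x has the indices \<open>Inl\<close> and y the indices
  \<open>Inr\<close>. On vertex indices alone it is -(d x)_a, so one form serves for cocycles and
  for lifts of coboundaries.\<close>

definition arc_form :: "('v + 'v set \<Rightarrow> 'v \<times> 'v set \<Rightarrow> real) \<Rightarrow> 'v \<times> 'v set \<Rightarrow>
    ('v + 'v set) + ('v \<times> 'v set) \<Rightarrow> real" where
  "arc_form s a i = (if i = Inr a then 1 else if i = Inl (Inl (fst a)) then - s (Inl (fst a)) a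
     else if i = Inl (Inr (snd a)) then - s (Inr (snd a)) a else 0)"

definition arc_conditions ::
  "'v set \<Rightarrow> 'v set set \<Rightarrow> ('v + 'v set \<Rightarrow> 'v \<times> 'v set \<Rightarrow> real) \<Rightarrow> ('v \<times> (('v + 'v set) + ('v \<times> 'v set) \<Rightarrow> real)) set" where
  "arc_conditions V E s = (\<lambda>a. (fst a, arc_form s a)) ` arcs V E"

text \<open>A value at a hyperedge e has to lie in the Lie algebra at each v in e, which replaces
  the intersection. An empty hyperedge imposes nothing, in accordance with its Lie algebra being all
  of Lie(G).\<close>

definition stalk_conditions ::
  "'v set \<Rightarrow> 'v set set \<Rightarrow> ('v \<times> (('v + 'v set) + ('v \<times> 'v set) \<Rightarrow> real)) set" where
  "stalk_conditions V E = (\<lambda>v. (v, \<lambda>i. if i = Inl (Inl v) then 1 else 0)) ` V \<union>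
     (\<lambda>(v, e). (v, \<lambda>i. if i = Inl (Inr e) then 1 else 0)) ` arcs V E"

text \<open>The groups enter only through their Lie algebras. The edge stalk is an intersection
  taken inside the Lie algebra of \<open>G\<close>, which gives the right value on the empty
  hyperedge.\<close>

locale motion =
  fixes V :: "'v set" and E :: "'v set set" and G :: "(real^'n^'n) set"
    and \<rho> :: "'v + 'v set \<Rightarrow> (real^'n^'n) set" and s :: "'v + 'v set \<Rightarrow> 'v \<times> 'v set \<Rightarrow> real"
    and B :: "(real^'n^'n) set"
  assumes finite_V: "finite V" and edges_subset: "E \<subseteq> Pow V"
    and finite_B: "finite B" and span_B: "span B = lie_algebra G"
    and vertex_stalk: "\<And>v. v \<in> V \<Longrightarrow> Real_Vector_Spaces.subspace (lie_algebra (\<rho> (Inl v)))"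
      "\<And>v. v \<in> V \<Longrightarrow> lie_algebra (\<rho> (Inl v)) \<subseteq> lie_algebra G"
    and edge_stalk: "\<And>e. e \<in> E \<Longrightarrow>
      lie_algebra (\<rho> (Inr e)) = {X \<in> lie_algebra G. \<forall>v\<in>e. X \<in> lie_algebra (\<rho> (Inl v))}"
begin

abbreviation "\<g> \<equiv> lie_algebra G"
abbreviation "h v \<equiv> lie_algebra (\<rho> (Inl v))"
abbreviation "\<Gamma> \<equiv> incidence_graph V E"
abbreviation "\<M> \<equiv> motion_sheaf G \<rho>"
abbreviation "coset u X \<equiv> lie_algebra (\<rho> u) +>\<^bsub>subspace_module (lie_algebra G)\<^esub> X"

lemma finite_index: "finite (arcs V E)" "finite (vert_index V E)" "finite (arc_index V E)"
proof -
  have "finite E" using finite_V edges_subset finite_subset finite_Pow_iff by metis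
  moreover have "arcs V E \<subseteq> V \<times> E" by (auto simp: arcs_def)
  ultimately show "finite (arcs V E)" using finite_V finite_subset by blast
  then show "finite (vert_index V E)" "finite (arc_index V E)"
    using finite_V \<open>finite E\<close> by (auto simp: vert_index_def arc_index_def)
qed

lemma subspace_g: "Real_Vector_Spaces.subspace \<g>"
  using subspace_span[of B] by (simp add: span_B)

lemma stalk:
  assumes "u \<in> Inl ` V \<union> Inr ` E"
  shows "Real_Vector_Spaces.subspace (lie_algebra (\<rho> u))" "lie_algebra (\<rho> u) \<subseteq> \<g>"
proof -
  have "Real_Vector_Spaces.subspace {X \<in> \<g>. \<forall>v\<in>e. X \<in> h v}" if "e \<in> E" for e
  proof (rule real_vector.subspaceI)
    have *: "Real_Vector_Spaces.subspace (h v)" if "v \<in> e" for v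
      using that \<open>e \<in> E\<close> edges_subset by (intro vertex_stalk) auto
    show "0 \<in> {X \<in> \<g>. \<forall>v\<in>e. X \<in> h v}"
      using * subspace_g by (auto simp: real_vector.subspace_0)
    show "X + Y \<in> {X \<in> \<g>. \<forall>v\<in>e. X \<in> h v}"
      if "X \<in> {X \<in> \<g>. \<forall>v\<in>e. X \<in> h v}" "Y \<in> {X \<in> \<g>. \<forall>v\<in>e. X \<in> h v}" for X Y
      using that * subspace_g by (auto simp: real_vector.subspace_add)
    show "c *\<^sub>R X \<in> {X \<in> \<g>. \<forall>v\<in>e. X \<in> h v}" if "X \<in> {X \<in> \<g>. \<forall>v\<in>e. X \<in> h v}" for c X
      using that * subspace_g by (auto simp: real_vector.subspace_scale)
  qed
  then show "Real_Vector_Spaces.subspace (lie_algebra (\<rho> u))" "lie_algebra (\<rho> u) \<subseteq> \<g>"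
    using assms vertex_stalk edge_stalk by auto
qed

lemma lin_onto_stalk:
  assumes "u \<in> Inl ` V \<union> Inr ` E"
  shows "lin_onto scaleR \<g> (coset u) (lie_quotient G (\<rho> u))"
    and "X \<in> \<g> \<Longrightarrow> coset u X = \<zero>\<^bsub>lie_quotient G (\<rho> u)\<^esub> \<longleftrightarrow> X \<in> lie_algebra (\<rho> u)"
  using lin_onto_lie_quotient[OF subspace_g stalk[OF assms]] by blast+

lemma coset_eq_iff:
  assumes u: "u \<in> Inl ` V \<union> Inr ` E" and XY: "X \<in> \<g>" "Y \<in> \<g>"
  shows "coset u X = coset u Y \<longleftrightarrow> X - Y \<in> lie_algebra (\<rho> u)"
proof -
  note lin = lin_ontoD[OF lin_onto_stalk(1)[OF u]]
  interpret Q: vectorspace real_scalars "lie_quotient G (\<rho> u)"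
    by (rule lin_onto_vectorspace[OF lin_onto_stalk(1)[OF u]])
  have D: "X - Y \<in> \<g>" by (rule real_vector.subspace_diff[OF subspace_g XY])
  have car: "coset u Z \<in> carrier (lie_quotient G (\<rho> u))" if "Z \<in> \<g>" for Z using that lin(3) by simp
  have "coset u X = coset u (X - Y) \<oplus>\<^bsub>lie_quotient G (\<rho> u)\<^esub> coset u Y"
    using lin(4)[OF D XY(2)] by simp
  then have "coset u X = coset u Y \<longleftrightarrow> coset u (X - Y) = \<zero>\<^bsub>lie_quotient G (\<rho> u)\<^esub>"
    using Q.add.r_cancel_one'[OF car[OF XY(2)] car[OF D]] by (metis Q.add.r_cancel_one[OF car[OF XY(2)] car[OF D]])
  then show ?thesis using lin_onto_stalk(2)[OF u D] by simp
qed

text \<open>\<open>D0\<close> and \<open>D1\<close> are the coordinates of 0- and 1-cochains with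
  values in \<open>\<g>\<close>, before the reduction modulo the stalks by \<open>pr0\<close> and
  \<open>pr1\<close>. They do not change with \<rho>.\<close>

definition "D0 = supported_on (vert_index V E \<times> B)"
definition "D1 = supported_on (arc_index V E \<times> B)"
definition "pr0 x = (\<lambda>u\<in>Inl ` V \<union> Inr ` E. coset u (hat B x (Inl u)))"
definition "pr1 x = (\<lambda>a\<in>arcs V E. coset (Inl (fst a)) (hat B x (Inr a)))"

lemma hat_mem: "hat B x i \<in> \<g>"
  using hat_in_span[of B x i] by (simp add: span_B)

lemma lin_onto_cochains0: "lin_onto fscale D0 pr0 (cochains0 \<Gamma> \<M>)"
proof -
  have surj: "\<exists>x\<in>D0. \<forall>u\<in>Inl ` V \<union> Inr ` E. hat B x (Inl u) = y u"
    if y: "\<And>u. u \<in> Inl ` V \<union> Inr ` E \<Longrightarrow> y u \<in> \<g>" for y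
  proof -
    have "case_sum y (\<lambda>_. 0) i \<in> span B" if "i \<in> vert_index V E" for i
      using that y by (auto simp: vert_index_def span_B)
    from hat_surj[OF finite_B, of "vert_index V E" "case_sum y (\<lambda>_. 0)", OF this]
    show ?thesis by (auto simp: D0_def vert_index_def)
  qed
  have "lin_onto fscale D0 pr0 (prod_module (Inl ` V \<union> Inr ` E) (\<lambda>u. lie_quotient G (\<rho> u)))"
    unfolding pr0_def[abs_def]
  proof (rule lin_onto_prod[where D = "\<lambda>_. \<g>" and sc = scaleR])
    show "lin_onto scaleR \<g> (coset i) (lie_quotient G (\<rho> i))" if "i \<in> Inl ` V \<union> Inr ` E" for i
      by (rule lin_onto_stalk(1)) (use that in \<open>simp\<close>)
    show "\<exists>x\<in>D0. \<forall>i\<in>Inl ` V \<union> Inr ` E. hat B x (Inl i) = y i"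
      if "\<And>i. i \<in> Inl ` V \<union> Inr ` E \<Longrightarrow> y i \<in> \<g>" for y by (rule surj[OF that])
    show "lin_subspace fscale D0" unfolding D0_def by (rule lin_subspace_supported_on)
  qed (rule hat_mem hat_add hat_scale vector_space_fscale)+
  then show ?thesis by (simp add: cochains0_def motion_sheaf_def incidence_graph_def)
qed

lemma lin_onto_cochains1: "lin_onto fscale D1 pr1 (cochains1 \<Gamma> \<M>)"
proof -
  have surj: "\<exists>x\<in>D1. \<forall>a\<in>arcs V E. hat B x (Inr a) = y a"
    if y: "\<And>a. a \<in> arcs V E \<Longrightarrow> y a \<in> \<g>" for y
  proof -
    have "case_sum (\<lambda>_. 0) y i \<in> span B" if "i \<in> arc_index V E" for i
      using that y by (auto simp: arc_index_def span_B)
    from hat_surj[OF finite_B, of "arc_index V E" "case_sum (\<lambda>_. 0) y", OF this]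
    show ?thesis by (auto simp: D1_def arc_index_def)
  qed
  have "lin_onto fscale D1 pr1 (prod_module (arcs V E) (\<lambda>a. lie_quotient G (\<rho> (Inl (fst a)))))"
    unfolding pr1_def[abs_def]
  proof (rule lin_onto_prod[where D = "\<lambda>_. \<g>" and sc = scaleR])
    show "lin_onto scaleR \<g> (coset (Inl (fst i))) (lie_quotient G (\<rho> (Inl (fst i))))" if "i \<in> arcs V E" for i
      by (rule lin_onto_stalk(1)) (use that in \<open>auto simp: arcs_def\<close>)
    show "\<exists>x\<in>D1. \<forall>i\<in>arcs V E. hat B x (Inr i) = y i"
      if "\<And>i. i \<in> arcs V E \<Longrightarrow> y i \<in> \<g>" for y by (rule surj[OF that])
    show "lin_subspace fscale D1" unfolding D1_def by (rule lin_subspace_supported_on)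
  qed (rule hat_mem hat_add hat_scale vector_space_fscale)+
  moreover have "estalk \<M> = (\<lambda>a. lie_quotient G (\<rho> (Inl (fst a))))"
    by (auto simp: motion_sheaf_def fun_eq_iff)
  ultimately show ?thesis by (simp add: cochains1_def incidence_graph_def arcs_def)
qed

definition "diff a x = s (Inl (fst a)) a *\<^sub>R hat B x (Inl (Inl (fst a))) +
  s (Inr (snd a)) a *\<^sub>R hat B x (Inl (Inr (snd a)))"

lemma diff_mem: "diff a x \<in> \<g>"
  unfolding diff_def using hat_mem subspace_g
  by (intro real_vector.subspace_add real_vector.subspace_scale) auto

text \<open>The restriction from a hyperedge adds the vertex Lie algebra to a coset of the smaller
  edge Lie algebra, which gives the coset of the same lift. Hence the coboundary may be computed on
  lifts.\<close>

lemma coboundary_pr0: "coboundary \<Gamma> s \<M> (pr0 x) = (\<lambda>a\<in>arcs V E. coset (Inl (fst a)) (diff a x))"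
proof -
  have "finsum (estalk \<M> a) (\<lambda>u. s u a \<odot>\<^bsub>estalk \<M> a\<^esub> restr \<M> u a (pr0 x u)) (ends \<Gamma> a) =
      coset (Inl (fst a)) (diff a x)" if a: "a \<in> arcs V E" for a
  proof -
    obtain v e where ve: "a = (v, e)" "v \<in> V" "e \<in> E" "v \<in> e" using a by (auto simp: arcs_def)
    let ?Q = "lie_quotient G (\<rho> (Inl v))"
    have v: "Inl v \<in> Inl ` V \<union> Inr ` E" and e: "Inr e \<in> Inl ` V \<union> Inr ` E" using ve by auto
    note lin = lin_ontoD[OF lin_onto_stalk(1)[OF v]]
    interpret Q: vectorspace real_scalars ?Q by (rule lin_onto_vectorspace[OF lin_onto_stalk(1)[OF v]])
    have est: "estalk \<M> a = ?Q" and ends: "ends \<Gamma> a = {Inl v, Inr e}"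
      by (simp_all add: motion_sheaf_def incidence_graph_def ve)
    have rv: "restr \<M> (Inl v) a (pr0 x (Inl v)) = coset (Inl v) (hat B x (Inl (Inl v)))"
      using v by (simp add: motion_sheaf_def ve pr0_def)
    have re: "restr \<M> (Inr e) a (pr0 x (Inr e)) = coset (Inl v) (hat B x (Inl (Inr e)))"
    proof -
      let ?X = "hat B x (Inl (Inr e))"
      have sub: "lie_algebra (\<rho> (Inr e)) \<subseteq> h v" using edge_stalk[OF ve(3)] ve(4) by auto
      have he: "0 \<in> lie_algebra (\<rho> (Inr e))" by (rule real_vector.subspace_0[OF stalk(1)[OF e]])
      have "restr \<M> (Inr e) a (pr0 x (Inr e)) =
          (\<Union>p\<in>h v. \<Union>q\<in>(\<Union>r\<in>lie_algebra (\<rho> (Inr e)). {r + ?X}). {p + q})"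
        using e by (simp add: motion_sheaf_def ve pr0_def set_add_def' a_r_coset_def' subspace_module_def)
      also have "\<dots> = (\<Union>p\<in>h v. {p + ?X})"
      proof (intro equalityI subsetI)
        fix Y assume "Y \<in> (\<Union>p\<in>h v. \<Union>q\<in>(\<Union>r\<in>lie_algebra (\<rho> (Inr e)). {r + ?X}). {p + q})"
        then obtain p r where "p \<in> h v" "r \<in> lie_algebra (\<rho> (Inr e))" "Y = (p + r) + ?X"
          by (auto simp: add.assoc)
        then show "Y \<in> (\<Union>p\<in>h v. {p + ?X})" using sub real_vector.subspace_add[OF stalk(1)[OF v]] by auto
      next
        fix Y assume "Y \<in> (\<Union>p\<in>h v. {p + ?X})"
        then show "Y \<in> (\<Union>p\<in>h v. \<Union>q\<in>(\<Union>r\<in>lie_algebra (\<rho> (Inr e)). {r + ?X}). {p + q})"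
          using he by force
      qed
      finally show ?thesis by (simp add: a_r_coset_def' subspace_module_def)
    qed
    define F where "F = (\<lambda>u. s u a \<odot>\<^bsub>?Q\<^esub> restr \<M> u a (pr0 x u))"
    have F: "F (Inl v) = coset (Inl v) (s (Inl v) a *\<^sub>R hat B x (Inl (Inl v)))"
      "F (Inr e) = coset (Inl v) (s (Inr e) a *\<^sub>R hat B x (Inl (Inr e)))"
      using lin(5)[OF hat_mem, symmetric] by (simp_all add: F_def rv re)
    have mem: "s u a *\<^sub>R hat B x i \<in> \<g>" for u i
      by (rule real_vector.subspace_scale[OF subspace_g hat_mem])
    have car: "coset (Inl v) (s u a *\<^sub>R hat B x i) \<in> carrier ?Q" for u i
      unfolding lin(3) using mem by (rule imageI)
    have "finsum ?Q F (insert (Inl v) {Inr e}) = F (Inl v) \<oplus>\<^bsub>?Q\<^esub> finsum ?Q F {Inr e}"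
      using car by (intro Q.finsum_insert) (auto simp: F)
    also have "finsum ?Q F {Inr e} = F (Inr e)"
      using car by (subst Q.finsum_insert) (auto simp: F)
    also have "F (Inl v) \<oplus>\<^bsub>?Q\<^esub> F (Inr e) = coset (Inl v) (diff a x)"
      unfolding F diff_def using lin(4)[OF mem mem] by (simp add: ve)
    finally have *: "finsum ?Q F {Inl v, Inr e} = coset (Inl v) (diff a x)" .
    show ?thesis unfolding est ends using * by (simp add: F_def ve(1))
  qed
  moreover have "edges \<Gamma> = arcs V E" by (simp add: incidence_graph_def arcs_def)
  ultimately show ?thesis unfolding coboundary_def by (auto intro: restrict_ext)
qed

text \<open>\<open>S_sys\<close> consists of the lifts to \<open>\<g>\<close> of the 0-cocycles, \<open>K_sys\<close> of the lifts of the zero 0-cochain, and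
  \<open>R_sys\<close> of the pairs of a lift \<open>x\<close> of a 0-cochain and a lift of its coboundary. The lifts of
  coboundaries are the projection of \<open>R_sys\<close>, with kernel \<open>S_sys\<close>.\<close>

abbreviation "S_sys \<equiv> incidence_system (vert_index V E) B (arc_conditions V E s) h"
abbreviation "R_sys \<equiv> incidence_system (vert_index V E \<union> arc_index V E) B (arc_conditions V E s) h"
abbreviation "K_sys \<equiv> incidence_system (vert_index V E) B (stalk_conditions V E) h"

lemma arc_form_sum:
  assumes "a \<in> arcs V E"
  shows "(\<Sum>i\<in>vert_index V E. arc_form s a i *\<^sub>R hat B x i) = - diff a x"
    and "(\<Sum>i\<in>vert_index V E \<union> arc_index V E. arc_form s a i *\<^sub>R hat B x i) = hat B x (Inr a) - diff a x"
proof -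
  have mem: "Inl (Inl (fst a)) \<in> vert_index V E" "Inl (Inr (snd a)) \<in> vert_index V E" "Inr a \<in> arc_index V E"
    using assms by (auto simp: arcs_def vert_index_def arc_index_def)
  have "(\<Sum>i\<in>vert_index V E. arc_form s a i *\<^sub>R hat B x i) =
      (\<Sum>i\<in>{Inl (Inl (fst a)), Inl (Inr (snd a))}. arc_form s a i *\<^sub>R hat B x i)"
    using mem finite_index by (intro sum.mono_neutral_right) (auto simp: arc_form_def vert_index_def)
  also have "\<dots> = - diff a x" by (simp add: arc_form_def diff_def)
  finally show 1: "(\<Sum>i\<in>vert_index V E. arc_form s a i *\<^sub>R hat B x i) = - diff a x" .
  have "(\<Sum>i\<in>arc_index V E. arc_form s a i *\<^sub>R hat B x i) = (\<Sum>i\<in>{Inr a}. arc_form s a i *\<^sub>R hat B x i)"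
    using mem finite_index by (intro sum.mono_neutral_right) (auto simp: arc_form_def arc_index_def)
  also have "\<dots> = hat B x (Inr a)" by (simp add: arc_form_def)
  finally have "(\<Sum>i\<in>arc_index V E. arc_form s a i *\<^sub>R hat B x i) = hat B x (Inr a)" .
  moreover have "vert_index V E \<inter> arc_index V E = {}" by (auto simp: vert_index_def arc_index_def)
  ultimately show "(\<Sum>i\<in>vert_index V E \<union> arc_index V E. arc_form s a i *\<^sub>R hat B x i) = hat B x (Inr a) - diff a x"
    using finite_index 1 by (simp add: sum.union_disjoint)
qed

lemma arc_mem: "a \<in> arcs V E \<Longrightarrow> fst a \<in> V" "a \<in> arcs V E \<Longrightarrow> Inl (fst a) \<in> Inl ` V \<union> Inr ` E"
  by (auto simp: arcs_def)

lemma S_sys_iff: "x \<in> S_sys \<longleftrightarrow> x \<in> D0 \<and> (\<forall>a\<in>arcs V E. diff a x \<in> h (fst a))"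
proof -
  have "- diff a x \<in> h (fst a) \<longleftrightarrow> diff a x \<in> h (fst a)" if "a \<in> arcs V E" for a
    using real_vector.subspace_neg[OF vertex_stalk(1)[OF arc_mem(1)[OF that]]] by (metis minus_minus)
  then show ?thesis by (auto simp: incidence_system_def arc_conditions_def arc_form_sum D0_def)
qed

lemma R_sys_iff: "x \<in> R_sys \<longleftrightarrow> x \<in> supported_on ((vert_index V E \<union> arc_index V E) \<times> B) \<and>
    (\<forall>a\<in>arcs V E. hat B x (Inr a) - diff a x \<in> h (fst a))"
  by (auto simp: incidence_system_def arc_conditions_def arc_form_sum)

lemma K_sys_iff: "x \<in> K_sys \<longleftrightarrow> x \<in> D0 \<and>
    (\<forall>u\<in>Inl ` V \<union> Inr ` E. hat B x (Inl u) \<in> lie_algebra (\<rho> u))"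
proof -
  have sum: "(\<Sum>i\<in>vert_index V E. (if i = Inl u then 1 else 0) *\<^sub>R hat B x i) = hat B x (Inl u)"
    if "u \<in> Inl ` V \<union> Inr ` E" for u
  proof -
    have "(\<Sum>i\<in>vert_index V E. (if i = Inl u then 1 else 0) *\<^sub>R hat B x i) =
        (\<Sum>i\<in>vert_index V E. if i = Inl u then hat B x i else 0)" by (intro sum.cong) auto
    then show ?thesis using that finite_index(2) by (simp add: sum.delta vert_index_def)
  qed
  have edge: "hat B x (Inl (Inr e)) \<in> lie_algebra (\<rho> (Inr e)) \<longleftrightarrow>
      (\<forall>v. (v, e) \<in> arcs V E \<longrightarrow> hat B x (Inl (Inr e)) \<in> h v)" if "e \<in> E" for e
  proof -
    have "e \<subseteq> V" using that edges_subset by blast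
    then show ?thesis using that hat_mem by (auto simp: edge_stalk arcs_def)
  qed
  have "x \<in> K_sys \<longleftrightarrow> x \<in> D0 \<and>
      (\<forall>v\<in>V. (\<Sum>i\<in>vert_index V E. (if i = Inl (Inl v) then 1 else 0) *\<^sub>R hat B x i) \<in> h v) \<and>
      (\<forall>a\<in>arcs V E. (\<Sum>i\<in>vert_index V E. (if i = Inl (Inr (snd a)) then 1 else 0) *\<^sub>R hat B x i) \<in> h (fst a))"
    unfolding incidence_system_def stalk_conditions_def D0_def ball_Un ball_simps by (simp add: case_prod_unfold)
  also have "\<dots> \<longleftrightarrow> x \<in> D0 \<and> (\<forall>v\<in>V. hat B x (Inl (Inl v)) \<in> h v) \<and>
      (\<forall>a\<in>arcs V E. hat B x (Inl (Inr (snd a))) \<in> h (fst a))"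
  proof -
    have "(\<Sum>i\<in>vert_index V E. (if i = Inl (Inl v) then 1 else 0) *\<^sub>R hat B x i) = hat B x (Inl (Inl v))"
      if "v \<in> V" for v using that by (intro sum) auto
    moreover have "(\<Sum>i\<in>vert_index V E. (if i = Inl (Inr (snd a)) then 1 else 0) *\<^sub>R hat B x i) =
        hat B x (Inl (Inr (snd a)))" if "a \<in> arcs V E" for a
      using that by (intro sum) (auto simp: arcs_def)
    ultimately show ?thesis by (metis (no_types, lifting))
  qed
  also have "\<dots> \<longleftrightarrow> x \<in> D0 \<and> (\<forall>u\<in>Inl ` V \<union> Inr ` E. hat B x (Inl u) \<in> lie_algebra (\<rho> u))"
    using edge by (auto simp: arcs_def)
  finally show ?thesis .
qed

lemma lin_subspace_sys: "lin_subspace fscale (incidence_system K B (arc_conditions V E s) h)"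
  using vertex_stalk(1) by (intro lin_subspace_incidence_system) (auto simp: arc_conditions_def arcs_def)

lemma D_finite: "finite (vert_index V E \<times> B)" "finite (arc_index V E \<times> B)"
  "finite ((vert_index V E \<union> arc_index V E) \<times> B)"
  using finite_index finite_B by auto

lemma zero_cochains1: "\<zero>\<^bsub>cochains1 \<Gamma> \<M>\<^esub> = (\<lambda>a\<in>arcs V E. \<zero>\<^bsub>lie_quotient G (\<rho> (Inl (fst a)))\<^esub>)"
  by (simp add: cochains1_def prod_module_def incidence_graph_def arcs_def motion_sheaf_def case_prod_unfold)

lemma zero_cochains0: "\<zero>\<^bsub>cochains0 \<Gamma> \<M>\<^esub> = (\<lambda>u\<in>Inl ` V \<union> Inr ` E. \<zero>\<^bsub>lie_quotient G (\<rho> u)\<^esub>)"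
  by (auto simp: cochains0_def prod_module_def incidence_graph_def motion_sheaf_def)

text \<open>Rank-nullity for \<open>pr0\<close> on the lifts of cocycles; its kernel is the space of
  lifts of the zero cochain.\<close>

theorem dim_H0: "vectorspace.dim real_scalars (H0 \<Gamma> s \<M>) + fdim K_sys = fdim S_sys"
proof -
  have cocycle: "coboundary \<Gamma> s \<M> (pr0 x) = \<zero>\<^bsub>cochains1 \<Gamma> \<M>\<^esub> \<longleftrightarrow> (\<forall>a\<in>arcs V E. diff a x \<in> h (fst a))" for x
  proof -
    have "coset (Inl (fst a)) (diff a x) = \<zero>\<^bsub>lie_quotient G (\<rho> (Inl (fst a)))\<^esub> \<longleftrightarrow> diff a x \<in> h (fst a)"
      if "a \<in> arcs V E" for a by (rule lin_onto_stalk(2)[OF arc_mem(2)[OF that] diff_mem])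
    then show ?thesis unfolding coboundary_pr0 zero_cochains1 restrict_eq_iff by blast
  qed
  have "carrier (H0 \<Gamma> s \<M>) = pr0 ` {x \<in> D0. coboundary \<Gamma> s \<M> (pr0 x) = \<zero>\<^bsub>cochains1 \<Gamma> \<M>\<^esub>}"
    using lin_ontoD(3)[OF lin_onto_cochains0] by (auto simp: H0_def)
  also have "{x \<in> D0. coboundary \<Gamma> s \<M> (pr0 x) = \<zero>\<^bsub>cochains1 \<Gamma> \<M>\<^esub>} = S_sys"
    unfolding cocycle using S_sys_iff by blast
  finally have "carrier (H0 \<Gamma> s \<M>) = pr0 ` S_sys" .
  then have H0: "H0 \<Gamma> s \<M> = (cochains0 \<Gamma> \<M>)\<lparr>carrier := pr0 ` S_sys\<rparr>" by (simp add: H0_def)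
  have onto: "lin_onto fscale S_sys pr0 (H0 \<Gamma> s \<M>)"
    unfolding H0
    by (rule lin_onto_restrict[OF lin_onto_cochains0 lin_subspace_sys]) (auto simp: S_sys_iff)
  have ker: "pr0 x = \<zero>\<^bsub>H0 \<Gamma> s \<M>\<^esub> \<longleftrightarrow> (\<forall>u\<in>Inl ` V \<union> Inr ` E. hat B x (Inl u) \<in> lie_algebra (\<rho> u))" for x
  proof -
    have zero: "\<zero>\<^bsub>H0 \<Gamma> s \<M>\<^esub> = (\<lambda>u\<in>Inl ` V \<union> Inr ` E. \<zero>\<^bsub>lie_quotient G (\<rho> u)\<^esub>)"
      by (simp add: H0_def zero_cochains0)
    have "coset u (hat B x (Inl u)) = \<zero>\<^bsub>lie_quotient G (\<rho> u)\<^esub> \<longleftrightarrow> hat B x (Inl u) \<in> lie_algebra (\<rho> u)"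
      if "u \<in> Inl ` V \<union> Inr ` E" for u by (rule lin_onto_stalk(2)[OF that hat_mem])
    then show ?thesis unfolding pr0_def zero restrict_eq_iff by (rule ball_cong[OF refl])
  qed
  \<comment> \<open>The edge Lie algebra is contained in that of each of its vertices, so a lift of
    zero satisfies the cocycle condition.\<close>
  have K_S: "x \<in> S_sys" if "x \<in> K_sys" for x
  proof -
    have "diff a x \<in> h (fst a)" if a: "a \<in> arcs V E" for a
    proof -
      obtain v e where ve: "a = (v, e)" "v \<in> V" "e \<in> E" "v \<in> e" using a by (auto simp: arcs_def)
      have mem: "hat B x (Inl u) \<in> lie_algebra (\<rho> u)" if "u \<in> Inl ` V \<union> Inr ` E" for u
        using \<open>x \<in> K_sys\<close> that unfolding K_sys_iff by blast
      have "hat B x (Inl (Inl v)) \<in> h v" using mem[of "Inl v"] ve(2) by simp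
      moreover have "hat B x (Inl (Inr e)) \<in> h v"
        using mem[of "Inr e"] ve(3,4) edge_stalk[OF ve(3)] by auto
      ultimately have "hat B x (Inl (Inl v)) \<in> h v" "hat B x (Inl (Inr e)) \<in> h v" by auto
      then show ?thesis unfolding diff_def ve
        using vertex_stalk(1)[OF ve(2)] real_vector.subspace_add real_vector.subspace_scale by simp blast
    qed
    then show ?thesis using \<open>x \<in> K_sys\<close> by (simp add: S_sys_iff K_sys_iff)
  qed
  have "x \<in> K_sys \<longleftrightarrow> x \<in> S_sys \<and> pr0 x = \<zero>\<^bsub>H0 \<Gamma> s \<M>\<^esub>" for x
    using K_S[of x] ker[of x] K_sys_iff[of x] S_sys_iff[of x] by argo
  then have "{x \<in> S_sys. pr0 x = \<zero>\<^bsub>H0 \<Gamma> s \<M>\<^esub>} = K_sys" by auto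
  moreover have "S_sys \<subseteq> supported_on (vert_index V E \<times> B)" by (auto simp: incidence_system_def)
  ultimately show ?thesis using lin_onto_dim[OF onto D_finite(1)] by simp
qed

definition "rest1 z = (\<lambda>j. if j \<in> arc_index V E \<times> B then z j else 0)"

lemma hat_rest1: "a \<in> arcs V E \<Longrightarrow> hat B (rest1 z) (Inr a) = hat B z (Inr a)"
  unfolding hat_def by (intro sum.cong) (auto simp: rest1_def arc_index_def)

text \<open>Two applications of rank-nullity: \<open>D1\<close> maps onto H1 with kernel the lifts
  of coboundaries, and \<open>R_sys\<close> maps onto these lifts with kernel
  \<open>S_sys\<close>.\<close>

theorem dim_H1: "vectorspace.dim real_scalars (H1 \<Gamma> s \<M>) + fdim R_sys = fdim D1 + fdim S_sys"
proof -
  define Dw where "Dw = rest1 ` R_sys"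
  define W where "W = coboundary \<Gamma> s \<M> ` carrier (cochains0 \<Gamma> \<M>)"
  have rest_lin: "rest1 (x + y) = rest1 x + rest1 y" "rest1 (fscale c x) = fscale c (rest1 x)" "rest1 0 = 0"
    for x y c by (auto simp: rest1_def fun_eq_iff)
  have Dw_sub: "lin_subspace fscale Dw"
    unfolding Dw_def
  proof (rule lin_subspaceI)
    note R = lin_subspaceD[OF lin_subspace_sys[of "vert_index V E \<union> arc_index V E"]]
    show "0 \<in> rest1 ` R_sys" using R(1) rest_lin(3) by (metis imageI)
    show "x + y \<in> rest1 ` R_sys" if "x \<in> rest1 ` R_sys" "y \<in> rest1 ` R_sys" for x y
      using that R(2) by (auto simp flip: rest_lin(1))
    show "fscale c x \<in> rest1 ` R_sys" if x: "x \<in> rest1 ` R_sys" for c x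
    proof -
      obtain z where z: "z \<in> R_sys" "x = rest1 z" using x by blast
      have "rest1 (fscale c z) \<in> rest1 ` R_sys" using R(3)[OF z(1)] by blast
      then show ?thesis by (simp only: rest_lin(2) z(2))
    qed
  qed
  have Dw_D1: "Dw \<subseteq> D1" by (auto simp: Dw_def D1_def rest1_def supported_on_def)
  have W: "W = pr1 ` Dw"
  proof (intro equalityI subsetI)
    fix w assume "w \<in> W"
    then obtain x where x: "x \<in> D0" "w = coboundary \<Gamma> s \<M> (pr0 x)"
      by (auto simp: W_def lin_ontoD(3)[OF lin_onto_cochains0])
    have "case_sum (\<lambda>_. 0) (\<lambda>a. diff a x) i \<in> span B" if "i \<in> arc_index V E" for i
      using that diff_mem by (auto simp: arc_index_def span_B)
    from hat_surj[OF finite_B, of "arc_index V E" "case_sum (\<lambda>_. 0) (\<lambda>a. diff a x)", OF this]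
    obtain y where "y \<in> D1" "\<forall>a\<in>arcs V E. hat B y (Inr a) = diff a x"
      by (auto simp: D1_def arc_index_def)
    then have y: "y \<in> D1" "\<And>a. a \<in> arcs V E \<Longrightarrow> hat B y (Inr a) = diff a x" by blast+
    \<comment> \<open>\<open>x\<close> and \<open>y\<close> have disjoint supports, so
      \<open>z\<close> has the vertex part of \<open>x\<close> and the arc part of
      \<open>y\<close>.\<close>
    define z where "z = x + y"
    have hat_v: "hat B z (Inl u) = hat B x (Inl u)" for u
      unfolding hat_def z_def using y(1)
      by (intro sum.cong) (auto simp: D1_def supported_on_def arc_index_def)
    have hat_a: "hat B z (Inr a) = hat B y (Inr a)" for a
      unfolding hat_def z_def using x(1)
      by (intro sum.cong) (auto simp: D0_def supported_on_def vert_index_def)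
    have "diff a z = diff a x" for a by (simp add: diff_def hat_v)
    then have "hat B z (Inr a) - diff a z \<in> h (fst a)" if "a \<in> arcs V E" for a
      using real_vector.subspace_0[OF vertex_stalk(1)[OF arc_mem(1)[OF that]]] by (simp add: hat_a y(2)[OF that])
    moreover have "z \<in> supported_on ((vert_index V E \<union> arc_index V E) \<times> B)"
      using x(1) y(1) by (auto simp: z_def D0_def D1_def supported_on_def)
    ultimately have "z \<in> R_sys" by (simp add: R_sys_iff)
    moreover have "w = pr1 (rest1 z)"
      unfolding x(2) coboundary_pr0 pr1_def
      by (intro restrict_ext) (simp add: hat_rest1 hat_a y(2))
    ultimately show "w \<in> pr1 ` Dw" by (auto simp: Dw_def)
  next
    fix w assume "w \<in> pr1 ` Dw"
    then obtain z where z: "z \<in> R_sys" "w = pr1 (rest1 z)" by (auto simp: Dw_def)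
    define x where "x = (\<lambda>j. if j \<in> vert_index V E \<times> B then z j else 0)"
    have "hat B x (Inl u) = hat B z (Inl u)" if "u \<in> Inl ` V \<union> Inr ` E" for u
      unfolding hat_def using that by (intro sum.cong) (auto simp: x_def vert_index_def)
    then have dxz: "diff a x = diff a z" if "a \<in> arcs V E" for a
      using that by (simp add: diff_def) (auto simp: arcs_def)
    have "w = coboundary \<Gamma> s \<M> (pr0 x)"
      unfolding z(2) coboundary_pr0 pr1_def
    proof (intro restrict_ext)
      fix a assume a: "a \<in> arcs V E"
      show "coset (Inl (fst a)) (hat B (rest1 z) (Inr a)) = coset (Inl (fst a)) (diff a x)"
        unfolding coset_eq_iff[OF arc_mem(2)[OF a] hat_mem diff_mem] hat_rest1[OF a] dxz[OF a]
        using z(1) a by (simp add: R_sys_iff)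
    qed
    moreover have "x \<in> D0" by (auto simp: x_def D0_def supported_on_def)
    ultimately show "w \<in> W" by (auto simp: W_def lin_ontoD(3)[OF lin_onto_cochains0])
  qed
  note quot = lin_onto_quot[OF lin_onto_cochains1 Dw_sub Dw_D1 W]
  have H1: "H1 \<Gamma> s \<M> = quot_module (cochains1 \<Gamma> \<M>) W" by (simp add: H1_def W_def)
  have "{y \<in> D1. W +>\<^bsub>cochains1 \<Gamma> \<M>\<^esub> pr1 y = \<zero>\<^bsub>H1 \<Gamma> s \<M>\<^esub>} = Dw"
  proof (intro equalityI subsetI)
    fix y assume "y \<in> {y \<in> D1. W +>\<^bsub>cochains1 \<Gamma> \<M>\<^esub> pr1 y = \<zero>\<^bsub>H1 \<Gamma> s \<M>\<^esub>}"
    then have y: "y \<in> D1" "pr1 y \<in> W" using quot(2) by (auto simp: H1)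
    then obtain z where z: "z \<in> R_sys" "pr1 y = pr1 (rest1 z)" by (auto simp: W Dw_def)
    \<comment> \<open>The coboundary of the vertex part of \<open>z\<close> fits \<open>y\<close>
      only modulo the stalks. Changing the arc part by an element of the stalk at each arc stays
      inside \<open>R_sys\<close> and yields \<open>y\<close> itself.\<close>
    define z' where "z' = z + (y - rest1 z)"
    have "hat B (y - rest1 z) (Inr a) \<in> h (fst a)" if a: "a \<in> arcs V E" for a
    proof -
      have "coset (Inl (fst a)) (hat B y (Inr a)) = coset (Inl (fst a)) (hat B (rest1 z) (Inr a))"
        using fun_cong[OF z(2), of a] a by (simp add: pr1_def)
      then show ?thesis unfolding coset_eq_iff[OF arc_mem(2)[OF a] hat_mem hat_mem] hat_diff .
    qed
    moreover have "hat B (y - rest1 z) (Inl u) = 0" for u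
      unfolding hat_def using y(1)
      by (intro sum.neutral) (auto simp: D1_def supported_on_def rest1_def arc_index_def)
    then have "diff a z' = diff a z" for a by (simp add: diff_def z'_def hat_add)
    moreover have "hat B z' (Inr a) = hat B z (Inr a) + hat B (y - rest1 z) (Inr a)" for a
      by (simp only: z'_def hat_add)
    ultimately have "hat B z' (Inr a) - diff a z' \<in> h (fst a)" if a: "a \<in> arcs V E" for a
      using z(1) a real_vector.subspace_add[OF vertex_stalk(1)[OF arc_mem(1)[OF a]],
          of "hat B z (Inr a) - diff a z" "hat B (y - rest1 z) (Inr a)"]
      by (simp add: R_sys_iff algebra_simps)
    moreover have "z' \<in> supported_on ((vert_index V E \<union> arc_index V E) \<times> B)"
      using z(1) y(1) by (auto simp: z'_def R_sys_iff D1_def supported_on_def rest1_def)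
    ultimately have "z' \<in> R_sys" by (simp add: R_sys_iff)
    moreover have "y = rest1 z'"
      using y(1) by (auto simp: fun_eq_iff rest1_def z'_def D1_def supported_on_def)
    ultimately show "y \<in> Dw" by (auto simp: Dw_def)
  next
    fix y assume "y \<in> Dw"
    then show "y \<in> {y \<in> D1. W +>\<^bsub>cochains1 \<Gamma> \<M>\<^esub> pr1 y = \<zero>\<^bsub>H1 \<Gamma> s \<M>\<^esub>}"
      using quot(2)[of y] Dw_D1 W by (auto simp: H1)
  qed
  then have 1: "fdim D1 = vectorspace.dim real_scalars (H1 \<Gamma> s \<M>) + fdim Dw"
    using lin_onto_dim[OF quot(1) D_finite(2)] by (simp add: H1 D1_def)
  have "R_sys \<subseteq> supported_on ((vert_index V E \<union> arc_index V E) \<times> B)" by (auto simp: incidence_system_def)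
  then have 2: "fdim R_sys = fdim Dw + fdim {z \<in> R_sys. rest1 z = 0}"
    unfolding Dw_def by (intro fdim_rank_nullity[OF lin_subspace_sys D_finite(3)] rest_lin)
  have "z \<in> R_sys \<and> rest1 z = 0 \<longleftrightarrow> z \<in> S_sys" for z
  proof -
    have "hat B z (Inr a) = 0" if "z \<in> D0" for a
      unfolding hat_def using that
      by (intro sum.neutral) (auto simp: D0_def supported_on_def vert_index_def)
    moreover have "z \<in> D0 \<longleftrightarrow> z \<in> supported_on ((vert_index V E \<union> arc_index V E) \<times> B) \<and> rest1 z = 0"
    proof
      assume "z \<in> D0"
      then show "z \<in> supported_on ((vert_index V E \<union> arc_index V E) \<times> B) \<and> rest1 z = 0"
        by (auto simp: D0_def supported_on_def rest1_def fun_eq_iff vert_index_def arc_index_def)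
    next
      assume z: "z \<in> supported_on ((vert_index V E \<union> arc_index V E) \<times> B) \<and> rest1 z = 0"
      have "z j = 0" if "j \<notin> vert_index V E \<times> B" for j
      proof (cases "j \<in> arc_index V E \<times> B")
        case True
        have "rest1 z j = 0" using z by simp
        then show ?thesis using True by (simp add: rest1_def)
      next
        case False
        then have "j \<notin> (vert_index V E \<union> arc_index V E) \<times> B" using that by (cases j) auto
        then show ?thesis using z unfolding supported_on_def by blast
      qed
      then show "z \<in> D0" by (simp add: D0_def supported_on_def)
    qed
    moreover have "- diff a z \<in> h (fst a) \<longleftrightarrow> diff a z \<in> h (fst a)" if "a \<in> arcs V E" for a
      using real_vector.subspace_neg[OF vertex_stalk(1)[OF arc_mem(1)[OF that]]] by (metis minus_minus)
    ultimately show ?thesis unfolding S_sys_iff R_sys_iff by auto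
  qed
  then have "{z \<in> R_sys. rest1 z = 0} = S_sys" by blast
  then show ?thesis using 1 2 by simp
qed

end


section \<open>Conjugates of a closed subgroup\<close>

lemma bounded_linear_conj:
  fixes A B :: "real^'n^'n"
  shows "bounded_linear (\<lambda>X. A ** X ** B)"
  using bounded_linear_compose[OF bounded_bilinear.bounded_linear_left[OF bounded_bilinear_matrix_mult, of B]
      bounded_bilinear.bounded_linear_right[OF bounded_bilinear_matrix_mult, of A]] by simp

lemma conj_inverse:
  fixes g X :: "'a::field^'n^'n"
  assumes "invertible g"
  shows "matrix_inv g ** (g ** X ** matrix_inv g) ** g = X" "g ** (matrix_inv g ** X ** g) ** matrix_inv g = X"
proof -
  have "matrix_inv g ** (g ** X ** matrix_inv g) ** g = (matrix_inv g ** g) ** X ** (matrix_inv g ** g)"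
    by (simp only: matrix_mul_assoc)
  then show "matrix_inv g ** (g ** X ** matrix_inv g) ** g = X" using assms by simp
  have "g ** (matrix_inv g ** X ** g) ** matrix_inv g = (g ** matrix_inv g) ** X ** (g ** matrix_inv g)"
    by (simp only: matrix_mul_assoc)
  then show "g ** (matrix_inv g ** X ** g) ** matrix_inv g = X" using assms by simp
qed

lemma conj_set_iff:
  assumes "invertible g"
  shows "X \<in> conj_set g H \<longleftrightarrow> matrix_inv g ** X ** g \<in> H"
  unfolding conj_set_def using conj_inverse[OF assms] by (auto simp: image_iff) metis

lemma conj_matrix_mult:
  fixes g :: "'a::field^'n^'n"
  assumes "invertible g"
  shows "matrix_inv g ** (X ** Y) ** g = (matrix_inv g ** X ** g) ** (matrix_inv g ** Y ** g)"
proof -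
  have "(matrix_inv g ** X ** g) ** (matrix_inv g ** Y ** g) = matrix_inv g ** X ** (g ** matrix_inv g) ** Y ** g"
    by (simp only: matrix_mul_assoc)
  then show ?thesis using assms by (simp add: matrix_mul_assoc)
qed

lemma matrix_inv_conj:
  fixes g :: "'a::field^'n^'n"
  assumes "invertible g" "invertible X"
  shows "matrix_inv (matrix_inv g ** X ** g) = matrix_inv g ** matrix_inv X ** g"
proof (rule matrix_inv_eqI)
  show "matrix_inv g ** X ** g ** (matrix_inv g ** matrix_inv X ** g) = mat 1"
    using conj_matrix_mult[OF assms(1), of X "matrix_inv X"] assms by simp
  show "matrix_inv g ** matrix_inv X ** g ** (matrix_inv g ** X ** g) = mat 1"
    using conj_matrix_mult[OF assms(1), of "matrix_inv X" X] assms by simp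
qed

lemma closed_matrix_group_conj:
  assumes H: "closed_matrix_group H" and g: "invertible g"
  shows "closed_matrix_group (conj_set g H)"
  unfolding closed_matrix_group_def subgroup_GL_iff
proof (intro conjI ballI allI impI)
  show inv: "invertible A" if "A \<in> conj_set g H" for A
    using that closed_matrix_groupD(1)[OF H] g invertible_matrix_inv[OF g]
    by (auto simp: conj_set_def intro!: invertible_mult)
  show "mat 1 \<in> conj_set g H" using g closed_matrix_groupD(2)[OF H] by (simp add: conj_set_iff)
  show "A ** B \<in> conj_set g H" if "A \<in> conj_set g H" "B \<in> conj_set g H" for A B
    using that closed_matrix_groupD(3)[OF H] g by (simp add: conj_set_iff conj_matrix_mult)
  show "matrix_inv A \<in> conj_set g H" if "A \<in> conj_set g H" for A
    using closed_matrix_groupD(4)[OF H] that g inv[OF that] matrix_inv_conj[OF g inv[OF that]]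
    by (metis conj_set_iff)
  fix y L assume y: "range y \<subseteq> conj_set g H" "y \<longlonglongrightarrow> L" "invertible L"
  have "matrix_inv g ** L ** g \<in> H"
  proof (rule closed_matrix_groupD(5)[OF H])
    show "matrix_inv g ** y k ** g \<in> H" for k using y(1) conj_set_iff[OF g] by blast
    show "(\<lambda>k. matrix_inv g ** y k ** g) \<longlonglongrightarrow> matrix_inv g ** L ** g"
      by (intro tendsto_matrix_mult tendsto_const y(2))
    show "invertible (matrix_inv g ** L ** g)" by (intro invertible_mult invertible_matrix_inv g y(3))
  qed
  then show "L \<in> conj_set g H" by (simp add: conj_set_iff[OF g])
qed

text \<open>Conjugation is linear and multiplicative, so it commutes with the exponential.\<close>

lemma lie_exp_conj:
  assumes g: "invertible g"
  shows "lie_exp (conj_set g H) = (\<lambda>X. g ** X ** matrix_inv g) ` lie_exp H"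
proof -
  have hom: "matrix_inv g ** mexp Y ** g = mexp (matrix_inv g ** Y ** g)" for Y
    using g by (intro mexp_hom[OF bounded_linear_conj]) (simp_all add: conj_matrix_mult)
  have iff: "X \<in> lie_exp (conj_set g H) \<longleftrightarrow> matrix_inv g ** X ** g \<in> lie_exp H" for X
    using hom by (simp add: lie_exp_def conj_set_iff[OF g] matrix_mult_scaleR)
  show ?thesis
  proof (intro equalityI subsetI)
    fix X assume "X \<in> lie_exp (conj_set g H)"
    then show "X \<in> (\<lambda>X. g ** X ** matrix_inv g) ` lie_exp H"
      unfolding iff by (intro image_eqI[where x = "matrix_inv g ** X ** g"]) (simp_all add: conj_inverse g)
  next
    fix X assume "X \<in> (\<lambda>X. g ** X ** matrix_inv g) ` lie_exp H"
    then show "X \<in> lie_exp (conj_set g H)" unfolding iff using conj_inverse(1)[OF g] by auto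
  qed
qed

lemma closed_matrix_group_Inter:
  assumes "\<K> \<noteq> {}" and K: "\<And>K. K \<in> \<K> \<Longrightarrow> closed_matrix_group K"
  shows "closed_matrix_group (\<Inter>\<K>)"
  unfolding closed_matrix_group_def subgroup_GL_iff
proof (intro conjI ballI allI impI)
  note D = closed_matrix_groupD[OF K]
  show "invertible A" if "A \<in> \<Inter>\<K>" for A using that assms(1) D(1) by blast
  show "mat 1 \<in> \<Inter>\<K>" using D(2) by blast
  show "A ** B \<in> \<Inter>\<K>" if "A \<in> \<Inter>\<K>" "B \<in> \<Inter>\<K>" for A B using that D(3) by blast
  show "matrix_inv A \<in> \<Inter>\<K>" if "A \<in> \<Inter>\<K>" for A using that D(4) by blast
  fix y L assume y: "range y \<subseteq> \<Inter>\<K>" "y \<longlonglongrightarrow> L" "invertible L"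
  have "L \<in> K" if "K \<in> \<K>" for K
    by (rule D(5)[OF that _ y(2,3)]) (use y(1) that in blast)
  then show "L \<in> \<Inter>\<K>" by blast
qed

lemma closed_matrix_group_closedin:
  assumes G: "closed_matrix_group G" and H: "subgroup H GL" "closedin (top_of_set G) H"
  shows "closed_matrix_group H"
  unfolding closed_matrix_group_def
proof (intro conjI allI impI H(1))
  fix y L assume y: "range y \<subseteq> H" "y \<longlonglongrightarrow> L" "invertible L"
  obtain T where T: "closed T" "H = G \<inter> T" using H(2) by (auto simp: closedin_closed)
  have "y k \<in> G" "y k \<in> T" for k using y(1) T(2) by auto
  then have "L \<in> G" "L \<in> T"
    using closed_matrix_groupD(5)[OF G _ y(2,3)] closed_sequentially[OF T(1) _ y(2)] by auto
  then show "L \<in> H" using T(2) by simp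
qed

section \<open>Generic rank of the incidence systems\<close>

text \<open>The adjugate in the form of Cramer's rule: column \<open>i\<close> of \<open>A\<close>
  is replaced by the j-th unit vector. Its entries are polynomials in those of
  \<open>A\<close>.\<close>

definition adj_matrix :: "'a::field^'n^'n \<Rightarrow> 'a^'n^'n" where
  "adj_matrix A = (\<chi> i j. det (\<chi> a b. if b = i then mat 1 $ a $ j else A $ a $ b))"

lemma adj_matrix_eq:
  fixes A :: "real^'n^'n"
  assumes A: "invertible A"
  shows "adj_matrix A = det A *\<^sub>R matrix_inv A"
proof -
  have "adj_matrix A $ i $ j = det A * matrix_inv A $ i $ j" for i j
  proof -
    let ?x = "\<chi> k. matrix_inv A $ k $ j" and ?b = "\<chi> a. (mat 1 :: real^'n^'n) $ a $ j"
    have "A *v ?x = ?b"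
    proof -
      have "(A *v ?x) $ a = (A ** matrix_inv A) $ a $ j" for a
        by (simp add: matrix_vector_mult_def matrix_matrix_mult_def)
      then show ?thesis using A by (simp add: vec_eq_iff)
    qed
    moreover have nz: "det A \<noteq> 0" using A by (simp add: invertible_det_nz)
    ultimately have "?x = (\<chi> k. det (\<chi> a b. if b = k then ?b $ a else A $ a $ b) / det A)"
      unfolding cramer[OF nz] by simp
    then have "?x $ i = det (\<chi> a b. if b = i then ?b $ a else A $ a $ b) / det A" by (simp only: vec_lambda_beta)
    then show ?thesis using nz by (simp add: adj_matrix_def cong: if_cong)
  qed
  then show ?thesis by (simp add: vec_eq_iff)
qed

lemma polyfun_adj_matrix:
  assumes "\<And>i j. (\<lambda>x. M x $ i $ j) \<in> polyfun X"
  shows "(\<lambda>x. adj_matrix (M x) $ i $ j) \<in> polyfun X"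
proof -
  have "(\<lambda>x. if b = i then mat 1 $ a $ j else M x $ a $ b) \<in> polyfun X" for a b
    using assms by (cases "b = i") (simp_all add: polyfun_const)
  then have "(\<lambda>x. det (\<chi> a b. if b = i then mat 1 $ a $ j else M x $ a $ b)) \<in> polyfun X"
    by (intro polyfun_compose_entries[OF polyfun_det]) simp
  then show ?thesis by (simp add: adj_matrix_def)
qed

lemma polyfun_matrix_mult:
  fixes P Q :: "'x \<Rightarrow> 'a::comm_ring_1^'n^'n"
  assumes "\<And>i j. (\<lambda>x. P x $ i $ j) \<in> polyfun X" "\<And>i j. (\<lambda>x. Q x $ i $ j) \<in> polyfun X"
  shows "(\<lambda>x. (P x ** Q x) $ i $ j) \<in> polyfun X"
  using assms by (simp add: matrix_matrix_mult_def) (intro polyfun_sum polyfun_mult)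

text \<open>A basis of the orthogonal complement gives the equations, as the double complement
  returns the subspace.\<close>

lemma subspace_equations:
  fixes h :: "'a::euclidean_space set"
  assumes "Real_Vector_Spaces.subspace h"
  obtains C where "finite C" "\<And>x. x \<in> h \<longleftrightarrow> (\<forall>c\<in>C. c \<bullet> x = 0)"
proof -
  obtain C where C: "C \<subseteq> h\<^sup>\<bottom>" "independent C" "h\<^sup>\<bottom> \<subseteq> span C"
    using real_vector.maximal_independent_subset by blast
  have "x \<in> h \<longleftrightarrow> (\<forall>c\<in>C. c \<bullet> x = 0)" for x
  proof
    assume "x \<in> h" then show "\<forall>c\<in>C. c \<bullet> x = 0"
      using C(1) by (auto simp: orthogonal_comp_def orthogonal_def inner_commute)
  next
    assume x: "\<forall>c\<in>C. c \<bullet> x = 0"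
    have "orthogonal x y" if "y \<in> span C" for y
      by (rule orthogonal_to_span[OF that]) (use x in \<open>auto simp: orthogonal_def inner_commute\<close>)
    then have "x \<in> h\<^sup>\<bottom>\<^sup>\<bottom>" using C(3) by (auto simp: orthogonal_comp_def orthogonal_commute)
    then show "x \<in> h" using orthogonal_comp_self[OF assms] by simp
  qed
  then show thesis using that[of C] independent_imp_finite[OF C(2)] by blast
qed

text \<open>Y lies in g h g^-1 iff g^-1 Y g satisfies the equations of \<open>h\<close>. Multiplied
  by det g, which is nonzero, these become polynomial in g with the same solutions, and the generic
  rank theorem applies.\<close>

theorem generic_fdim_incidence_system:
  fixes h B :: "(real^'n^'n) set" and V :: "'v set" and K :: "'i set" and C :: "('v \<times> ('i \<Rightarrow> real)) set"
  assumes h: "Real_Vector_Spaces.subspace h" and fin: "finite K" "finite B"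
    and C: "\<And>v l. (v, l) \<in> C \<Longrightarrow> v \<in> V"
  defines "sys g \<equiv> incidence_system K B C (\<lambda>v. (\<lambda>X. g v ** X ** matrix_inv (g v)) ` h)"
  assumes g0: "\<And>v. v \<in> V \<Longrightarrow> invertible (g0 v)"
  shows "\<exists>F\<in>polyfun (family_entry_funs V). F g0 \<noteq> 0 \<and>
    (\<forall>g. (\<forall>v\<in>V. invertible (g v)) \<longrightarrow> F g \<noteq> 0 \<longrightarrow> fdim (sys g) \<le> fdim (sys g0))"
proof -
  obtain N where N: "finite N" "\<And>X. X \<in> h \<longleftrightarrow> (\<forall>c\<in>N. c \<bullet> X = 0)" using subspace_equations[OF h] by blast
  \<comment> \<open>A row is a condition (v, l) together with an equation c of \<open>h\<close>; a
    column is an index k together with an element b of \<open>B\<close>.\<close>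
  define M where "M i j g = (case i of ((v, l), c) \<Rightarrow> case j of (k, b) \<Rightarrow>
      c \<bullet> (adj_matrix (g v) ** (l k *\<^sub>R b) ** g v))" for i :: "('v \<times> ('i \<Rightarrow> real)) \<times> (real^'n^'n)" and j :: "'i \<times> (real^'n^'n)" and g :: "'v \<Rightarrow> real^'n^'n"
  have sys: "sys g = solutions (K \<times> B) (C \<times> N) (\<lambda>i j. M i j g)" if g: "\<forall>v\<in>V. invertible (g v)" for g
  proof -
    have sum: "(\<Sum>j\<in>K \<times> B. M ((v, l), c) j g * x j) =
        c \<bullet> (adj_matrix (g v) ** (\<Sum>k\<in>K. l k *\<^sub>R hat B x k) ** g v)" for v l c x
    proof -
      interpret L: bounded_linear "\<lambda>X. c \<bullet> (adj_matrix (g v) ** X ** g v)"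
        by (rule bounded_linear_compose[OF bounded_linear_inner_right bounded_linear_conj])
      have "(\<Sum>j\<in>K \<times> B. M ((v, l), c) j g * x j) =
          (\<Sum>k\<in>K. \<Sum>b\<in>B. c \<bullet> (adj_matrix (g v) ** (l k *\<^sub>R b) ** g v) * x (k, b))"
        by (simp add: M_def sum.cartesian_product split_def)
      also have "\<dots> = c \<bullet> (adj_matrix (g v) ** (\<Sum>k\<in>K. \<Sum>b\<in>B. x (k, b) *\<^sub>R (l k *\<^sub>R b)) ** g v)"
        unfolding L.sum by (simp only: L.scaleR) (simp add: mult.commute)
      also have "(\<Sum>k\<in>K. \<Sum>b\<in>B. x (k, b) *\<^sub>R (l k *\<^sub>R b)) = (\<Sum>k\<in>K. l k *\<^sub>R hat B x k)"
        by (simp add: hat_def scaleR_right.sum mult.commute)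
      finally show ?thesis .
    qed
    have "Y \<in> (\<lambda>X. g v ** X ** matrix_inv (g v)) ` h \<longleftrightarrow> (\<forall>c\<in>N. c \<bullet> (adj_matrix (g v) ** Y ** g v) = 0)"
      if v: "v \<in> V" for v Y
    proof -
      have inv: "invertible (g v)" using g v by blast
      then have nz: "det (g v) \<noteq> 0" by (simp add: invertible_det_nz)
      have "Y \<in> (\<lambda>X. g v ** X ** matrix_inv (g v)) ` h \<longleftrightarrow> matrix_inv (g v) ** Y ** g v \<in> h"
        using conj_set_iff[OF inv, of Y h] by (simp add: conj_set_def)
      also have "\<dots> \<longleftrightarrow> (\<forall>c\<in>N. c \<bullet> (adj_matrix (g v) ** Y ** g v) = 0)"
        unfolding N(2) adj_matrix_eq[OF inv] using nz by (simp add: matrix_mult_scaleR)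
      finally show ?thesis .
    qed
    note mem = this
    have "(case p of (v, l) \<Rightarrow> (\<Sum>i\<in>K. l i *\<^sub>R hat B x i) \<in> (\<lambda>X. g v ** X ** matrix_inv (g v)) ` h) \<longleftrightarrow>
        (\<forall>c\<in>N. (\<Sum>j\<in>K \<times> B. M (p, c) j g * x j) = 0)" if p: "p \<in> C" for p x
    proof -
      obtain v l where vl: "p = (v, l)" by (cases p)
      then have v: "v \<in> V" using C p by blast
      show ?thesis unfolding vl split_conv sum mem[OF v] ..
    qed
    then have "(\<forall>(v, l)\<in>C. (\<Sum>i\<in>K. l i *\<^sub>R hat B x i) \<in> (\<lambda>X. g v ** X ** matrix_inv (g v)) ` h) \<longleftrightarrow>
        (\<forall>i\<in>C \<times> N. (\<Sum>j\<in>K \<times> B. M i j g * x j) = 0)" for x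
      by (simp cong: ball_cong)
    then show ?thesis unfolding sys_def incidence_system_def solutions_def by blast
  qed
  have "M i j \<in> polyfun (family_entry_funs V)" if i: "i \<in> C \<times> N" for i j
  proof -
    obtain v l c k b where ij: "i = ((v, l), c)" "j = (k, b)" by (metis surj_pair)
    have v: "v \<in> V" using C i ij by auto
    have ent: "(\<lambda>g. g v $ a $ b) \<in> polyfun (family_entry_funs V)" for a b
      using v by (intro polyfun_gen image_eqI[where x = "(v, a, b)"]) auto
    have const: "(\<lambda>g. (l k *\<^sub>R b) $ a $ a') \<in> polyfun (family_entry_funs V)" for a a'
      by (rule polyfun_const)
    have "(\<lambda>g. (adj_matrix (g v) ** (l k *\<^sub>R b) ** g v) $ a $ a') \<in> polyfun (family_entry_funs V)" for a a'
      by (intro polyfun_matrix_mult polyfun_adj_matrix ent const)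
    then have "(\<lambda>g. \<Sum>a\<in>UNIV. \<Sum>a'\<in>UNIV. c $ a $ a' * (adj_matrix (g v) ** (l k *\<^sub>R b) ** g v) $ a $ a')
        \<in> polyfun (family_entry_funs V)"
      by (intro polyfun_sum polyfun_mult polyfun_const)
    then show ?thesis by (simp add: M_def[abs_def] ij inner_vec_def)
  qed
  then obtain F where F: "F \<in> polyfun (family_entry_funs V)" "F g0 \<noteq> 0"
    "\<And>g. F g \<noteq> 0 \<Longrightarrow> fdim (solutions (K \<times> B) (C \<times> N) (\<lambda>i j. M i j g)) \<le>
      fdim (solutions (K \<times> B) (C \<times> N) (\<lambda>i j. M i j g0))"
    using generic_fdim_solutions[of "K \<times> B" "C \<times> N" M "family_entry_funs V" g0] fin by blast
  then show ?thesis using sys g0 by (intro bexI[OF _ F(1)]) auto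
qed


section \<open>The topology of the space of assignments\<close>

lemma conj_set_one:
  fixes H :: "(real^'n^'n) set"
  shows "conj_set (mat 1) H = H"
  using matrix_inv_eqI[of "mat 1 :: real^'n^'n" "mat 1"] by (simp add: conj_set_def)

lemma conj_set_mult:
  assumes "invertible g" "invertible h"
  shows "conj_set (g ** h) H = conj_set g (conj_set h H)"
proof -
  have "g ** h ** (matrix_inv h ** matrix_inv g) = g ** (h ** matrix_inv h) ** matrix_inv g"
    "matrix_inv h ** matrix_inv g ** (g ** h) = matrix_inv h ** (matrix_inv g ** g) ** h"
    by (simp_all only: matrix_mul_assoc)
  then have "matrix_inv (g ** h) = matrix_inv h ** matrix_inv g"
    using assms by (intro matrix_inv_eqI) simp_all
  then show ?thesis by (simp add: conj_set_def image_image matrix_mul_assoc)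
qed

lemma continuous_map_polyfun_families:
  fixes F :: "('v \<Rightarrow> real^'n^'n) \<Rightarrow> real"
  assumes "F \<in> polyfun (family_entry_funs V)"
  shows "continuous_map (product_topology (\<lambda>_. top_of_set G) V) euclideanreal F"
  using assms
proof induction
  case (polyfun_gen f)
  then obtain v i j where v: "v \<in> V" "f = (\<lambda>g. g v $ i $ j)" by auto
  have "continuous_map (top_of_set G) euclideanreal (\<lambda>A. A $ i $ j)"
    by (simp add: continuous_on_component)
  from continuous_map_compose[OF continuous_map_product_projection[OF v(1)] this]
  show ?case by (simp add: v(2) comp_def)
qed (auto intro: continuous_map_add continuous_map_real_mult)

lemma openin_polyfun_nonzero:
  fixes F :: "('v \<Rightarrow> real^'n^'n) \<Rightarrow> real"
  assumes "F \<in> polyfun (family_entry_funs V)" "openin (product_topology (\<lambda>_. top_of_set G) V) W"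
  shows "openin (product_topology (\<lambda>_. top_of_set G) V) {g \<in> W. F g \<noteq> 0}"
proof -
  have "openin (product_topology (\<lambda>_. top_of_set G) V)
      {g \<in> topspace (product_topology (\<lambda>_. top_of_set G) V). F g \<in> - {0}}"
    by (rule openin_continuous_map_preimage[OF continuous_map_polyfun_families[OF assms(1)]]) auto
  from openin_Int[OF assms(2) this] show ?thesis
    using openin_subset[OF assms(2)] by (simp add: Collect_conj_eq Int_absorb2 inf.assoc[symmetric])
qed

locale assignment_space =
  fixes V :: "'v set" and E :: "'v set set" and G :: "(real^'n^'n) set" and H :: "(real^'n^'n) set"
  assumes finite_V: "finite V" and edges_subset: "E \<subseteq> Pow V" and closed_G: "closed_matrix_group G"
begin

abbreviation "N \<equiv> normalizer_in G H"
abbreviation "q g \<equiv> g <#\<^bsub>GL\<^esub> N"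
abbreviation "rho \<equiv> assignment_of V E G H"
text \<open>\<open>XP\<close> consists of families of group elements, \<open>XQ\<close> of families
  of cosets. On \<open>XP\<close> the map \<open>rho\<close> is \<open>\<Phi>\<close> after
  \<open>Q\<close>, so open sets of assignments can be tested on \<open>XP\<close>.\<close>

abbreviation "XP \<equiv> product_topology (\<lambda>_. top_of_set G) V"
abbreviation "XQ \<equiv> product_topology (\<lambda>_. coset_topology G N) V"
abbreviation "Q g \<equiv> (\<lambda>v\<in>V. q (g v))"
abbreviation "\<Phi> c \<equiv> rho (\<lambda>v. SOME g. g \<in> c v)"

lemmas G_inv = closed_matrix_groupD(1)[OF closed_G]
  and G_mult = closed_matrix_groupD(3)[OF closed_G]

lemma coset_eq: "q g = (\<lambda>n. g ** n) ` N"
  by (auto simp: l_coset_def GL_def)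

lemma normalizer:
  shows "mat 1 \<in> N" "\<And>m n. m \<in> N \<Longrightarrow> n \<in> N \<Longrightarrow> m ** n \<in> N" "\<And>n. n \<in> N \<Longrightarrow> matrix_inv n \<in> N"
    and "\<And>n. n \<in> N \<Longrightarrow> n \<in> G"
proof -
  show "mat 1 \<in> N" using closed_matrix_groupD(2)[OF closed_G] by (simp add: normalizer_in_def conj_set_one)
  show "m ** n \<in> N" if "m \<in> N" "n \<in> N" for m n
    using that conj_set_mult[of m n H] G_inv G_mult by (simp add: normalizer_in_def)
  show "matrix_inv n \<in> N" if n: "n \<in> N" for n
  proof -
    have nG: "n \<in> G" "conj_set n H = H" using n by (auto simp: normalizer_in_def)
    have inv: "invertible n" "invertible (matrix_inv n)"
      using G_inv[OF nG(1)] by (auto intro: invertible_matrix_inv)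
    have "conj_set (matrix_inv n) (conj_set n H) = H"
      using conj_set_mult[OF inv(2,1), of H] inv(1) by (simp add: conj_set_one)
    then show ?thesis using nG closed_matrix_groupD(4)[OF closed_G nG(1)] by (simp add: normalizer_in_def)
  qed
  show "n \<in> G" if "n \<in> N" for n using that by (simp add: normalizer_in_def)
qed

lemma mem_coset: "g \<in> q g"
  unfolding coset_eq using normalizer(1) by (rule image_eqI[rotated]) simp

lemma mem_cosetE:
  assumes "g' \<in> q g"
  obtains n where "n \<in> N" "g' = g ** n"
  using assms unfolding coset_eq by blast

lemma coset_mult:
  assumes "n \<in> N"
  shows "q (g ** n) = q g"
proof -
  have "(\<lambda>m. n ** m) ` N = N"
  proof (intro equalityI subsetI)
    fix m assume m: "m \<in> N"
    have "n ** (matrix_inv n ** m) = m"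
      using G_inv[OF normalizer(4)[OF assms]] by (simp add: matrix_mul_assoc)
    then show "m \<in> (\<lambda>m. n ** m) ` N" using normalizer(2)[OF normalizer(3)[OF assms] m] by (metis imageI)
  qed (use normalizer(2)[OF assms] in auto)
  then have "(\<lambda>x. g ** x) ` (\<lambda>m. n ** m) ` N = (\<lambda>x. g ** x) ` N" by simp
  then show ?thesis by (simp add: coset_eq image_image matrix_mul_assoc)
qed

lemma conj_set_coset:
  assumes "g \<in> G" "g' \<in> q g"
  shows "conj_set g' H = conj_set g H"
proof -
  obtain n where n: "n \<in> N" "g' = g ** n" using assms(2) by (rule mem_cosetE)
  have "conj_set g' H = conj_set g (conj_set n H)"
    unfolding n(2) using G_inv assms(1) normalizer(4)[OF n(1)] by (intro conj_set_mult)
  then show ?thesis using n(1) by (simp add: normalizer_in_def)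
qed

lemma rho_cong:
  assumes "\<And>v. v \<in> V \<Longrightarrow> conj_set (g v) H = conj_set (g' v) H"
  shows "rho g = rho g'"
  unfolding assignment_of_def
proof (rule restrict_ext)
  fix x assume x: "x \<in> Inl ` V \<union> Inr ` E"
  show "(case x of Inl v \<Rightarrow> conj_set (g v) H | Inr e \<Rightarrow> G \<inter> (\<Inter>v\<in>e. conj_set (g v) H)) =
      (case x of Inl v \<Rightarrow> conj_set (g' v) H | Inr e \<Rightarrow> G \<inter> (\<Inter>v\<in>e. conj_set (g' v) H))"
  proof (cases x)
    case (Inl v) then show ?thesis using x assms by auto
  next
    case (Inr e)
    then have "e \<subseteq> V" using x edges_subset by auto
    then have "(\<Inter>v\<in>e. conj_set (g v) H) = (\<Inter>v\<in>e. conj_set (g' v) H)"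
      using assms by (intro INF_cong) auto
    then show ?thesis using Inr by simp
  qed
qed

lemma topspace_XP: "g \<in> topspace XP \<longleftrightarrow> (\<forall>v\<in>V. g v \<in> G) \<and> g \<in> extensional V"
  by (auto simp: PiE_def)

lemma rho_restrict: "rho (restrict g V) = rho g"
  by (rule rho_cong) simp

lemma rho_XP: "rho ` topspace XP = assignments V E G H"
proof (intro equalityI subsetI)
  fix r assume "r \<in> assignments V E G H"
  then obtain g where g: "r = rho g" "\<forall>v\<in>V. g v \<in> G" by (auto simp: assignments_def)
  then have "r = rho (restrict g V)" "restrict g V \<in> topspace XP"
    by (simp_all only: rho_restrict) (simp add: topspace_XP)
  then show "r \<in> rho ` topspace XP" by blast
qed (auto simp: assignments_def)

text \<open>The chosen representative differs from \<open>g v\<close> by an element of the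
  normalizer, which does not change the conjugate of \<open>H\<close>.\<close>

lemma Phi_Q:
  assumes "g \<in> topspace XP"
  shows "\<Phi> (Q g) = rho g"
proof (rule rho_cong)
  fix v assume v: "v \<in> V"
  have "(SOME g'. g' \<in> Q g v) \<in> q (g v)" using mem_coset[of "g v"] v by (simp add: someI[of "\<lambda>x. x \<in> q (g v)"])
  then show "conj_set (SOME g'. g' \<in> Q g v) H = conj_set (g v) H"
    using assms v by (intro conj_set_coset) (auto simp: topspace_XP)
qed

lemma topspace_coset: "topspace (coset_topology G N) = q ` G"
  by (simp add: coset_topology_def topspace_quotient_topology)

lemma Q_image_PiE:
  assumes "\<And>v. v \<in> V \<Longrightarrow> P v \<subseteq> G"
  shows "Q ` Pi\<^sub>E V P = (\<Pi>\<^sub>E v\<in>V. q ` P v)"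
proof (intro equalityI subsetI)
  fix c assume c: "c \<in> (\<Pi>\<^sub>E v\<in>V. q ` P v)"
  then have "\<forall>v\<in>V. \<exists>g. g \<in> P v \<and> c v = q g" by fastforce
  then obtain g where g: "\<forall>v\<in>V. g v \<in> P v \<and> c v = q (g v)" by metis
  have "c = Q (restrict g V)" using c g by (intro ext) (auto simp: PiE_def extensional_def)
  moreover have "restrict g V \<in> Pi\<^sub>E V P" using g by auto
  ultimately show "c \<in> Q ` Pi\<^sub>E V P" by blast
qed auto

lemma topspace_XQ: "topspace XQ = Q ` topspace XP"
  using Q_image_PiE[of "\<lambda>_. G"] by (simp add: topspace_coset)

lemma Phi_XQ: "\<Phi> ` topspace XQ = assignments V E G H"
  unfolding topspace_XQ image_image using Phi_Q rho_XP by simp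

lemma continuous_q: "continuous_map (top_of_set G) (coset_topology G N) q"
  unfolding continuous_map_def topspace_coset
  by (auto simp: coset_topology_def openin_quotient_topology)

text \<open>The saturation of \<open>W\<close> is a union of right translates of \<open>W\<close> by
  elements of the normalizer.\<close>

lemma open_q:
  assumes "openin (top_of_set G) W"
  shows "openin (coset_topology G N) (q ` W)"
proof -
  have WG: "W \<subseteq> G" using openin_subset[OF assms] by simp
  have "{x \<in> G. q x \<in> q ` W} = (\<Union>n\<in>N. G \<inter> (\<lambda>x. x ** n) -` W)"
  proof (intro equalityI subsetI)
    fix x assume "x \<in> {x \<in> G. q x \<in> q ` W}"
    then obtain w where w: "x \<in> G" "w \<in> W" "q x = q w" by blast
    then obtain n where "n \<in> N" "w = x ** n" using mem_coset[of w] by (auto elim: mem_cosetE)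
    then show "x \<in> (\<Union>n\<in>N. G \<inter> (\<lambda>x. x ** n) -` W)" using w by auto
  next
    fix x assume "x \<in> (\<Union>n\<in>N. G \<inter> (\<lambda>x. x ** n) -` W)"
    then obtain n where n: "n \<in> N" "x \<in> G" "x ** n \<in> W" by auto
    then show "x \<in> {x \<in> G. q x \<in> q ` W}" using coset_mult[OF n(1), of x] by blast
  qed
  moreover have "openin (top_of_set G) (G \<inter> (\<lambda>x. x ** n) -` W)" if "n \<in> N" for n
  proof (rule continuous_openin_preimage[OF _ _ assms])
    show "continuous_on G (\<lambda>x. x ** n)"
      by (intro linear_continuous_on bounded_bilinear.bounded_linear_left[OF bounded_bilinear_matrix_mult])
    show "(\<lambda>x. x ** n) \<in> G \<rightarrow> G" using G_mult normalizer(4)[OF that] by simp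
  qed
  then have "openin (top_of_set G) (\<Union>n\<in>N. G \<inter> (\<lambda>x. x ** n) -` W)" by (intro openin_Union) blast
  ultimately have "openin (top_of_set G) {x \<in> G. q x \<in> q ` W}" by (simp only:)
  then show ?thesis
    using WG by (auto simp: coset_topology_def openin_quotient_topology)
qed

lemma continuous_Q: "continuous_map XP XQ Q"
  unfolding continuous_map_componentwise
proof (intro conjI ballI)
  fix v assume v: "v \<in> V"
  from continuous_map_compose[OF continuous_map_product_projection[OF v] continuous_q]
  show "continuous_map XP (coset_topology G N) (\<lambda>g. Q g v)" using v by (simp add: comp_def)
qed auto

text \<open>An open set around g contains an open box, whose image is the box of the images under
  the open map \<open>q\<close>. As \<open>V\<close> is finite, every box with open sides is
  open.\<close>

lemma open_Q:
  assumes "openin XP W"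
  shows "openin XQ (Q ` W)"
  unfolding openin_product_topology_alt
proof
  fix c assume "c \<in> Q ` W"
  then obtain g where g: "g \<in> W" "c = Q g" by blast
  obtain P where P: "\<And>v. v \<in> V \<Longrightarrow> openin (top_of_set G) (P v)" "g \<in> Pi\<^sub>E V P" "Pi\<^sub>E V P \<subseteq> W"
    using assms[unfolded openin_product_topology_alt] g(1) by (metis (no_types, lifting))
  have PG: "P v \<subseteq> G" if "v \<in> V" for v using openin_subset[OF P(1)[OF that]] by simp
  show "\<exists>U. finite {i \<in> V. U i \<noteq> topspace (coset_topology G N)} \<and>
      (\<forall>i\<in>V. openin (coset_topology G N) (U i)) \<and> c \<in> Pi\<^sub>E V U \<and> Pi\<^sub>E V U \<subseteq> Q ` W"
  proof (intro exI[where x = "\<lambda>v. q ` P v"] conjI ballI)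
    show "openin (coset_topology G N) (q ` P v)" if "v \<in> V" for v by (rule open_q[OF P(1)[OF that]])
    show "c \<in> (\<Pi>\<^sub>E v\<in>V. q ` P v)" using P(2) g(2) by auto
    show "(\<Pi>\<^sub>E v\<in>V. q ` P v) \<subseteq> Q ` W" using Q_image_PiE[of P] PG image_mono[OF P(3), of Q] by simp
  qed (simp add: finite_V)
qed

lemma topspace_assignment_topology: "topspace (assignment_topology V E G H) = assignments V E G H"
  by (simp only: assignment_topology_def topspace_quotient_topology Phi_XQ)

text \<open>A condition on \<open>rho g\<close> depends only on the cosets, so its preimage in
  \<open>XQ\<close> is the image under the open map \<open>Q\<close> of its preimage in
  \<open>XP\<close>.\<close>

lemma openin_assignment_topology:
  assumes "openin XP {g \<in> topspace XP. P (rho g)}"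
  shows "openin (assignment_topology V E G H) {r \<in> assignments V E G H. P r}"
proof -
  have "{c \<in> topspace XQ. \<Phi> c \<in> {r \<in> assignments V E G H. P r}} = {c \<in> topspace XQ. P (\<Phi> c)}"
    using Phi_XQ by blast
  also have "\<dots> = Q ` {g \<in> topspace XP. P (rho g)}"
    unfolding topspace_XQ using Phi_Q by auto
  finally show ?thesis
    unfolding assignment_topology_def openin_quotient_topology Phi_XQ
    using open_Q[OF assms] by auto
qed

lemma openin_rho_preimage:
  assumes "openin (assignment_topology V E G H) W"
  shows "openin XP {g \<in> topspace XP. rho g \<in> W}"
proof -
  have "openin XQ {c \<in> topspace XQ. \<Phi> c \<in> W}"
    using assms by (simp add: assignment_topology_def openin_quotient_topology)
  from openin_continuous_map_preimage[OF continuous_Q this]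
  have "openin XP {g \<in> topspace XP. Q g \<in> {c \<in> topspace XQ. \<Phi> c \<in> W}}" .
  also have "{g \<in> topspace XP. Q g \<in> {c \<in> topspace XQ. \<Phi> c \<in> W}} = {g \<in> topspace XP. rho g \<in> W}"
    unfolding topspace_XQ using Phi_Q by auto
  finally show ?thesis .
qed

lemma generic_set:
  assumes op: "openin XP {g \<in> topspace XP. P (rho g)}"
    and dense: "\<And>W. openin XP W \<Longrightarrow> W \<noteq> {} \<Longrightarrow> \<exists>g\<in>W. P (rho g)"
  defines "U \<equiv> {r \<in> assignments V E G H. P r}"
  shows "openin (assignment_topology V E G H) U"
    "assignment_topology V E G H closure_of U = assignments V E G H"
proof -
  show "openin (assignment_topology V E G H) U"
    unfolding U_def by (rule openin_assignment_topology[OF op])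
  have "U \<inter> W \<noteq> {}" if W: "openin (assignment_topology V E G H) W" "W \<noteq> {}" for W
  proof -
    have "W \<subseteq> rho ` topspace XP"
      using openin_subset[OF W(1)] unfolding topspace_assignment_topology rho_XP .
    then have "{g \<in> topspace XP. rho g \<in> W} \<noteq> {}" using W(2) by blast
    from dense[OF openin_rho_preimage[OF W(1)] this]
    obtain g where "g \<in> topspace XP" "rho g \<in> W" "P (rho g)" by blast
    then show ?thesis using rho_XP unfolding U_def by blast
  qed
  then show "assignment_topology V E G H closure_of U = assignments V E G H"
    using dense_intersects_open[of "assignment_topology V E G H" U]
    by (simp add: topspace_assignment_topology)
qed

text \<open>Around a family where \<delta> is minimal, \<open>F\<close> marks a set on which it
  stays minimal; this gives openness. The \<open>F\<close> of a minimizer is nonzero at one point,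
  so by the identity theorem it is not zero on all of any nonempty open set; this gives
  density.\<close>

theorem generically_constant:
  fixes \<delta> :: "'i \<Rightarrow> ('v + 'v set \<Rightarrow> (real^'n^'n) set) \<Rightarrow> nat"
  assumes "finite I"
    and semi: "\<And>i g0. i \<in> I \<Longrightarrow> \<forall>v\<in>V. g0 v \<in> G \<Longrightarrow> \<exists>F\<in>polyfun (family_entry_funs V). F g0 \<noteq> 0 \<and>
      (\<forall>g. (\<forall>v\<in>V. g v \<in> G) \<longrightarrow> F g \<noteq> 0 \<longrightarrow> \<delta> i (rho g) \<le> \<delta> i (rho g0))"
    and identity: "\<And>F W g. F \<in> polyfun (family_entry_funs V) \<Longrightarrow> openin XP W \<Longrightarrow> W \<noteq> {} \<Longrightarrow>
      (\<And>g. g \<in> W \<Longrightarrow> F g = 0) \<Longrightarrow> \<forall>v\<in>V. g v \<in> G \<Longrightarrow> F g = 0"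
  shows "\<exists>U. U \<subseteq> assignments V E G H \<and> openin (assignment_topology V E G H) U \<and>
    assignment_topology V E G H closure_of U = assignments V E G H \<and>
    (\<exists>m. \<forall>i\<in>I. \<forall>r\<in>U. \<delta> i r = m i)"
proof -
  define m where "m i = (LEAST k. \<exists>g. (\<forall>v\<in>V. g v \<in> G) \<and> \<delta> i (rho g) = k)" for i
  have one: "\<forall>v\<in>V. (\<lambda>_. mat 1) v \<in> G" using closed_matrix_groupD(2)[OF closed_G] by simp
  have "\<exists>g. (\<forall>v\<in>V. g v \<in> G) \<and> \<delta> i (rho g) = m i" for i
    unfolding m_def by (rule LeastI_ex)
      (use one in \<open>auto intro!: exI[where x = "\<delta> i (rho (\<lambda>_. mat 1))"] exI[where x = "\<lambda>_. mat 1"]\<close>)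
  then obtain g0 where g0: "\<And>i. \<forall>v\<in>V. g0 i v \<in> G" "\<And>i. \<delta> i (rho (g0 i)) = m i" by metis
  have least: "m i \<le> \<delta> i (rho g)" if "\<forall>v\<in>V. g v \<in> G" for i g
    unfolding m_def by (rule Least_le) (use that in blast)
  define P where "P r \<longleftrightarrow> (\<forall>i\<in>I. \<delta> i r = m i)" for r
  have local: "\<exists>F\<in>polyfun (family_entry_funs V). F g1 \<noteq> 0 \<and>
      (\<forall>g. (\<forall>v\<in>V. g v \<in> G) \<longrightarrow> F g \<noteq> 0 \<longrightarrow> \<delta> i (rho g) = m i)"
    if i: "i \<in> I" and g1: "\<forall>v\<in>V. g1 v \<in> G" "\<delta> i (rho g1) = m i" for i g1
  proof -
    obtain F where F: "F \<in> polyfun (family_entry_funs V)" "F g1 \<noteq> 0"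
      "\<And>g. \<forall>v\<in>V. g v \<in> G \<Longrightarrow> F g \<noteq> 0 \<Longrightarrow> \<delta> i (rho g) \<le> m i"
      using semi[OF i g1(1)] g1(2) by auto
    have "\<delta> i (rho g) = m i" if "\<forall>v\<in>V. g v \<in> G" "F g \<noteq> 0" for g
      using F(3)[OF that] least[OF that(1), of i] by simp
    then show ?thesis using F(1,2) by blast
  qed
  have op: "openin XP {g \<in> topspace XP. P (rho g)}"
    unfolding openin_subopen[of XP "{g \<in> topspace XP. P (rho g)}"]
  proof
    fix g1 assume g1: "g1 \<in> {g \<in> topspace XP. P (rho g)}"
    then have G1: "\<forall>v\<in>V. g1 v \<in> G" "\<And>i. i \<in> I \<Longrightarrow> \<delta> i (rho g1) = m i"
      unfolding mem_Collect_eq topspace_XP P_def by blast+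
    have "\<forall>i\<in>I. \<exists>F. F \<in> polyfun (family_entry_funs V) \<and> F g1 \<noteq> 0 \<and>
        (\<forall>g. (\<forall>v\<in>V. g v \<in> G) \<longrightarrow> F g \<noteq> 0 \<longrightarrow> \<delta> i (rho g) = m i)"
      using local[OF _ G1(1) G1(2)] by blast
    from bchoice[OF this] obtain F where F':
      "\<forall>i\<in>I. F i \<in> polyfun (family_entry_funs V) \<and> F i g1 \<noteq> 0 \<and>
        (\<forall>g. (\<forall>v\<in>V. g v \<in> G) \<longrightarrow> F i g \<noteq> 0 \<longrightarrow> \<delta> i (rho g) = m i)" ..
    have F: "F i \<in> polyfun (family_entry_funs V)" "F i g1 \<noteq> 0"
      "\<forall>v\<in>V. g v \<in> G \<Longrightarrow> F i g \<noteq> 0 \<Longrightarrow> \<delta> i (rho g) = m i" if "i \<in> I" for i g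
      using F' that by simp_all
    let ?T = "{g \<in> topspace XP. (\<Prod>i\<in>I. F i g) \<noteq> 0}"
    have "openin XP ?T"
      by (intro openin_polyfun_nonzero openin_topspace polyfun_prod F(1))
    moreover have "g1 \<in> ?T" using g1 F(2) assms(1) by (simp del: topspace_product_topology)
    moreover have "?T \<subseteq> {g \<in> topspace XP. P (rho g)}"
    proof
      fix g assume g: "g \<in> ?T"
      then have "F i g \<noteq> 0" if "i \<in> I" for i using that assms(1) by auto
      moreover have "\<forall>v\<in>V. g v \<in> G" using g topspace_XP[of g] by blast
      ultimately show "g \<in> {g \<in> topspace XP. P (rho g)}" using F(3) g unfolding P_def by blast
    qed
    ultimately show "\<exists>T. openin XP T \<and> g1 \<in> T \<and> T \<subseteq> {g \<in> topspace XP. P (rho g)}" by blast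
  qed
  have dense: "\<exists>g\<in>W. P (rho g)" if W: "openin XP W" "W \<noteq> {}" for W
  proof -
    \<comment> \<open>The indices are treated one after another, each shrinking the open set found
      so far to a smaller nonempty one.\<close>
    have "\<exists>W'. openin XP W' \<and> W' \<noteq> {} \<and> W' \<subseteq> W \<and> (\<forall>i\<in>J. \<forall>g\<in>W'. \<delta> i (rho g) = m i)" if "finite J" "J \<subseteq> I" for J
      using that
    proof (induction J)
      case empty then show ?case using W by blast
    next
      case (insert i J)
      then obtain W' where W': "openin XP W'" "W' \<noteq> {}" "W' \<subseteq> W" "\<forall>i\<in>J. \<forall>g\<in>W'. \<delta> i (rho g) = m i" by auto
      obtain F where F: "F \<in> polyfun (family_entry_funs V)" "F (g0 i) \<noteq> 0"
        "\<And>g. \<forall>v\<in>V. g v \<in> G \<Longrightarrow> F g \<noteq> 0 \<Longrightarrow> \<delta> i (rho g) = m i"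
        using local[OF _ g0] insert.prems by blast
      let ?W = "{g \<in> W'. F g \<noteq> 0}"
      have "openin XP ?W" by (rule openin_polyfun_nonzero[OF F(1) W'(1)])
      moreover have "?W \<noteq> {}" using identity[OF F(1) W'(1,2) _ g0(1)[of i]] F(2) by blast
      moreover have "\<delta> j (rho g) = m j" if j: "j \<in> insert i J" and g: "g \<in> ?W" for j g
      proof -
        have "g \<in> topspace XP" using g openin_subset[OF W'(1)] by blast
        then have "\<forall>v\<in>V. g v \<in> G" unfolding topspace_XP by blast
        then show ?thesis using j g F(3) W'(4) by auto
      qed
      ultimately show ?case using W'(3) by (intro exI[of _ ?W]) blast
    qed
    from this[OF assms(1) order.refl]
    obtain W' where W': "W' \<noteq> {}" "W' \<subseteq> W" "\<forall>i\<in>I. \<forall>g\<in>W'. \<delta> i (rho g) = m i" by blast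
    then show ?thesis unfolding P_def by blast
  qed
  show ?thesis
    using generic_set[of P, OF op dense]
    by (intro exI[of _ "{r \<in> assignments V E G H. P r}"]) (auto simp: P_def)
qed

end


section \<open>Dimensions of the motion sheaf cohomology\<close>

lemma incidence_system_cong:
  assumes "\<And>v l. (v, l) \<in> C \<Longrightarrow> h v = h' v"
  shows "incidence_system K B C h = incidence_system K B C h'"
proof -
  have "(\<forall>(v, l)\<in>C. (\<Sum>i\<in>K. l i *\<^sub>R hat B x i) \<in> h v) \<longleftrightarrow>
      (\<forall>(v, l)\<in>C. (\<Sum>i\<in>K. l i *\<^sub>R hat B x i) \<in> h' v)" for x
    using assms by (intro ball_cong) auto
  then show ?thesis by (simp add: incidence_system_def)
qed

text \<open>A one-parameter group lies in an intersection iff it lies in every member.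
  \<open>G\<close> is among the members, so an empty \<open>e\<close> is covered.\<close>

lemma lie_algebra_Inter:
  assumes "closed_matrix_group G" "\<And>v. v \<in> e \<Longrightarrow> closed_matrix_group (K v)"
  shows "lie_algebra (G \<inter> (\<Inter>v\<in>e. K v)) = {X \<in> lie_algebra G. \<forall>v\<in>e. X \<in> lie_algebra (K v)}"
proof -
  have "closed_matrix_group (\<Inter>(insert G (K ` e)))"
    using assms by (intro closed_matrix_group_Inter) auto
  then have "lie_algebra (G \<inter> (\<Inter>v\<in>e. K v)) = lie_exp (G \<inter> (\<Inter>v\<in>e. K v))"
    by (simp add: lie_algebra_eq_lie_exp)
  also have "\<dots> = {X \<in> lie_exp G. \<forall>v\<in>e. X \<in> lie_exp (K v)}" by (auto simp: lie_exp_def)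
  finally show ?thesis using assms by (simp add: lie_algebra_eq_lie_exp)
qed

theorem mainTheorem3:
  fixes V :: "'v set" and E :: "'v set set"
    and G :: "(complex^'n^'n) set" and H :: "(real^'n^'n) set"
    and s :: "'v + 'v set \<Rightarrow> 'v \<times> 'v set \<Rightarrow> real"
  assumes "finite V" and "hypergraph V E"
    and "real_algebraic_group G" and "connectedin zariski G"
    and "subgroup H GL" and "H \<subseteq> real_points G"
    and "closedin (top_of_set (real_points G)) H" and "connected H"
    and "incidence_signs (incidence_graph V E) s"
  shows "\<exists>U. U \<subseteq> assignments V E (real_points G) H \<and>
    openin (assignment_topology V E (real_points G) H) U \<and>
    assignment_topology V E (real_points G) H closure_of U = assignments V E (real_points G) H \<and>
    (\<lambda>\<rho>. vectorspace.dim real_scalars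
       (H0 (incidence_graph V E) s (motion_sheaf (real_points G) \<rho>))) constant_on U \<and>
    (\<lambda>\<rho>. vectorspace.dim real_scalars
       (H1 (incidence_graph V E) s (motion_sheaf (real_points G) \<rho>))) constant_on U"
proof -
  interpret real_alg_group G by unfold_locales (fact assms(3))
  define GR where "GR = real_points G"
  have closed_GR: "closed_matrix_group GR" unfolding GR_def by (rule closed_real_points)
  have closed_H: "closed_matrix_group H"
    using closed_matrix_group_closedin[OF closed_real_points assms(5,7)] .
  have edges: "E \<subseteq> Pow V" using assms(2) by (simp add: hypergraph_def)
  interpret assignment_space V E GR H by unfold_locales (fact assms(1) edges closed_GR)+
  have inv: "invertible g" if "g \<in> GR" for g using closed_matrix_groupD(1)[OF closed_GR that] .
  have closed_conj: "closed_matrix_group (conj_set g H)" if "g \<in> GR" for g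
    by (rule closed_matrix_group_conj[OF closed_H inv[OF that]])
  have conj_sub: "conj_set g H \<subseteq> GR" if "g \<in> GR" for g
    using that assms(6) closed_matrix_groupD(3,4)[OF closed_GR] by (auto simp: conj_set_def GR_def)
  \<comment> \<open>One basis of the Lie algebra serves for all assignments.\<close>
  obtain B where B: "B \<subseteq> lie_algebra GR" "independent B" "lie_algebra GR \<subseteq> span B"
    using real_vector.maximal_independent_subset by blast
  have subspace_lie: "Real_Vector_Spaces.subspace (lie_algebra K)" if "closed_matrix_group K" for K :: "(real^'n^'n) set"
    unfolding lie_algebra_eq_lie_exp[OF that] by (rule subspace_lie_exp[OF that])
  have span_B: "span B = lie_algebra GR"
    using B(1,3) real_vector.span_minimal[OF B(1) subspace_lie[OF closed_GR]] by blast
  have finite_B: "finite B" by (rule independent_imp_finite[OF B(2)])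
  \<comment> \<open>The indices 0, 1 and 2 stand for \<open>S_sys\<close>, \<open>R_sys\<close> and
    \<open>K_sys\<close>.\<close>
  let ?K = "\<lambda>i :: nat. if i = 1 then vert_index V E \<union> arc_index V E else vert_index V E"
  let ?C = "\<lambda>i :: nat. if i = 2 then stalk_conditions V E else arc_conditions V E s"
  define \<delta> where "\<delta> i r = fdim (incidence_system (?K i) B (?C i) (\<lambda>v. lie_algebra (r (Inl v))))"
    for i and r :: "'v + 'v set \<Rightarrow> (real^'n^'n) set"
  have C: "v \<in> V" if "(v, l) \<in> ?C i" for v l i
    using that by (auto simp: stalk_conditions_def arc_conditions_def arcs_def split: if_splits)
  have lie_vertex: "lie_algebra (rho g (Inl v)) = (\<lambda>X. g v ** X ** matrix_inv (g v)) ` lie_exp H"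
    "rho g (Inl v) = conj_set (g v) H"
    if "v \<in> V" "g v \<in> GR" for g v
    using that lie_algebra_eq_lie_exp[OF closed_conj[OF that(2)]] lie_exp_conj[OF inv[OF that(2)], of H]
    by (simp_all add: assignment_of_def)
  have \<delta>: "\<delta> i (rho g) = fdim (incidence_system (?K i) B (?C i) (\<lambda>v. (\<lambda>X. g v ** X ** matrix_inv (g v)) ` lie_exp H))"
    if g: "\<forall>v\<in>V. g v \<in> GR" for i g
    unfolding \<delta>_def using lie_vertex(1)[OF C] g C
    by (intro arg_cong[where f = fdim] incidence_system_cong) blast
  have motion: "motion V E GR (rho g) B" if g: "\<forall>v\<in>V. g v \<in> GR" for g
  proof unfold_locales
    show "finite B" "span B = lie_algebra GR" by (fact finite_B span_B)+
    fix v assume v: "v \<in> V"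
    then have gv: "g v \<in> GR" using g by blast
    show "Real_Vector_Spaces.subspace (lie_algebra (rho g (Inl v)))"
      unfolding lie_vertex(2)[of v g, OF v gv] by (rule subspace_lie[OF closed_conj[OF gv]])
    show "lie_algebra (rho g (Inl v)) \<subseteq> lie_algebra GR"
      using conj_sub[OF gv] unfolding lie_vertex(2)[of v g, OF v gv] by (auto simp: lie_algebra_def)
  next
    fix e assume e: "e \<in> E"
    then have ev: "v \<in> V" "g v \<in> GR" if "v \<in> e" for v using that g edges by auto
    have "rho g (Inr e) = GR \<inter> (\<Inter>v\<in>e. conj_set (g v) H)" using e by (simp add: assignment_of_def)
    then have "lie_algebra (rho g (Inr e)) = {X \<in> lie_algebra GR. \<forall>v\<in>e. X \<in> lie_algebra (conj_set (g v) H)}"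
      using lie_algebra_Inter[OF closed_GR, of e "\<lambda>v. conj_set (g v) H"] closed_conj ev by simp
    then show "lie_algebra (rho g (Inr e)) = {X \<in> lie_algebra GR. \<forall>v\<in>e. X \<in> lie_algebra (rho g (Inl v))}"
      using lie_vertex(2)[of _ g, OF ev] by auto
  qed (fact assms(1) edges)+
  have "\<exists>U. U \<subseteq> assignments V E GR H \<and> openin (assignment_topology V E GR H) U \<and>
    assignment_topology V E GR H closure_of U = assignments V E GR H \<and>
    (\<exists>m. \<forall>i\<in>{0, 1, 2}. \<forall>r\<in>U. \<delta> i r = m i)"
  proof (rule generically_constant)
    show "finite {0, 1, 2 :: nat}" by simp
    fix i :: nat and g0 :: "'v \<Rightarrow> real^'n^'n" assume g0: "\<forall>v\<in>V. g0 v \<in> GR"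
    have fin: "finite (?K i)" using motion.finite_index[OF motion[OF g0]] by simp
    have "\<exists>F\<in>polyfun (family_entry_funs V). F g0 \<noteq> 0 \<and>
      (\<forall>g. (\<forall>v\<in>V. invertible (g v)) \<longrightarrow> F g \<noteq> 0 \<longrightarrow>
        fdim (incidence_system (?K i) B (?C i) (\<lambda>v. (\<lambda>X. g v ** X ** matrix_inv (g v)) ` lie_exp H)) \<le>
        fdim (incidence_system (?K i) B (?C i) (\<lambda>v. (\<lambda>X. g0 v ** X ** matrix_inv (g0 v)) ` lie_exp H)))"
      by (rule generic_fdim_incidence_system[OF subspace_lie_exp[OF closed_H] fin finite_B C])
        (use g0 inv in blast)+
    then show "\<exists>F\<in>polyfun (family_entry_funs V). F g0 \<noteq> 0 \<and>
      (\<forall>g. (\<forall>v\<in>V. g v \<in> GR) \<longrightarrow> F g \<noteq> 0 \<longrightarrow> \<delta> i (rho g) \<le> \<delta> i (rho g0))"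
      using \<delta>[OF g0] \<delta> inv by (metis (no_types, lifting))
  next
    fix F W g assume F: "F \<in> polyfun (family_entry_funs V)" "openin XP W" "W \<noteq> {}"
      "\<And>g. g \<in> W \<Longrightarrow> F g = 0" "\<forall>v\<in>V. g v \<in> GR"
    show "F g = 0"
      by (rule polyfun_identity_families[OF assms(4) assms(1) F(1) F(2)[unfolded GR_def] F(3,4)])
        (use F(5) in \<open>auto simp: GR_def\<close>)
  qed
  then obtain U m where U: "U \<subseteq> assignments V E GR H" "openin (assignment_topology V E GR H) U"
    "assignment_topology V E GR H closure_of U = assignments V E GR H"
    and m: "\<And>i r. i \<in> {0, 1, 2} \<Longrightarrow> r \<in> U \<Longrightarrow> \<delta> i r = m i" by blast
  \<comment> \<open>The subtractions of natural numbers are exact, since \<open>dim_H0\<close> and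
    \<open>dim_H1\<close> state the relations as sums.\<close>
  have dims: "vectorspace.dim real_scalars (H0 (incidence_graph V E) s (motion_sheaf GR \<rho>)) = m 0 - m 2"
    "vectorspace.dim real_scalars (H1 (incidence_graph V E) s (motion_sheaf GR \<rho>)) =
      fdim (supported_on (arc_index V E \<times> B)) + m 0 - m 1" if \<rho>: "\<rho> \<in> U" for \<rho>
  proof -
    obtain g where g: "\<rho> = rho g" "\<forall>v\<in>V. g v \<in> GR" using U(1) \<rho> by (auto simp: assignments_def)
    interpret M: motion V E GR \<rho> s B unfolding g(1) by (rule motion[OF g(2)])
    show "vectorspace.dim real_scalars (H0 (incidence_graph V E) s (motion_sheaf GR \<rho>)) = m 0 - m 2"
      using M.dim_H0 m[OF _ \<rho>, of 0] m[OF _ \<rho>, of 2] by (simp add: \<delta>_def)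
    show "vectorspace.dim real_scalars (H1 (incidence_graph V E) s (motion_sheaf GR \<rho>)) =
        fdim (supported_on (arc_index V E \<times> B)) + m 0 - m 1"
      using M.dim_H1 m[OF _ \<rho>, of 0] m[OF _ \<rho>, of 1] by (simp add: \<delta>_def M.D1_def)
  qed
  show ?thesis
    using U dims unfolding constant_on_def GR_def[symmetric] by blast
qed


end
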